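(* Let $\mathbb{K}$ be an arbitrary field. The algebra $Q^{p,q,r}$ is Koszul for every $(p,q,r)\in\mathbb{K}^3$. The algebra $Q^{p,q,r}$ is PHS if and only if at least two of $p$, $q$ and $r$ are non-zero and the equality $p^3=q^3=r^3$ fails.
   Context: For $(p,q,r)\in\mathbb{K}^3$, the Sklyanin algebra $Q^{p,q,r}$ is the associative unital $\mathbb{K}$-algebra with generators $x,y,z$ and the three relations $pyz+qzy+rxx=0$, $pzx+qxz+ryy=0$, $pxy+qyx+rzz=0$, graded by $\deg x=\deg y=\deg z=1$. For a graded algebra $A$ with finite-dimensional components $A_j$, $H_A(t)=\sum_{j\ge 0}\dim_{\mathbb{K}}A_j\,t^j$ is its Hilbert series. A quadratic algebra $A$ with $3$ generators is called PHS if $H_A(t)=(1-t)^{-3}$. A quadratic algebra $A$ (generated in degree 1 with $A_0=\mathbb{K}$ and quadratic relations) is Koszul if the graded right $A$-module $\mathbb{K}$ (via the augmentation map $A\to\mathbb{K}$) has a free resolution $\dots\to M_m\to\dots\to M_1\to A\to\mathbb{K}\to0$ by graded free right $A$-modules with degree-preserving maps, the second last arrow being the augmentation map and each $M_m$ being generated in degree $m$. *)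

theory Defs
  imports
    "HOL-Algebra.Algebra"
    "HOL-Library.Poly_Mapping"
    "HOL-Computational_Algebra.Formal_Power_Series"
begin

section \<open>The free algebra\<close>

text \<open>Lists form the free monoid under concatenation. With this instance, the multiplication that
  \<^theory>\<open>HOL-Library.Poly_Mapping\<close> puts on finitely supported functions from words to \<open>'k\<close> is
  convolution over concatenation, which makes \<open>'g list \<Rightarrow>\<^sub>0 'k\<close> the free associative unital algebra
  on the generators \<open>'g\<close>.\<close>

instantiation list :: (type) monoid_add
begin

definition zero_list :: "'a list" where "zero_list = []"

definition plus_list :: "'a list \<Rightarrow> 'a list \<Rightarrow> 'a list" where "plus_list = (@)"

instance
  by standard (simp_all add: zero_list_def plus_list_def)

end

type_synonym ('g, 'k) free = "'g list \<Rightarrow>\<^sub>0 'k"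

definition const :: "'k::field \<Rightarrow> ('g, 'k) free" where
  "const c = Poly_Mapping.single [] c"

definition gen :: "'g \<Rightarrow> ('g, 'k::field) free" where
  "gen g = Poly_Mapping.single [g] 1"

definition free_homog :: "nat \<Rightarrow> ('g, 'k::field) free set" where
  "free_homog j = {f. \<forall>w\<in>Poly_Mapping.keys f. length w = j}"

definition free_algebra :: "('g, 'k::field) free ring" where
  "free_algebra =
     \<lparr>carrier = UNIV, monoid.mult = (*), one = 1, ring.zero = 0, add = (+)\<rparr>"


section \<open>Graded algebras and graded right modules\<close>

record 'a graded = "'a ring" +
  homog :: "nat \<Rightarrow> 'a set"

record 'a graded_algebra = "'a graded" +
  scalars :: "'a set"

text \<open>As in the library's record for modules, the fields for multiplication and unit of
  a module are present but meaningless.\<close>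

record ('a, 'm) graded_right_module = "'m graded" +
  act :: "'m \<Rightarrow> 'a \<Rightarrow> 'm"  (infixl \<open>\<triangleleft>\<index>\<close> 70)

definition decomposition :: "('m, 'b) graded_scheme \<Rightarrow> 'm \<Rightarrow> (nat \<Rightarrow> 'm) \<Rightarrow> bool" where
  "decomposition M x c \<longleftrightarrow>
     (\<forall>j. c j \<in> homog M j) \<and> finite {j. c j \<noteq> \<zero>\<^bsub>M\<^esub>} \<and>
     x = (\<Oplus>\<^bsub>M\<^esub>j\<in>{j. c j \<noteq> \<zero>\<^bsub>M\<^esub>}. c j)"

locale graded_right_module = A?: ring A + M?: abelian_group M
  for A :: "('a, 'b) graded_scheme" (structure)
    and M :: "('a, 'm, 'c) graded_right_module_scheme" (structure) +
  assumes act_closed: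
      "\<lbrakk>x \<in> carrier M; a \<in> carrier A\<rbrakk> \<Longrightarrow> x \<triangleleft>\<^bsub>M\<^esub> a \<in> carrier M"
    and act_add_left:
      "\<lbrakk>x \<in> carrier M; y \<in> carrier M; a \<in> carrier A\<rbrakk> \<Longrightarrow>
         (x \<oplus>\<^bsub>M\<^esub> y) \<triangleleft>\<^bsub>M\<^esub> a = x \<triangleleft>\<^bsub>M\<^esub> a \<oplus>\<^bsub>M\<^esub> y \<triangleleft>\<^bsub>M\<^esub> a"
    and act_add_right:
      "\<lbrakk>x \<in> carrier M; a \<in> carrier A; b \<in> carrier A\<rbrakk> \<Longrightarrow>
         x \<triangleleft>\<^bsub>M\<^esub> (a \<oplus>\<^bsub>A\<^esub> b) = x \<triangleleft>\<^bsub>M\<^esub> a \<oplus>\<^bsub>M\<^esub> x \<triangleleft>\<^bsub>M\<^esub> b"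
    and act_mult:
      "\<lbrakk>x \<in> carrier M; a \<in> carrier A; b \<in> carrier A\<rbrakk> \<Longrightarrow>
         x \<triangleleft>\<^bsub>M\<^esub> (a \<otimes>\<^bsub>A\<^esub> b) = (x \<triangleleft>\<^bsub>M\<^esub> a) \<triangleleft>\<^bsub>M\<^esub> b"
    and act_one:
      "x \<in> carrier M \<Longrightarrow> x \<triangleleft>\<^bsub>M\<^esub> \<one>\<^bsub>A\<^esub> = x"
    and homog_subgroup:
      "additive_subgroup (homog M j) M"
    and homog_direct_sum:
      "x \<in> carrier M \<Longrightarrow> \<exists>!c. decomposition M x c"
    and homog_act:
      "\<lbrakk>x \<in> homog M i; a \<in> homog A j\<rbrakk> \<Longrightarrow> x \<triangleleft>\<^bsub>M\<^esub> a \<in> homog M (i + j)"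

definition graded_hom ::
    "('a, 'b) graded_scheme \<Rightarrow> ('a, 'm, 'c) graded_right_module_scheme \<Rightarrow>
     ('a, 'n, 'd) graded_right_module_scheme \<Rightarrow> ('m \<Rightarrow> 'n) set" where
  "graded_hom A M N =
     {f \<in> carrier M \<rightarrow> carrier N.
        (\<forall>x\<in>carrier M. \<forall>y\<in>carrier M. f (x \<oplus>\<^bsub>M\<^esub> y) = f x \<oplus>\<^bsub>N\<^esub> f y) \<and>
        (\<forall>x\<in>carrier M. \<forall>a\<in>carrier A. f (x \<triangleleft>\<^bsub>M\<^esub> a) = f x \<triangleleft>\<^bsub>N\<^esub> a) \<and>
        (\<forall>j. f ` homog M j \<subseteq> homog N j)}"

definition right_span ::
    "('a, 'b) graded_scheme \<Rightarrow> ('a, 'm, 'c) graded_right_module_scheme \<Rightarrow> 'm set \<Rightarrow> 'm set" where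
  "right_span A M S =
     {(\<Oplus>\<^bsub>M\<^esub>s\<in>F. s \<triangleleft>\<^bsub>M\<^esub> c s) | F c. finite F \<and> F \<subseteq> S \<and> c \<in> F \<rightarrow> carrier A}"

definition right_basis ::
    "('a, 'b) graded_scheme \<Rightarrow> ('a, 'm, 'c) graded_right_module_scheme \<Rightarrow> 'm set \<Rightarrow> bool" where
  "right_basis A M B \<longleftrightarrow>
     B \<subseteq> carrier M \<and> right_span A M B = carrier M \<and>
     (\<forall>F c. finite F \<and> F \<subseteq> B \<and> c \<in> F \<rightarrow> carrier A \<and> (\<Oplus>\<^bsub>M\<^esub>b\<in>F. b \<triangleleft>\<^bsub>M\<^esub> c b) = \<zero>\<^bsub>M\<^esub>
        \<longrightarrow> (\<forall>b\<in>F. c b = \<zero>\<^bsub>A\<^esub>))"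

definition graded_free ::
    "('a, 'b) graded_scheme \<Rightarrow> ('a, 'm, 'c) graded_right_module_scheme \<Rightarrow> bool" where
  "graded_free A M \<longleftrightarrow>
     graded_right_module A M \<and> (\<exists>B. B \<subseteq> (\<Union>j. homog M j) \<and> right_basis A M B)"

definition generated_in_degree ::
    "('a, 'b) graded_scheme \<Rightarrow> ('a, 'm, 'c) graded_right_module_scheme \<Rightarrow> nat \<Rightarrow> bool" where
  "generated_in_degree A M m \<longleftrightarrow> right_span A M (homog M m) = carrier M"


section \<open>Koszul algebras and Hilbert series\<close>

text \<open>The projection onto the degree 0 component; for a quadratic algebra that component is the
  ground field.\<close>

definition augmentation :: "('a, 'b) graded_algebra_scheme \<Rightarrow> 'a \<Rightarrow> 'a" where
  "augmentation A a = (THE c. decomposition A a c) 0"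

definition regular_module ::
    "('a, 'b) graded_algebra_scheme \<Rightarrow> ('a, 'a) graded_right_module" where
  "regular_module A =
     \<lparr>carrier = carrier A, monoid.mult = monoid.mult A, one = \<one>\<^bsub>A\<^esub>,
      ring.zero = \<zero>\<^bsub>A\<^esub>, add = add A, homog = homog A, act = monoid.mult A\<rparr>"

definition ground_field_module ::
    "('a, 'b) graded_algebra_scheme \<Rightarrow> ('a, 'a) graded_right_module" where
  "ground_field_module A =
     \<lparr>carrier = scalars A, monoid.mult = monoid.mult A, one = \<one>\<^bsub>A\<^esub>,
      ring.zero = \<zero>\<^bsub>A\<^esub>, add = add A,
      homog = (\<lambda>j. if j = 0 then scalars A else {\<zero>\<^bsub>A\<^esub>}),
      act = (\<lambda>c a. c \<otimes>\<^bsub>A\<^esub> augmentation A a)\<rparr>"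

definition kernel_of ::
    "('m, 'b) ring_scheme \<Rightarrow> ('n, 'c) ring_scheme \<Rightarrow> ('m \<Rightarrow> 'n) \<Rightarrow> 'm set" where
  "kernel_of M N f = {x \<in> carrier M. f x = \<zero>\<^bsub>N\<^esub>}"

text \<open>The resolution is
  \<open>\<dots> \<rightarrow> M\<^sub>3 \<rightarrow> M\<^sub>2 \<rightarrow> M\<^sub>1 \<rightarrow> A \<rightarrow> K \<rightarrow> 0\<close>
  with maps \<open>d m : M\<^bsub>m+1\<^esub> \<rightarrow> M\<^bsub>m\<^esub>\<close> for \<open>m \<ge> 1\<close> and \<open>d\<^sub>1 : M\<^sub>1 \<rightarrow> A\<close>; \<open>M 0\<close> and \<open>d 0\<close> are not used.
  The elements of the modules are taken from the type \<open>nat \<Rightarrow> 'a\<close>, which contains every free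
  \<open>A\<close>-module of countable rank. This is no restriction for quadratic algebras on finitely many
  generators: a resolution as below is minimal, so \<open>M\<^bsub>m\<^esub>\<close> has rank \<open>dim Tor\<^bsub>m\<^esub>(K,K)\<close>,
  which is finite.\<close>

definition koszul :: "('a, 'b) graded_algebra_scheme \<Rightarrow> bool" where
  "koszul A \<longleftrightarrow>
     (\<exists>(M :: nat \<Rightarrow> ('a, nat \<Rightarrow> 'a) graded_right_module) d\<^sub>1 d.
        (\<forall>m\<ge>1. graded_free A (M m) \<and> generated_in_degree A (M m) m) \<and>
        augmentation A \<in> graded_hom A (regular_module A) (ground_field_module A) \<and>
        d\<^sub>1 \<in> graded_hom A (M 1) (regular_module A) \<and>
        (\<forall>m\<ge>1. d m \<in> graded_hom A (M (m + 1)) (M m)) \<and>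
        augmentation A ` carrier (regular_module A) = carrier (ground_field_module A) \<and>
        d\<^sub>1 ` carrier (M 1) =
          kernel_of (regular_module A) (ground_field_module A) (augmentation A) \<and>
        d 1 ` carrier (M 2) = kernel_of (M 1) (regular_module A) d\<^sub>1 \<and>
        (\<forall>m\<ge>1. d (m + 1) ` carrier (M (m + 2)) = kernel_of (M (m + 1)) (M m) (d m)))"

definition hilbert_series :: "('a, 'b) graded_algebra_scheme \<Rightarrow> rat fps" where
  "hilbert_series A = Abs_fps (\<lambda>j. of_nat (ring.dim A (scalars A) (homog A j)))"

definition PHS :: "('a, 'b) graded_algebra_scheme \<Rightarrow> bool" where
  "PHS A \<longleftrightarrow> hilbert_series A = inverse ((1 - fps_X) ^ 3)"


section \<open>Quadratic algebras and Sklyanin algebras\<close>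

text \<open>The set \<open>S\<close> of relations is meant to consist of elements of \<^term>\<open>free_homog 2\<close>. Note that
  \<^const>\<open>genideal\<close> is the two-sided ideal generated by a set.\<close>

definition quadratic_algebra ::
    "('g, 'k::field) free set \<Rightarrow> ('g, 'k) free set graded_algebra" where
  "quadratic_algebra S =
     (let I = genideal free_algebra S;
          Q = free_algebra Quot I;
          proj = (\<lambda>f. I +>\<^bsub>free_algebra\<^esub> f)
      in \<lparr>carrier = carrier Q, monoid.mult = monoid.mult Q, one = \<one>\<^bsub>Q\<^esub>,
          ring.zero = \<zero>\<^bsub>Q\<^esub>, add = add Q,
          homog = (\<lambda>j. proj ` free_homog j),
          scalars = proj ` range const\<rparr>)"

datatype xyz = Gx | Gy | Gz

definition sklyanin :: "'k::field \<Rightarrow> 'k \<Rightarrow> 'k \<Rightarrow> (xyz, 'k) free set graded_algebra" where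
  "sklyanin p q r =
     (let x = gen Gx; y = gen Gy; z = gen Gz
      in quadratic_algebra
          {const p * y * z + const q * z * y + const r * x * x,
           const p * z * x + const q * x * z + const r * y * y,
           const p * x * y + const q * y * x + const r * z * z})"

end

theory Submission
  imports Defs
begin

text \<open>Write \<open>V\<close> for the span of the generators, \<open>R\<close> for the span of the relations, \<open>I\<close> for the ideal,
  \<open>F\<close> for the free algebra and \<open>A = F / I\<close>. The relations are the contractions of a cyclically invariant trilinear form
  with one vector.

  Suppose that two of \<open>p, q, r\<close> are nonzero and \<open>p\<^sup>3 = q\<^sup>3 = r\<^sup>3\<close> fails. Then every contraction of the
  form with a nonzero vector has rank at least 2, so a point of the cubic curve of singular contractions
  determines the next point, and its point module \<open>A / a\<^sup>\<bottom> A\<close> has dimension at most 1 in each degree. For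
  a linear form \<open>u\<close> vanishing at a rational point \<open>a\<close> of the curve, some relation has the form
  \<open>u s + v t\<close> with \<open>u, v\<close> spanning \<open>a\<^sup>\<bottom>\<close> and \<open>t\<close> vanishing at another rational point. By induction
  \<open>dim (A / u A)\<^sub>n \<le> n + 1\<close>, hence \<open>dim A\<^sub>n \<le> dim A\<^sub>n\<^sub>-\<^sub>1 + n + 1\<close>, with equality only if left
  multiplication by \<open>u\<close> is injective in degree \<open>n - 1\<close>. That injectivity makes the Koszul complex exact at
  its left end, so its Euler characteristic gives the opposite inequality and then exactness
  everywhere. As the curve contains the rational point \<open>(1, -1, 0)\<close>, no extension of the field is
  needed.

  In the other cases with \<open>(p, q, r) \<noteq> 0\<close> there is a square matrix \<open>N\<close> of linear forms with \<open>N\<^sup>2 = 0\<close>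
  whose columns span the relations and some combination of whose rows is \<open>(x, y, z)\<close>. Exactness at the
  first step, which holds for every quadratic algebra, then propagates to a resolution with all
  differentials equal to \<open>N\<close>.\<close>

section \<open>Dimensions of finitely generated subspaces\<close>

text \<open>The two estimates feed each other. The Euler characteristic bounds dim A_n from below
  only once left multiplication by u is injective in degree n - 3, and that injectivity is read off
  from the exact dimensions in degrees n - 3 and n - 2. Hence the strong induction: the squeeze in
  degree n costs only what is known below n.

  No automorphism of the curve and no algebraic closure is needed to move from point to point, since
  a singular matrix over K has a kernel vector over K; rank at least 2 then makes every form
  vanishing at the new point available. One rational starting point is enough. The vector (1, -1, 0)
  is a left kernel vector of the contraction with (q, p, r), whatever the parameters are.

  Equations in A are handled as memberships in \<open>I\<close>, and dimensions in A as differences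
  of dimensions of subspaces of one homogeneous component of F, so the quotient appears only when
  the results are transferred to the definitions.

  In the periodic cases PHS already fails in degree 3: it would make the intersection of R V and V R
  one-dimensional, while the entries of (x, y, z) N N give three independent elements of it.\<close>

locale vspace = vector_space scale
  for scale :: "'a::field \<Rightarrow> 'b::ab_group_add \<Rightarrow> 'b" (infixr \<open>*s\<close> 75)
begin

text \<open>The ambient space is infinite-dimensional, and \<open>dim\<close> counts an infinite
  basis as 0, so finiteness is recorded subspace by subspace. The spanning set may lie outside
  \<open>S\<close>, which lets the notion pass to arbitrary subsets.\<close>

definition fin_gen :: "'b set \<Rightarrow> bool" where
  "fin_gen S \<longleftrightarrow> (\<exists>W. finite W \<and> S \<subseteq> local.span W)"

lemma fin_gen_subset: "S \<subseteq> T \<Longrightarrow> fin_gen T \<Longrightarrow> fin_gen S"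
  unfolding fin_gen_def by blast

lemma fin_gen_sums:
  assumes "fin_gen S" "fin_gen T"
  shows "fin_gen {x + y |x y. x \<in> S \<and> y \<in> T}"
proof -
  obtain V W where "finite V" "S \<subseteq> span V" "finite W" "T \<subseteq> span W"
    using assms unfolding fin_gen_def by blast
  then have "finite (V \<union> W)" "{x + y |x y. x \<in> S \<and> y \<in> T} \<subseteq> span (V \<union> W)"
    unfolding span_Un by auto
  then show ?thesis
    unfolding fin_gen_def by blast
qed

lemma independent_finite_if_fin_gen:
  assumes "fin_gen S" "local.independent B" "B \<subseteq> S"
  shows "finite B"
proof -
  obtain W where "finite W" "S \<subseteq> span W"
    using assms(1) unfolding fin_gen_def by blast
  then show ?thesis
    using independent_span_bound[of W B] assms by blast
qed

text \<open>Extending one finite basis to another turns statements about dimensions into statements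
  about cardinalities: the two lemmas below become \<open>card_mono\<close> and
  \<open>card_seteq\<close>.\<close>

lemma nested_bases:
  assumes "subspace S" "subspace T" "S \<subseteq> T" "fin_gen T"
  obtains B C where "B \<subseteq> C" "finite C" "local.independent C" "span B = S" "span C = T"
    "card B = dim S" "card C = dim T"
proof -
  obtain B where B: "B \<subseteq> S" "local.independent B" "S \<subseteq> span B" "card B = dim S"
    using basis_exists by blast
  obtain C where C: "B \<subseteq> C" "C \<subseteq> T" "local.independent C" "T \<subseteq> span C"
    using maximal_independent_subset_extend[of B T] B assms(3) by blast
  show thesis
  proof
    show "finite C"
      using independent_finite_if_fin_gen assms(4) C by blast
    show "span B = S" "span C = T"
      using span_minimal B C assms by (metis subset_antisym)+
    show "card C = dim T"
      using basis_card_eq_dim C by blast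
  qed (use B C in auto)
qed

lemma dim_mono_fin_gen:
  assumes "subspace S" "subspace T" "S \<subseteq> T" "fin_gen T"
  shows "dim S \<le> dim T"
  using nested_bases[OF assms] by (metis card_mono)

lemma subspace_dim_equal_fin_gen:
  assumes "subspace S" "subspace T" "S \<subseteq> T" "fin_gen T" "dim T \<le> dim S"
  shows "S = T"
  using nested_bases[OF assms(1-4)] assms(5) by (metis card_seteq)

lemma dim_direct_sum:
  assumes S: "subspace S" and T: "subspace T" and fin: "fin_gen S" "fin_gen T"
    and triv: "S \<inter> T \<subseteq> {0}"
  shows "dim {x + y |x y. x \<in> S \<and> y \<in> T} = dim S + dim T"
proof -
  obtain B where B: "finite B" "local.independent B" "span B = S" "card B = dim S"
    using nested_bases[OF S S subset_refl fin(1)] by metis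
  obtain C where C: "finite C" "local.independent C" "span C = T" "card C = dim T"
    using nested_bases[OF T T subset_refl fin(2)] by metis
  have disj: "B \<inter> C = {}"
    using triv B C span_base dependent_zero by blast
  have indep: "local.independent (B \<union> C)"
  proof (rule independent_if_scalars_zero)
    show "finite (B \<union> C)"
      using B C by simp
    fix f x
    assume 0: "(\<Sum>x\<in>B \<union> C. f x *s x) = 0" and x: "x \<in> B \<union> C"
    let ?b = "\<Sum>x\<in>B. f x *s x" and ?c = "\<Sum>x\<in>C. f x *s x"
    have eq: "?b + ?c = 0"
      using 0 sum.union_disjoint[OF B(1) C(1) disj, of "\<lambda>x. f x *s x"] by simp
    have b: "?b \<in> S" and c: "?c \<in> T"
      unfolding B(3)[symmetric] C(3)[symmetric] by (simp_all add: span_sum span_scale span_base)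
    have "?b = - ?c"
      using eq by (simp add: eq_neg_iff_add_eq_0)
    then have "?b \<in> T"
      using c subspace_neg[OF T] by simp
    then have b0: "?b = 0"
      using b triv by blast
    then have "?c = 0"
      using eq by simp
    then show "f x = 0"
      using b0 x independentD[OF B(2,1) subset_refl] independentD[OF C(2,1) subset_refl] by blast
  qed
  have "span (B \<union> C) = {x + y |x y. x \<in> S \<and> y \<in> T}"
    unfolding span_Un B C by simp
  then show ?thesis
    using dim_span_eq_card_independent[OF indep] B C disj by (simp add: card_Un_disjoint)
qed

text \<open>Extend a basis \<open>B\<close> of the intersection to a basis \<open>C\<close> of
  \<open>T\<close>. The span of \<open>C - B\<close> complements the intersection in
  \<open>T\<close>, hence it complements \<open>S\<close> in the sum.\<close>

lemma dim_sums_Int_fin_gen: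
  assumes S: "subspace S" and T: "subspace T" and fin: "fin_gen S" "fin_gen T"
  shows "dim {x + y |x y. x \<in> S \<and> y \<in> T} + dim (S \<inter> T) = dim S + dim T"
proof -
  have ST: "subspace (S \<inter> T)"
    using S T by (rule subspace_inter)
  obtain B C where BC: "B \<subseteq> C" "finite C" "local.independent C" "span B = S \<inter> T" "span C = T"
    "card B = dim (S \<inter> T)" "card C = dim T"
    using nested_bases[OF ST T _ fin(2)] by blast
  let ?D = "C - B"
  have indep: "local.independent ?D"
    using BC(3) independent_mono by blast
  have dimD: "dim (span ?D) = dim T - dim (S \<inter> T)"
    using dim_span_eq_card_independent[OF indep] BC
    by (simp add: card_Diff_subset finite_subset)
  have le: "dim (S \<inter> T) \<le> dim T"
    using BC by (metis card_mono)
  have DT: "span ?D \<subseteq> T"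
    using BC(5) span_mono by blast
  have trivD: "span ?D \<inter> span B \<subseteq> {0}"
  proof
    fix x assume x: "x \<in> span ?D \<inter> span B"
    have finBD: "finite ?D" "finite B"
      using BC(1,2) finite_subset by auto
    obtain f where f: "x = (\<Sum>v\<in>?D. f v *s v)"
      using x unfolding span_finite[OF finBD(1)] by blast
    obtain g where g: "x = (\<Sum>v\<in>B. g v *s v)"
      using x unfolding span_finite[OF finBD(2)] by blast
    \<comment> \<open>Two expansions of one element, subtracted, give a linear relation over
      \<open>C\<close>.\<close>
    define h where "h = (\<lambda>v. if v \<in> B then g v else - f v)"
    have "(\<Sum>v\<in>C. h v *s v) = (\<Sum>v\<in>B. h v *s v) + (\<Sum>v\<in>?D. h v *s v)"
      using sum.subset_diff[OF BC(1,2), of "\<lambda>v. h v *s v"] by (simp add: add.commute)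
    also have "\<dots> = (\<Sum>v\<in>B. g v *s v) + (\<Sum>v\<in>?D. - (f v *s v))"
      by (intro arg_cong2[where f = "(+)"] sum.cong) (auto simp: h_def)
    also have "\<dots> = 0"
      using f g by (simp add: sum_negf)
    finally have "\<forall>v\<in>C. h v = 0"
      using independentD[OF BC(3,2) subset_refl] by blast
    then have "\<forall>v\<in>B. g v = 0"
      using BC(1) unfolding h_def by (metis subsetD)
    then show "x \<in> {0}"
      using g by simp
  qed
  have triv: "S \<inter> span ?D \<subseteq> {0}"
    using trivD DT BC(4) by blast
  have "{x + y |x y. x \<in> S \<and> y \<in> T} = {x + y |x y. x \<in> S \<and> y \<in> span ?D}"
  proof (intro subset_antisym subsetI)
    fix z assume "z \<in> {x + y |x y. x \<in> S \<and> y \<in> T}"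
    then obtain x y where xy: "z = x + y" "x \<in> S" "y \<in> T"
      by blast
    have "C = B \<union> ?D"
      using BC(1) by blast
    then have "T = {b + d |b d. b \<in> span B \<and> d \<in> span ?D}"
      using BC(5) span_Un by metis
    then obtain b d where "y = b + d" "b \<in> S" "d \<in> span ?D"
      using xy BC(4) by blast
    then have "z = (x + b) + d" "x + b \<in> S" "d \<in> span ?D"
      using xy subspace_add[OF S] by (auto simp: add.assoc)
    then show "z \<in> {x + y |x y. x \<in> S \<and> y \<in> span ?D}"
      by blast
  qed (use DT in blast)
  moreover have "dim {x + y |x y. x \<in> S \<and> y \<in> span ?D} = dim S + dim (span ?D)"
    by (rule dim_direct_sum[OF S subspace_span fin(1) _ triv]) (use DT fin(2) fin_gen_subset in blast)
  ultimately show ?thesis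
    using dimD le by simp
qed

lemma dim_image_fin_gen:
  assumes "Vector_Spaces.linear scale scale f" "subspace S" "inj_on f S" "fin_gen S"
  shows "dim (f ` S) = dim S" and "fin_gen (f ` S)" and "subspace (f ` S)"
proof -
  interpret f: Vector_Spaces.linear scale scale f by fact
  interpret p: vector_space_pair scale scale ..
  obtain B where B: "finite B" "local.independent B" "span B = S" "card B = dim S"
    using nested_bases[OF assms(2) assms(2) subset_refl assms(4)] by metis
  have "local.independent (f ` B)"
    using p.linear_independent_injective_image[OF assms(1) B(2)] assms(3) B(3) by blast
  moreover have "card (f ` B) = card B"
    using B assms(3) span_superset inj_on_subset card_image by metis
  moreover have "span (f ` B) = f ` S"
    using f.span_image B(3) by blast
  ultimately show "dim (f ` S) = dim S"
    using B(4) dim_span_eq_card_independent by metis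
  show "fin_gen (f ` S)"
    unfolding fin_gen_def using \<open>span (f ` B) = f ` S\<close> B(1) by blast
  show "subspace (f ` S)"
    using \<open>span (f ` B) = f ` S\<close> subspace_span by metis
qed

end

section \<open>The free algebra as a graded vector space\<close>

lemma single_mult_single:
  "Poly_Mapping.single u c * Poly_Mapping.single v d = Poly_Mapping.single (u @ v) (c * d)"
  for u v :: "'g list" and c d :: "'k::field"
  by (simp add: mult_single plus_list_def)

lemma free_induct [case_names single add]:
  fixes f :: "('g, 'k::field) free"
  assumes "\<And>w c. P (Poly_Mapping.single w c)" "\<And>a b. P a \<Longrightarrow> P b \<Longrightarrow> P (a + b)"
  shows "P f"
proof (induction f rule: Poly_Mapping.update_induct)
  case const
  then show ?case
    using assms(1)[of "[]" 0] by simp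
next
  case (update f w c)
  then have "Poly_Mapping.update w c f = f + Poly_Mapping.single w c"
    by (intro poly_mapping_eqI)
      (auto simp: lookup_update lookup_add lookup_single in_keys_iff when_def)
  then show ?case
    using assms update by simp
qed

lemma const_simps [simp]: "const 0 = 0" "const 1 = 1"
  by (simp_all add: const_def flip: zero_list_def)

lemma const_add: "const (a + b) = const a + const b"
  and const_mult: "const (a * b) = const a * const b"
  and const_uminus: "const (- a) = - const a"
  and const_diff: "const (a - b) = const a - const b"
  by (simp_all add: const_def single_add single_mult_single single_uminus single_diff)

lemma const_eq_0_iff [simp]: "const c = 0 \<longleftrightarrow> c = 0"
  by (metis const_def const_simps(1) lookup_single_eq)

lemma const_commute: "f * const c = const c * f"
  by (induction f rule: free_induct)
    (simp_all add: const_def single_mult_single algebra_simps)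

lemma const_left_commute: "f * (const c * h) = const c * (f * h)"
  by (metis const_commute mult.assoc)

lemma lookup_Nil_single: "Poly_Mapping.lookup (Poly_Mapping.single w c) [] = (if w = [] then c else 0)"
  by (simp add: lookup_single when_def)

lemma lookup_Nil_const [simp]: "Poly_Mapping.lookup (const c) [] = c"
  by (simp add: const_def)

lemma lookup_Nil_mult [simp]:
  "Poly_Mapping.lookup (a * b) [] = Poly_Mapping.lookup a [] * Poly_Mapping.lookup b []"
  for a b :: "('g, 'k::field) free"
proof (induction a rule: free_induct)
  case (single u c)
  show ?case
    by (induction b rule: free_induct)
      (simp_all add: single_mult_single lookup_Nil_single lookup_add algebra_simps)
qed (simp add: lookup_add algebra_simps)

lemma lookup_Nil_gen [simp]: "Poly_Mapping.lookup (gen g) [] = 0"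
  by (simp add: gen_def lookup_Nil_single)

definition smul :: "'k::field \<Rightarrow> ('g, 'k) free \<Rightarrow> ('g, 'k) free" where
  "smul c f = const c * f"

global_interpretation free_space: vspace smul
  by unfold_locales (simp_all add: smul_def const_add const_mult algebra_simps)

text \<open>Every element without constant term is uniquely of the form \<open>\<Sum>g. gen g * f g\<close>; the operator
  \<open>dl g\<close> extracts \<open>f g\<close>.\<close>

definition dl :: "'g \<Rightarrow> ('g, 'k::field) free \<Rightarrow> ('g, 'k) free" where
  "dl g f = Poly_Mapping.map_key ((#) g) f"

lemma lookup_dl [simp]: "Poly_Mapping.lookup (dl g f) w = Poly_Mapping.lookup f (g # w)"
  by (simp add: dl_def map_key.rep_eq)

lemma dl_add [simp]: "dl g (a + b) = dl g a + dl g b"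
  and dl_diff [simp]: "dl g (a - b) = dl g a - dl g b"
  and dl_uminus [simp]: "dl g (- a) = - dl g a"
  and dl_zero [simp]: "dl g 0 = 0"
  by (auto intro!: poly_mapping_eqI simp: lookup_add lookup_minus)

lemma dl_sum [simp]: "dl g (sum f S) = (\<Sum>s\<in>S. dl g (f s))"
  by (induction S rule: infinite_finite_induct) simp_all

lemma dl_single: "dl g (Poly_Mapping.single w c) =
    (if w \<noteq> [] \<and> hd w = g then Poly_Mapping.single (tl w) c else 0)"
  by (cases w) (auto intro!: poly_mapping_eqI simp: lookup_single when_def)

lemma dl_const [simp]: "dl g (const c) = 0"
  by (simp add: const_def dl_single)

text \<open>A Leibniz rule twisted by the augmentation: the first letter of a product comes from
  \<open>a\<close> unless the word contributed by \<open>a\<close> is empty.\<close>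

lemma dl_mult: "dl g (a * b) = dl g a * b + const (Poly_Mapping.lookup a []) * dl g b"
proof (induction a rule: free_induct)
  case (single u c)
  show ?case
  proof (induction b rule: free_induct)
    case (single v d)
    show ?case
      by (cases u) (simp_all add: dl_single single_mult_single lookup_Nil_single const_def)
  qed (simp add: algebra_simps)
qed (simp add: algebra_simps const_add lookup_add)

lemma dl_gen [simp]: "dl g (gen h) = (if g = h then 1 else 0)"
  by (simp add: gen_def dl_single flip: zero_list_def)

lemma dl_gen_mult [simp]: "dl g (gen h * f) = (if g = h then f else 0)"
  by (simp add: dl_mult)

lemma dl_const_mult [simp]: "dl g (const c * f) = const c * dl g f"
  by (simp add: dl_mult)

lemma gen_expansion:
  fixes f :: "('g::finite, 'k::field) free"
  shows "f = const (Poly_Mapping.lookup f []) + (\<Sum>g\<in>UNIV. gen g * dl g f)"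
proof (induction f rule: free_induct)
  case (single w c)
  show ?case
  proof (cases w)
    case Nil
    then show ?thesis
      by (simp add: dl_single const_def)
  next
    case (Cons h v)
    have "(\<Sum>g\<in>UNIV. gen g * dl g (Poly_Mapping.single w c)) =
      (\<Sum>g\<in>UNIV. if h = g then gen h * Poly_Mapping.single v c else 0)"
      using Cons by (intro sum.cong) (auto simp: dl_single)
    then show ?thesis
      using Cons by (simp add: gen_def single_mult_single lookup_Nil_single)
  qed
next
  case (add a b)
  have "a + b = (const (Poly_Mapping.lookup a []) + (\<Sum>g\<in>UNIV. gen g * dl g a)) +
      (const (Poly_Mapping.lookup b []) + (\<Sum>g\<in>UNIV. gen g * dl g b))"
    using add.IH by simp
  also have "\<dots> = const (Poly_Mapping.lookup (a + b) []) + (\<Sum>g\<in>UNIV. gen g * dl g (a + b))"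
    by (simp add: lookup_add const_add algebra_simps sum.distrib)
  finally show ?case .
qed

lemma gen_comb_eq_iff:
  fixes f h :: "'g::finite \<Rightarrow> ('g, 'k::field) free"
  shows "(\<Sum>g\<in>UNIV. gen g * f g) = (\<Sum>g\<in>UNIV. gen g * h g) \<longleftrightarrow> f = h"
proof
  assume eq: "(\<Sum>g\<in>UNIV. gen g * f g) = (\<Sum>g\<in>UNIV. gen g * h g)"
  have "f g = h g" for g
    using arg_cong[OF eq, of "dl g"] by simp
  then show "f = h" ..
qed simp

section \<open>Homogeneous elements and components\<close>

lemma free_homog_iff: "f \<in> free_homog n \<longleftrightarrow> (\<forall>w. length w \<noteq> n \<longrightarrow> Poly_Mapping.lookup f w = 0)"
  by (auto simp: free_homog_def in_keys_iff)

lemma free_homog_zero [simp, intro]: "0 \<in> free_homog n"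
  and free_homog_add [intro]: "a \<in> free_homog n \<Longrightarrow> b \<in> free_homog n \<Longrightarrow> a + b \<in> free_homog n"
  and free_homog_uminus [intro]: "a \<in> free_homog n \<Longrightarrow> - a \<in> free_homog n"
  and free_homog_diff [intro]: "a \<in> free_homog n \<Longrightarrow> b \<in> free_homog n \<Longrightarrow> a - b \<in> free_homog n"
  by (simp_all add: free_homog_iff lookup_add lookup_minus)

lemma free_homog_sum [intro]: "(\<And>s. s \<in> S \<Longrightarrow> f s \<in> free_homog n) \<Longrightarrow> sum f S \<in> free_homog n"
  by (induction S rule: infinite_finite_induct) auto

lemma const_in_free_homog [simp, intro]: "const c \<in> free_homog 0"
  and gen_in_free_homog [simp, intro]: "gen g \<in> free_homog (Suc 0)"
  by (auto simp: free_homog_iff const_def gen_def lookup_single when_def)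

lemma free_homog_mult:
  assumes "a \<in> free_homog i" "b \<in> free_homog j"
  shows "a * b \<in> free_homog (i + j)"
  using keys_mult[of a b] assms by (fastforce simp: free_homog_def plus_list_def)

lemma free_homog_mult': "a \<in> free_homog i \<Longrightarrow> b \<in> free_homog j \<Longrightarrow> n = i + j \<Longrightarrow> a * b \<in> free_homog n"
  using free_homog_mult by blast

lemma const_mult_free_homog [intro]: "f \<in> free_homog n \<Longrightarrow> const c * f \<in> free_homog n"
  using free_homog_mult[of "const c" 0 f n] by simp

lemma dl_in_free_homog [intro]: "f \<in> free_homog (Suc n) \<Longrightarrow> dl g f \<in> free_homog n"
  by (simp add: free_homog_iff)

lemma free_homog_0_eq: "free_homog 0 = range const"
proof (intro subset_antisym subsetI)
  fix f :: "('g, 'k::field) free"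
  assume "f \<in> free_homog 0"
  then have "f = const (Poly_Mapping.lookup f [])"
    by (intro poly_mapping_eqI) (auto simp: free_homog_iff const_def lookup_single when_def)
  then show "f \<in> range const"
    by blast
qed auto

lemma lookup_Nil_free_homog: "f \<in> free_homog (Suc n) \<Longrightarrow> Poly_Mapping.lookup f [] = 0"
  by (simp add: free_homog_iff)

lemma subspace_free_homog: "free_space.subspace (free_homog n)"
  by (auto simp: free_space.subspace_def smul_def)

definition hcomp :: "nat \<Rightarrow> ('g, 'k::field) free \<Rightarrow> ('g, 'k) free" where
  "hcomp n f = Poly_Mapping.mapp (\<lambda>w c. if length w = n then c else 0) f"

lemma lookup_hcomp [simp]:
  "Poly_Mapping.lookup (hcomp n f) w = (if length w = n then Poly_Mapping.lookup f w else 0)"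
  by (auto simp: hcomp_def lookup_mapp when_def in_keys_iff)

lemma hcomp_add [simp]: "hcomp n (a + b) = hcomp n a + hcomp n b"
  and hcomp_diff [simp]: "hcomp n (a - b) = hcomp n a - hcomp n b"
  and hcomp_uminus [simp]: "hcomp n (- a) = - hcomp n a"
  and hcomp_zero [simp]: "hcomp n 0 = 0"
  by (auto intro!: poly_mapping_eqI simp: lookup_add lookup_minus)

lemma hcomp_sum [simp]: "hcomp n (sum f S) = (\<Sum>s\<in>S. hcomp n (f s))"
  by (induction S rule: infinite_finite_induct) simp_all

lemma hcomp_in_free_homog [simp, intro]: "hcomp n f \<in> free_homog n"
  by (simp add: free_homog_iff)

lemma hcomp_free_homog: "f \<in> free_homog m \<Longrightarrow> hcomp n f = (if n = m then f else 0)"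
  by (auto intro!: poly_mapping_eqI simp: free_homog_iff)

lemma finite_hcomp: "finite {n. hcomp n f \<noteq> 0}"
proof (rule finite_subset)
  show "{n. hcomp n f \<noteq> 0} \<subseteq> length ` Poly_Mapping.keys f"
  proof
    fix n assume "n \<in> {n. hcomp n f \<noteq> 0}"
    then obtain w where "Poly_Mapping.lookup (hcomp n f) w \<noteq> 0"
      by (metis (mono_tags) lookup_zero mem_Collect_eq poly_mapping_eqI)
    then show "n \<in> length ` Poly_Mapping.keys f"
      by (auto simp: in_keys_iff split: if_splits)
  qed
qed simp

text \<open>\<open>N\<close> may exceed the support, so that one index set can serve several
  elements at once, as in \<open>exact_2\<close>.\<close>

lemma sum_hcomp:
  assumes "finite N" "{n. hcomp n f \<noteq> 0} \<subseteq> N"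
  shows "(\<Sum>n\<in>N. hcomp n f) = f"
proof (rule poly_mapping_eqI)
  fix w
  have "(\<Sum>n\<in>N. Poly_Mapping.lookup (hcomp n f) w) =
      (\<Sum>n\<in>N. if n = length w then Poly_Mapping.lookup f w else 0)"
    by (intro sum.cong) auto
  also have "\<dots> = Poly_Mapping.lookup f w"
  proof (cases "length w \<in> N")
    case False
    then have "hcomp (length w) f = 0"
      using assms(2) by blast
    then have "Poly_Mapping.lookup f w = 0"
      by (metis lookup_hcomp lookup_zero)
    then show ?thesis
      by (simp only: if_distrib cong: if_cong) simp
  qed (use assms(1) in simp)
  finally show "Poly_Mapping.lookup (\<Sum>n\<in>N. hcomp n f) w = Poly_Mapping.lookup f w"
    by (simp add: lookup_sum)
qed

lemma hcomp_mult_left: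
  assumes "a \<in> free_homog i"
  shows "hcomp n (a * f) = (if i \<le> n then a * hcomp (n - i) f else 0)"
proof -
  have "hcomp n (a * f) = (\<Sum>m\<in>{m. hcomp m f \<noteq> 0}. hcomp n (a * hcomp m f))"
    by (metis finite_hcomp hcomp_sum order_refl sum_distrib_left sum_hcomp)
  also have "\<dots> = (\<Sum>m\<in>{m. hcomp m f \<noteq> 0}. if m = n - i \<and> i \<le> n then a * hcomp m f else 0)"
    by (intro sum.cong) (auto simp: hcomp_free_homog[OF free_homog_mult[OF assms hcomp_in_free_homog]])
  also have "\<dots> = (if i \<le> n then a * hcomp (n - i) f else 0)"
    using finite_hcomp[of f] by auto
  finally show ?thesis .
qed

lemma hcomp_mult_right:
  assumes "a \<in> free_homog i"
  shows "hcomp n (f * a) = (if i \<le> n then hcomp (n - i) f * a else 0)"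
proof -
  have "hcomp n (f * a) = (\<Sum>m\<in>{m. hcomp m f \<noteq> 0}. hcomp n (hcomp m f * a))"
    by (metis finite_hcomp hcomp_sum order_refl sum_distrib_right sum_hcomp)
  also have "\<dots> = (\<Sum>m\<in>{m. hcomp m f \<noteq> 0}. if m = n - i \<and> i \<le> n then hcomp m f * a else 0)"
    by (intro sum.cong) (auto simp: hcomp_free_homog[OF free_homog_mult[OF hcomp_in_free_homog assms]])
  also have "\<dots> = (if i \<le> n then hcomp (n - i) f * a else 0)"
    using finite_hcomp[of f] by auto
  finally show ?thesis .
qed

section \<open>Products of a family with a subspace: V U for \<open>gen\<close>, R U for the
  relations\<close>

definition lcomb :: "('i \<Rightarrow> ('g, 'k::field) free) \<Rightarrow> 'i set \<Rightarrow> ('g, 'k) free set \<Rightarrow> ('g, 'k) free set" where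
  "lcomb a J U = {\<Sum>k\<in>J. a k * f k |f. \<forall>k\<in>J. f k \<in> U}"

lemma lcombI: "(\<And>k. k \<in> J \<Longrightarrow> f k \<in> U) \<Longrightarrow> (\<Sum>k\<in>J. a k * f k) \<in> lcomb a J U"
  unfolding lcomb_def by blast

lemma lcombE:
  assumes "x \<in> lcomb a J U"
  obtains f where "x = (\<Sum>k\<in>J. a k * f k)" "\<And>k. k \<in> J \<Longrightarrow> f k \<in> U"
  using assms unfolding lcomb_def by blast

lemma lcomb_insert:
  assumes "finite J" "j \<notin> J"
  shows "lcomb a (insert j J) U = {x + y |x y. x \<in> (*) (a j) ` U \<and> y \<in> lcomb a J U}"
proof (intro subset_antisym subsetI)
  fix z assume "z \<in> lcomb a (insert j J) U"
  then obtain f where f: "z = a j * f j + (\<Sum>k\<in>J. a k * f k)" "f j \<in> U" "\<forall>k\<in>J. f k \<in> U"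
    using assms by (auto simp: lcomb_def)
  then have "a j * f j \<in> (*) (a j) ` U" "(\<Sum>k\<in>J. a k * f k) \<in> lcomb a J U"
    by (auto intro!: lcombI)
  then show "z \<in> {x + y |x y. x \<in> (*) (a j) ` U \<and> y \<in> lcomb a J U}"
    using f(1) by blast
next
  fix z assume "z \<in> {x + y |x y. x \<in> (*) (a j) ` U \<and> y \<in> lcomb a J U}"
  then obtain u f where z: "z = a j * u + (\<Sum>k\<in>J. a k * f k)" "u \<in> U" "\<forall>k\<in>J. f k \<in> U"
    by (auto simp: lcomb_def)
  let ?f = "f(j := u)"
  have "(\<Sum>k\<in>J. a k * ?f k) = (\<Sum>k\<in>J. a k * f k)"
    using assms(2) by (intro sum.cong) auto
  then have "z = (\<Sum>k\<in>insert j J. a k * ?f k)"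
    unfolding z(1) sum.insert[OF assms] by simp
  then show "z \<in> lcomb a (insert j J) U"
    using z(2,3) lcombI[of "insert j J" ?f U a] by (metis fun_upd_apply insert_iff)
qed

lemma linear_mult_left: "Vector_Spaces.linear smul smul ((*) a)"
  by (intro Vector_Spaces.linear_iff[THEN iffD2] conjI free_space.vector_space_axioms)
    (simp_all add: smul_def algebra_simps const_left_commute)

lemma subspace_lcomb:
  assumes "free_space.subspace U"
  shows "free_space.subspace (lcomb a J U)"
proof (rule free_space.subspaceI)
  show "0 \<in> lcomb a J U"
    using lcombI[of J "\<lambda>_. 0" U a] free_space.subspace_0[OF assms] by simp
next
  fix x y assume "x \<in> lcomb a J U" "y \<in> lcomb a J U"
  then obtain f h where "x = (\<Sum>k\<in>J. a k * f k)" "\<forall>k\<in>J. f k \<in> U"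
    "y = (\<Sum>k\<in>J. a k * h k)" "\<forall>k\<in>J. h k \<in> U"
    by (auto simp: lcomb_def)
  then show "x + y \<in> lcomb a J U"
    using lcombI[of J "\<lambda>k. f k + h k" U a] free_space.subspace_add[OF assms]
    by (simp add: distrib_left sum.distrib)
next
  fix c x assume "x \<in> lcomb a J U"
  then obtain f where "x = (\<Sum>k\<in>J. a k * f k)" "\<forall>k\<in>J. f k \<in> U"
    by (auto simp: lcomb_def)
  then show "smul c x \<in> lcomb a J U"
    using lcombI[of J "\<lambda>k. smul c (f k)" U a] free_space.subspace_scale[OF assms]
    by (simp add: smul_def const_left_commute sum_distrib_left)
qed

lemma dim_singleton_0: "free_space.dim {0} = 0"
  by (rule free_space.dim_unique[of "{}"])
    (auto simp: free_space.span_zero free_space.independent_empty)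

lemma lcomb_zero: "lcomb a J {0} = {0}"
  by (auto simp: lcomb_def intro: exI[of _ "\<lambda>_. 0"])

text \<open>Right independence of the \<open>a k\<close> makes \<open>lcomb a J U\<close> a direct
  sum of \<open>card J\<close> copies of \<open>U\<close>. The coefficients in the hypothesis range
  over the whole free algebra, so that one fact about \<open>gen\<close> or the relations serves all
  degrees and all \<open>U\<close>.\<close>

lemma dim_lcomb:
  assumes "finite J" and sub: "free_space.subspace U" and fin: "free_space.fin_gen U"
    and inj: "\<And>f. (\<Sum>k\<in>J. a k * f k) = 0 \<Longrightarrow> \<forall>k\<in>J. f k = 0"
  shows "free_space.fin_gen (lcomb a J U) \<and> free_space.dim (lcomb a J U) = card J * free_space.dim U"
  using assms(1,4)
proof (induction J)
  case empty
  have "lcomb a {} U = {0}"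
    by (simp add: lcomb_def)
  moreover have "free_space.fin_gen {0}"
    unfolding free_space.fin_gen_def by (intro exI[of _ "{0}"]) (simp add: free_space.span_zero)
  ultimately show ?case
    by (simp add: dim_singleton_0)
next
  case (insert j J)
  have aj: "h = 0" if "a j * h = 0" for h
  proof -
    let ?f = "(\<lambda>_. 0)(j := h)"
    have "(\<Sum>k\<in>J. a k * ?f k) = 0"
      using insert.hyps by (intro sum.neutral) auto
    then have "(\<Sum>k\<in>insert j J. a k * ?f k) = 0"
      unfolding sum.insert[OF insert.hyps] using that by simp
    then show ?thesis
      using insert.prems[of ?f] by simp
  qed
  have injJ: "\<forall>k\<in>J. f k = 0" if "(\<Sum>k\<in>J. a k * f k) = 0" for f
  proof -
    let ?f = "f(j := 0)"
    have "(\<Sum>k\<in>J. a k * ?f k) = (\<Sum>k\<in>J. a k * f k)"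
      using insert.hyps by (intro sum.cong) auto
    then have "(\<Sum>k\<in>insert j J. a k * ?f k) = 0"
      unfolding sum.insert[OF insert.hyps] using that by simp
    then have "\<forall>k\<in>insert j J. ?f k = 0"
      by (rule insert.prems)
    then show ?thesis
      using insert.hyps by (metis fun_upd_other insertCI)
  qed
  have inj_aj: "inj_on ((*) (a j)) U"
  proof (rule inj_onI)
    fix x y assume "a j * x = a j * y"
    then have "a j * (x - y) = 0"
      by (simp add: right_diff_distrib)
    then show "x = y"
      using aj[of "x - y"] by simp
  qed
  note img = free_space.dim_image_fin_gen[OF linear_mult_left sub inj_aj fin]
  have IH: "free_space.fin_gen (lcomb a J U)"
    "free_space.dim (lcomb a J U) = card J * free_space.dim U"
    using insert.IH injJ by blast+
  have triv: "(*) (a j) ` U \<inter> lcomb a J U \<subseteq> {0}"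
  proof
    fix x assume xin: "x \<in> (*) (a j) ` U \<inter> lcomb a J U"
    then obtain u where u: "x = a j * u"
      by blast
    obtain f where f: "x = (\<Sum>k\<in>J. a k * f k)"
      using xin by (blast elim: lcombE)
    let ?f = "f(j := - u)"
    have "(\<Sum>k\<in>J. a k * ?f k) = (\<Sum>k\<in>J. a k * f k)"
      using insert.hyps by (intro sum.cong) auto
    then have "(\<Sum>k\<in>insert j J. a k * ?f k) = 0"
      unfolding sum.insert[OF insert.hyps] using u f by simp
    then have "?f j = 0"
      using insert.prems by blast
    then have "u = 0"
      by simp
    then show "x \<in> {0}"
      using u by simp
  qed
  show ?case
    unfolding lcomb_insert[OF insert.hyps]
    using free_space.fin_gen_sums[OF img(2) IH(1)] insert.hyps
      free_space.dim_direct_sum[OF img(3) subspace_lcomb[OF sub] img(2) IH(1) triv] img(1) IH(2)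
    by simp
qed

lemma free_homog_Suc_eq: "free_homog (Suc n) = lcomb gen (UNIV :: 'g::finite set) (free_homog n)"
proof (intro subset_antisym subsetI)
  fix f :: "('g, 'k::field) free"
  assume f: "f \<in> free_homog (Suc n)"
  have "f = (\<Sum>g\<in>UNIV. gen g * dl g f)"
    using gen_expansion[of f] lookup_Nil_free_homog[OF f] by simp
  then show "f \<in> lcomb gen UNIV (free_homog n)"
    using f lcombI[of UNIV "\<lambda>g. dl g f" "free_homog n" gen] dl_in_free_homog by metis
next
  fix f :: "('g, 'k::field) free"
  assume "f \<in> lcomb gen UNIV (free_homog n)"
  then show "f \<in> free_homog (Suc n)"
    by (auto elim!: lcombE intro!: free_homog_mult'[OF gen_in_free_homog])
qed

lemma gen_comb_eq_0: "(\<Sum>g\<in>UNIV. gen g * f g) = 0 \<Longrightarrow> \<forall>g\<in>(UNIV :: 'g::finite set). f g = 0"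
  using gen_comb_eq_iff[of f "\<lambda>_. 0"] by (auto simp: fun_eq_iff)

lemma dim_free_homog:
  "free_space.fin_gen (free_homog n :: ('g::finite, 'k::field) free set) \<and>
   free_space.dim (free_homog n :: ('g, 'k) free set) = card (UNIV :: 'g set) ^ n"
proof (induction n)
  case 0
  have eq: "free_homog 0 = free_space.span {1 :: ('g, 'k) free}"
    unfolding free_homog_0_eq free_space.span_singleton by (simp add: smul_def)
  have "free_space.independent {1 :: ('g, 'k) free}"
    by simp
  then show ?case
    using free_space.dim_span_eq_card_independent[of "{1 :: ('g, 'k) free}"]
    by (auto simp: eq free_space.fin_gen_def)
next
  case (Suc n)
  then show ?case
    unfolding free_homog_Suc_eq
    using dim_lcomb[OF finite subspace_free_homog, of n gen, OF _ gen_comb_eq_0] by auto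
qed

lemma hcomp_lcomb:
  assumes "\<And>k. k \<in> J \<Longrightarrow> a k \<in> free_homog i" "i \<le> n"
  shows "hcomp n (\<Sum>k\<in>J. a k * f k) = (\<Sum>k\<in>J. a k * hcomp (n - i) (f k))"
  using assms by (simp add: hcomp_mult_left[of _ i])

section \<open>Ideals of quadratic relations\<close>

lemma free_algebra_simps [simp]:
  "carrier free_algebra = UNIV" "a \<otimes>\<^bsub>free_algebra\<^esub> b = a * b" "\<one>\<^bsub>free_algebra\<^esub> = 1"
  "\<zero>\<^bsub>free_algebra\<^esub> = 0" "a \<oplus>\<^bsub>free_algebra\<^esub> b = a + b"
  by (simp_all add: free_algebra_def)

lemma ring_free_algebra: "ring (free_algebra :: ('g, 'k::field) free ring)"
proof (rule ringI)
  show "abelian_group (free_algebra :: ('g, 'k) free ring)"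
    by (rule abelian_groupI) (auto simp: algebra_simps intro: exI[of _ "- x" for x])
  show "Group.monoid (free_algebra :: ('g, 'k) free ring)"
    by (rule monoidI) (auto simp: algebra_simps)
qed (auto simp: algebra_simps)

lemma free_algebra_a_inv [simp]: "\<ominus>\<^bsub>free_algebra\<^esub> (a :: ('g, 'k::field) free) = - a"
proof -
  interpret ring "free_algebra :: ('g, 'k) free ring"
    by (rule ring_free_algebra)
  show ?thesis
    by (rule minus_equality) simp_all
qed

lemma ideal_free_algebraI:
  fixes J :: "('g, 'k::field) free set"
  assumes "0 \<in> J" "\<And>a b. a \<in> J \<Longrightarrow> b \<in> J \<Longrightarrow> a + b \<in> J"
    "\<And>a f. a \<in> J \<Longrightarrow> f * a \<in> J" "\<And>a f. a \<in> J \<Longrightarrow> a * f \<in> J"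
  shows "ideal J free_algebra"
proof (rule idealI[OF ring_free_algebra])
  have neg: "- a \<in> J" if "a \<in> J" for a
    using assms(3)[OF that, of "- 1"] by simp
  interpret R: ring "free_algebra :: ('g, 'k) free ring"
    by (rule ring_free_algebra)
  have "inv\<^bsub>add_monoid free_algebra\<^esub> a = - a" for a :: "('g, 'k) free"
    using free_algebra_a_inv[of a] by (simp add: a_inv_def)
  then show "subgroup J (add_monoid free_algebra)"
    using assms neg by (intro group.subgroupI R.a_group) auto
qed (use assms in auto)

locale quadratic_relations =
  fixes r :: "'i::finite \<Rightarrow> ('g::finite, 'k::field) free"
  assumes rel_homog: "r k \<in> free_homog 2"
begin

definition I :: "('g, 'k) free set" where
  "I = genideal free_algebra (range r)"

sublocale I: ideal I free_algebra
  unfolding I_def by (rule ring.genideal_ideal[OF ring_free_algebra]) simp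

lemma I_zero [simp, intro]: "0 \<in> I"
  and I_add [intro]: "a \<in> I \<Longrightarrow> b \<in> I \<Longrightarrow> a + b \<in> I"
  and I_mult_left [intro]: "a \<in> I \<Longrightarrow> f * a \<in> I"
  and I_mult_right [intro]: "a \<in> I \<Longrightarrow> a * f \<in> I"
  using additive_subgroup.zero_closed[OF I.additive_subgroup_axioms]
    additive_subgroup.a_closed[OF I.additive_subgroup_axioms, of a b]
    I.I_l_closed[of a f] I.I_r_closed[of a f] by auto

lemma I_uminus [intro]: "a \<in> I \<Longrightarrow> - a \<in> I"
  using I_mult_left[of a "- 1"] by simp

lemma I_diff [intro]: "a \<in> I \<Longrightarrow> b \<in> I \<Longrightarrow> a - b \<in> I"
  using I_add[of a "- b"] I_uminus by simp

lemma I_sum [intro]: "(\<And>s. s \<in> T \<Longrightarrow> f s \<in> I) \<Longrightarrow> sum f T \<in> I"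
  by (induction T rule: infinite_finite_induct) auto

lemma rel_in_I [simp, intro]: "r k \<in> I"
  unfolding I_def using ring.genideal_self[OF ring_free_algebra, of "range r"] by auto

lemma I_minimal: "ideal J free_algebra \<Longrightarrow> (\<And>k. r k \<in> J) \<Longrightarrow> I \<subseteq> J"
  unfolding I_def by (rule ring.genideal_minimal[OF ring_free_algebra]) auto

lemma subspace_I: "free_space.subspace I"
  by (auto simp: free_space.subspace_def smul_def)

lemma I_diff_cong: "a - b \<in> I \<Longrightarrow> a \<in> I \<longleftrightarrow> b \<in> I"
  using I_add[of "a - b" b] I_diff[of a "a - b"] by auto

lemma I_hcomp_mult:
  "hcomp n (f * a) \<in> I" "hcomp n (a * f) \<in> I" if "\<And>m. hcomp m a \<in> I"
proof -
  have "f * a = (\<Sum>i\<in>{i. hcomp i f \<noteq> 0}. hcomp i f * a)"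
    "a * f = (\<Sum>i\<in>{i. hcomp i f \<noteq> 0}. a * hcomp i f)"
    by (simp_all add: sum_hcomp[OF finite_hcomp] flip: sum_distrib_left sum_distrib_right)
  then have "hcomp n (f * a) = (\<Sum>i\<in>{i. hcomp i f \<noteq> 0}. hcomp n (hcomp i f * a))"
    "hcomp n (a * f) = (\<Sum>i\<in>{i. hcomp i f \<noteq> 0}. hcomp n (a * hcomp i f))"
    by (metis hcomp_sum)+
  then show "hcomp n (f * a) \<in> I" "hcomp n (a * f) \<in> I"
    using that
    by (auto simp: hcomp_mult_left[OF hcomp_in_free_homog] hcomp_mult_right[OF hcomp_in_free_homog]
        intro!: I_sum I_mult_left[OF that] I_mult_right[OF that])
qed

text \<open>The elements with all components in \<open>I\<close> form an ideal containing the
  generators, so minimality of \<open>I\<close> applies.\<close>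

lemma I_hcomp:
  assumes "f \<in> I"
  shows "hcomp n f \<in> I"
proof -
  have "ideal {f. \<forall>n. hcomp n f \<in> I} free_algebra"
    by (rule ideal_free_algebraI) (auto intro: I_hcomp_mult)
  moreover have "r k \<in> {f. \<forall>n. hcomp n f \<in> I}" for k
    using hcomp_free_homog[OF rel_homog] by simp
  ultimately have "I \<subseteq> {f. \<forall>n. hcomp n f \<in> I}"
    by (rule I_minimal)
  then show ?thesis
    using assms by blast
qed

text \<open>Again by minimality. The two conditions are treated together because vanishing linear
  coefficients are stable under multiplication only in the presence of a vanishing constant term, by
  \<open>dl_mult\<close>.\<close>

lemma I_low_degree:
  assumes "f \<in> I"
  shows "Poly_Mapping.lookup f [] = 0" "Poly_Mapping.lookup f [g] = 0"
proof -
  let ?J = "{f :: ('g, 'k) free. Poly_Mapping.lookup f [] = 0 \<and>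
      (\<forall>g. Poly_Mapping.lookup (dl g f) [] = 0)}"
  have "ideal ?J free_algebra"
    by (rule ideal_free_algebraI)
      (auto simp: dl_mult lookup_add simp del: lookup_dl)
  moreover have "r k \<in> ?J" for k
    using rel_homog[of k] by (simp add: free_homog_iff)
  ultimately have "I \<subseteq> ?J"
    by (rule I_minimal)
  then show "Poly_Mapping.lookup f [] = 0" "Poly_Mapping.lookup f [g] = 0"
    using assms by auto
qed

lemma I_homog_0: "f \<in> I \<Longrightarrow> f \<in> free_homog 0 \<Longrightarrow> f = 0"
  using I_low_degree(1) by (force simp: free_homog_0_eq)

lemma I_homog_1: "f \<in> I \<Longrightarrow> f \<in> free_homog 1 \<Longrightarrow> f = 0"
  using I_low_degree(2)[of f]
  by (intro poly_mapping_eqI) (metis One_nat_def free_homog_iff length_0_conv length_Suc_conv lookup_zero)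

text \<open>This is exactness of the Koszul complex in homological degree 1, for any quadratic algebra.\<close>

lemma I_iff: "f \<in> I \<longleftrightarrow>
    (\<exists>h i. (\<forall>g. i g \<in> I) \<and> f = (\<Sum>k\<in>UNIV. r k * h k) + (\<Sum>g\<in>UNIV. gen g * i g))"
proof
  let ?P = "\<lambda>f h i. (\<forall>g. i g \<in> I) \<and> f = (\<Sum>k\<in>UNIV. r k * h k) + (\<Sum>g\<in>UNIV. gen g * i g)"
  define J where "J = {f. \<exists>h i. ?P f h i}"
  have J_intro: "f \<in> J" if "?P f h i" for f h i
    unfolding J_def mem_Collect_eq using that by (intro exI)
  have J_elim: thesis if "f \<in> J" "\<And>h i. ?P f h i \<Longrightarrow> thesis" for f thesis
    using that(1) unfolding J_def mem_Collect_eq by (elim exE) (rule that(2))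
  have JI: "J \<subseteq> I"
    by (auto elim!: J_elim)
  have J_add: "a + b \<in> J" if ab: "a \<in> J" "b \<in> J" for a b
  proof -
    obtain h i where "\<forall>g. i g \<in> I"
      "a = (\<Sum>k\<in>UNIV. r k * h k) + (\<Sum>g\<in>UNIV. gen g * i g)"
      using ab(1) by (rule J_elim) blast
    moreover obtain h' i' where "\<forall>g. i' g \<in> I"
      "b = (\<Sum>k\<in>UNIV. r k * h' k) + (\<Sum>g\<in>UNIV. gen g * i' g)"
      using ab(2) by (rule J_elim) blast
    ultimately have "a + b = (\<Sum>k\<in>UNIV. r k * (h k + h' k)) + (\<Sum>g\<in>UNIV. gen g * (i g + i' g))"
      "\<forall>g. i g + i' g \<in> I"
      by (auto simp: distrib_left sum.distrib algebra_simps)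
    then show ?thesis
      by (intro J_intro[of "\<lambda>g. i g + i' g" _ "\<lambda>k. h k + h' k"]) simp
  qed
  have J_right: "a * f \<in> J" if a: "a \<in> J" for a f
  proof -
    obtain h i where "\<forall>g. i g \<in> I" "a = (\<Sum>k\<in>UNIV. r k * h k) + (\<Sum>g\<in>UNIV. gen g * i g)"
      using a by (rule J_elim) blast
    then have "a * f = (\<Sum>k\<in>UNIV. r k * (h k * f)) + (\<Sum>g\<in>UNIV. gen g * (i g * f))"
      "\<forall>g. i g * f \<in> I"
      by (auto simp: distrib_right sum_distrib_right mult.assoc)
    then show ?thesis
      by (intro J_intro[of "\<lambda>g. i g * f" _ "\<lambda>k. h k * f"]) simp
  qed
  have J_gen: "(\<Sum>g\<in>UNIV. gen g * i g) \<in> J" if "\<And>g. i g \<in> I" for i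
    by (rule J_intro[of i _ "\<lambda>_. 0"]) (use that in simp)
  have "ideal J free_algebra"
  proof (rule ideal_free_algebraI)
    show "0 \<in> J"
      using J_gen[of "\<lambda>_. 0"] by simp
    fix a f :: "('g, 'k) free"
    assume a: "a \<in> J"
    \<comment> \<open>Left multiples are the reason for the second sum in \<open>J\<close>: the
      constant term of \<open>f\<close> only rescales \<open>a\<close>, and everything else starts
      with a generator followed by an element of \<open>I\<close>.\<close>
    have "f * a = a * const (Poly_Mapping.lookup f []) + (\<Sum>g\<in>UNIV. gen g * (dl g f * a))"
      by (subst gen_expansion[of f])
        (simp only: const_commute distrib_right sum_distrib_right mult.assoc)
    then show "f * a \<in> J"
      using J_right[OF a] J_gen[of "\<lambda>g. dl g f * a"] JI a by (auto intro!: J_add )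
  qed (fact J_add J_right)+
  moreover have "r k \<in> J" for k
  proof -
    have "r k = (\<Sum>j\<in>UNIV. r j * (if j = k then 1 else 0)) + (\<Sum>g\<in>UNIV. gen g * 0)"
      by (simp add: if_distrib[of "\<lambda>h. r _ * h"] cong: if_cong)
    then show ?thesis
      by (intro J_intro[of "\<lambda>_. 0" _ "\<lambda>j. if j = k then 1 else 0"]) simp
  qed
  ultimately have "I \<subseteq> J"
    by (rule I_minimal)
  then show "f \<in> I \<Longrightarrow>
    \<exists>h i. (\<forall>g. i g \<in> I) \<and> f = (\<Sum>k\<in>UNIV. r k * h k) + (\<Sum>g\<in>UNIV. gen g * i g)"
    unfolding J_def by blast
qed auto

text \<open>Comparing the coefficients of \<open>gen g\<close> in \<open>I_iff\<close>: over A, the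
  kernel of the row of generators is the image of the matrix with entries \<open>dl g (r k)\<close>,
  the next differential.\<close>

lemma gen_comb_in_I_iff: "(\<Sum>g\<in>UNIV. gen g * f g) \<in> I \<longleftrightarrow>
    (\<exists>h. \<forall>g. f g - (\<Sum>k\<in>UNIV. dl g (r k) * h k) \<in> I)"
proof
  have r: "r k = (\<Sum>g\<in>UNIV. gen g * dl g (r k))" for k
    using gen_expansion[of "r k"] I_low_degree(1)[OF rel_in_I] by simp
  have swap: "(\<Sum>g\<in>UNIV. gen g * (\<Sum>k\<in>UNIV. dl g (r k) * h k)) = (\<Sum>k\<in>UNIV. r k * h k)" for h
  proof -
    have "(\<Sum>k\<in>UNIV. r k * h k) = (\<Sum>k\<in>UNIV. \<Sum>g\<in>UNIV. gen g * dl g (r k) * h k)"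
      by (subst r) (simp add: sum_distrib_right)
    also have "\<dots> = (\<Sum>g\<in>UNIV. \<Sum>k\<in>UNIV. gen g * dl g (r k) * h k)"
      by (rule sum.swap)
    finally show ?thesis
      by (simp add: sum_distrib_left mult.assoc)
  qed
  {
    assume "(\<Sum>g\<in>UNIV. gen g * f g) \<in> I"
    from I_iff[THEN iffD1, OF this] obtain h i where i: "\<forall>g. i g \<in> I" and
      eq: "(\<Sum>g\<in>UNIV. gen g * f g) = (\<Sum>k\<in>UNIV. r k * h k) + (\<Sum>g\<in>UNIV. gen g * i g)"
      by blast
    have "(\<Sum>g\<in>UNIV. gen g * f g) = (\<Sum>g\<in>UNIV. gen g * ((\<Sum>k\<in>UNIV. dl g (r k) * h k) + i g))"
      unfolding eq distrib_left sum.distrib swap ..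
    then have "f g = (\<Sum>k\<in>UNIV. dl g (r k) * h k) + i g" for g
      unfolding gen_comb_eq_iff by (rule fun_cong)
    then show "\<exists>h. \<forall>g. f g - (\<Sum>k\<in>UNIV. dl g (r k) * h k) \<in> I"
      using i by (intro exI[of _ h]) simp
  next
    assume "\<exists>h. \<forall>g. f g - (\<Sum>k\<in>UNIV. dl g (r k) * h k) \<in> I"
    then obtain h where "\<And>g. f g - (\<Sum>k\<in>UNIV. dl g (r k) * h k) \<in> I"
      by blast
    then have "(\<Sum>g\<in>UNIV. gen g * (f g - (\<Sum>k\<in>UNIV. dl g (r k) * h k))) \<in> I"
      by blast
    then have "(\<Sum>g\<in>UNIV. gen g * f g) - (\<Sum>k\<in>UNIV. r k * h k) \<in> I"
      unfolding right_diff_distrib sum_subtractf swap .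
    then show "(\<Sum>g\<in>UNIV. gen g * f g) \<in> I"
      using I_diff_cong by blast
  }
qed

section \<open>Homogeneous components of the ideal\<close>

abbreviation I_homog :: "nat \<Rightarrow> ('g, 'k) free set" where
  "I_homog n \<equiv> I \<inter> free_homog n"

lemma subspace_I_homog: "free_space.subspace (I_homog n)"
  by (intro free_space.subspace_inter subspace_I subspace_free_homog)

lemma fin_gen_I_homog: "free_space.fin_gen (I_homog n)"
  using free_space.fin_gen_subset dim_free_homog by blast

lemma rel_mult_in_free_homog: "h \<in> free_homog n \<Longrightarrow> r k * h \<in> free_homog (Suc (Suc n))"
  by (rule free_homog_mult'[OF rel_homog]) auto

text \<open>The graded form of \<open>I_iff\<close>: I_(n+2) is R F_n + V I_(n+1). It is the
  recursion behind all dimension counts.\<close>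

lemma I_homog_Suc_Suc:
  "I_homog (Suc (Suc n)) =
    {x + y |x y. x \<in> lcomb r UNIV (free_homog n) \<and> y \<in> lcomb gen UNIV (I_homog (Suc n))}"
proof (intro subset_antisym subsetI)
  fix f assume f: "f \<in> I_homog (Suc (Suc n))"
  obtain h i where i: "\<forall>g. i g \<in> I"
    and eq: "f = (\<Sum>k\<in>UNIV. r k * h k) + (\<Sum>g\<in>UNIV. gen g * i g)"
    using I_iff[THEN iffD1, of f] f by blast
  have "f = hcomp (Suc (Suc n)) f"
    using f hcomp_free_homog by fastforce
  also have "\<dots> = (\<Sum>k\<in>UNIV. r k * hcomp n (h k)) + (\<Sum>g\<in>UNIV. gen g * hcomp (Suc n) (i g))"
    unfolding eq hcomp_add
    using hcomp_lcomb[of UNIV r 2 "Suc (Suc n)" h] hcomp_lcomb[of UNIV gen 1 "Suc (Suc n)" i] rel_homog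
    by (simp add: numeral_2_eq_2)
  finally show "f \<in> {x + y |x y. x \<in> lcomb r UNIV (free_homog n) \<and>
      y \<in> lcomb gen UNIV (I_homog (Suc n))}"
    using i I_hcomp by (auto intro!: lcombI exI)
next
  fix f assume "f \<in> {x + y |x y. x \<in> lcomb r UNIV (free_homog n) \<and>
      y \<in> lcomb gen UNIV (I_homog (Suc n))}"
  then show "f \<in> I_homog (Suc (Suc n))"
    by (auto elim!: lcombE intro!: I_add I_sum free_homog_add free_homog_sum
        rel_mult_in_free_homog free_homog_mult'[OF gen_in_free_homog])
qed

text \<open>The dimension of A_n, counted in the free algebra; \<open>dim_quotient_homog\<close>
  makes the identification. By \<open>hdim_eq\<close> the subtraction never truncates.\<close>

definition hdim :: "nat \<Rightarrow> nat" where
  "hdim n = card (UNIV :: 'g set) ^ n - free_space.dim (I_homog n)"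

lemma hdim_eq: "hdim n + free_space.dim (I_homog n) = card (UNIV :: 'g set) ^ n"
proof -
  have "free_space.dim (I_homog n) \<le> free_space.dim (free_homog n :: ('g, 'k) free set)"
    by (rule free_space.dim_mono_fin_gen[OF subspace_I_homog subspace_free_homog])
      (use dim_free_homog in auto)
  then show ?thesis
    using dim_free_homog[of n, where ?'g = 'g and ?'k = 'k] by (simp add: hdim_def)
qed

end

section \<open>Free graded modules and Koszulity\<close>

text \<open>An additive \<open>P i\<close> applied to a decomposition removes all summands but the
  one in degree \<open>i\<close>, so a system of projections forces uniqueness. It settles both the
  definite description in \<open>augmentation\<close> and the unique decompositions in free
  modules.\<close>

lemma decomposition_iff:
  fixes M :: "('m, 'b) graded_scheme" (structure)
  assumes M: "abelian_group M" and sub: "\<And>j. additive_subgroup (homog M j) M"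
    and P_homog: "\<And>j x. x \<in> carrier M \<Longrightarrow> P j x \<in> homog M j"
    and P_add: "\<And>j x y. x \<in> carrier M \<Longrightarrow> y \<in> carrier M \<Longrightarrow> P j (x \<oplus> y) = P j x \<oplus> P j y"
    and P_same: "\<And>i j x. x \<in> homog M j \<Longrightarrow> P i x = (if i = j then x else \<zero>)"
    and fin: "finite {j. P j x \<noteq> \<zero>}" and sum: "(\<Oplus>j\<in>{j. P j x \<noteq> \<zero>}. P j x) = x"
    and x: "x \<in> carrier M"
  shows "decomposition M x c \<longleftrightarrow> c = (\<lambda>j. P j x)"
proof
  interpret abelian_group M by fact
  have carr: "homog M j \<subseteq> carrier M" for j
    using sub additive_subgroup.a_subset by blast
  have zero: "\<zero> \<in> homog M j" for j
    using sub additive_subgroup.zero_closed by blast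
  {
    assume c: "decomposition M x c"
    let ?J = "{j. c j \<noteq> \<zero>}"
    have J: "finite ?J" and ch: "\<And>j. c j \<in> homog M j" and xs: "x = (\<Oplus>j\<in>?J. c j)"
      using c unfolding decomposition_def by blast+
    have cc: "c j \<in> carrier M" for j
      using ch carr by blast
    have P_sum: "P i (\<Oplus>j\<in>N. c j) = (\<Oplus>j\<in>N. P i (c j))" if "finite N" for i N
      using that
    proof (induction N)
      case empty
      then show ?case
        using P_same[OF zero] by simp
    next
      case (insert k N)
      have "c \<in> N \<rightarrow> carrier M" "(\<lambda>j. P i (c j)) \<in> N \<rightarrow> carrier M" "c k \<in> carrier M"
        "P i (c k) \<in> carrier M"
        using ch carr P_homog by blast+
      then show ?case
        using insert P_add by simp
    qed
    show "c = (\<lambda>j. P j x)"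
    proof
      fix i
      have "P i x = (\<Oplus>j\<in>?J. P i (c j))"
        using P_sum[OF J] xs by metis
      also have "\<dots> = (\<Oplus>j\<in>?J. if i = j then c j else \<zero>)"
        using ch cc by (intro finsum_cong') (auto simp: P_same)
      also have "\<dots> = c i"
      proof (cases "i \<in> ?J")
        case True
        then show ?thesis
          using finsum_singleton[OF True J, of c] cc by blast
      next
        case False
        then have "(\<Oplus>j\<in>?J. if i = j then c j else \<zero>) = (\<Oplus>j\<in>?J. \<zero>)"
          by (intro finsum_cong') auto
        then show ?thesis
          using False by simp
      qed
      finally show "c i = P i x" ..
    qed
  next
    assume "c = (\<lambda>j. P j x)"
    then show "decomposition M x c"
      unfolding decomposition_def using P_homog x fin sum by simp
  }
qed

section \<open>Connected graded rings and their shifted free modules\<close>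

locale connected_graded_ring = ring A for A :: "('a, 'b) graded_algebra_scheme" (structure) +
  fixes P :: "nat \<Rightarrow> 'a \<Rightarrow> 'a"
  assumes homog_subgroup: "additive_subgroup (homog A j) A"
    and homog_mult: "x \<in> homog A i \<Longrightarrow> y \<in> homog A j \<Longrightarrow> x \<otimes> y \<in> homog A (i + j)"
    and one_homog: "\<one> \<in> homog A 0"
    and one_neq_zero: "\<one> \<noteq> \<zero>"
    and P_homog: "x \<in> carrier A \<Longrightarrow> P j x \<in> homog A j"
    and P_add: "x \<in> carrier A \<Longrightarrow> y \<in> carrier A \<Longrightarrow> P j (x \<oplus> y) = P j x \<oplus> P j y"
    and P_same: "x \<in> homog A j \<Longrightarrow> P i x = (if i = j then x else \<zero>)"
    and P_finite: "x \<in> carrier A \<Longrightarrow> finite {j. P j x \<noteq> \<zero>}"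
    and P_sum: "x \<in> carrier A \<Longrightarrow> (\<Oplus>j\<in>{j. P j x \<noteq> \<zero>}. P j x) = x"
    and P_0_mult: "x \<in> carrier A \<Longrightarrow> y \<in> carrier A \<Longrightarrow> P 0 (x \<otimes> y) = P 0 x \<otimes> P 0 y"
    and scalars_eq: "scalars A = homog A 0"
begin

lemma homog_carrier: "x \<in> homog A j \<Longrightarrow> x \<in> carrier A"
  using additive_subgroup.a_subset[OF homog_subgroup] by blast

lemma zero_homog [simp, intro]: "\<zero> \<in> homog A j"
  by (rule additive_subgroup.zero_closed[OF homog_subgroup])

lemma add_homog: "x \<in> homog A j \<Longrightarrow> y \<in> homog A j \<Longrightarrow> x \<oplus> y \<in> homog A j"
  by (rule additive_subgroup.a_closed[OF homog_subgroup])

lemma minus_homog: "x \<in> homog A j \<Longrightarrow> \<ominus> x \<in> homog A j"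
  using additive_subgroup.a_inv_closed[OF homog_subgroup] by blast

lemma finsum_homog:
  assumes "\<And>s. s \<in> S \<Longrightarrow> f s \<in> homog A j"
  shows "finsum A f S \<in> homog A j"
  using assms
proof (induction S rule: infinite_finite_induct)
  case (insert s S)
  then have "f \<in> S \<rightarrow> carrier A" "f s \<in> carrier A"
    using homog_carrier by blast+
  then show ?case
    using insert add_homog by simp
qed simp_all

lemma P_carrier [simp, intro]: "x \<in> carrier A \<Longrightarrow> P j x \<in> carrier A"
  using P_homog homog_carrier by blast

lemma augmentation_eq: "x \<in> carrier A \<Longrightarrow> augmentation A x = P 0 x"
  using decomposition_iff[OF abelian_group_axioms homog_subgroup P_homog P_add P_same P_finite P_sum]
  by (simp add: augmentation_def)

text \<open>The module A(-m)^n, whose basis vectors sit in degree \<open>m\<close>. Entries from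
  index \<open>n\<close> on are forced to be zero, so that equality of functions is equality of
  vectors.\<close>

definition free_mod :: "nat \<Rightarrow> nat \<Rightarrow> ('a, nat \<Rightarrow> 'a) graded_right_module" where
  "free_mod n m =
     \<lparr>carrier = {v. (\<forall>i<n. v i \<in> carrier A) \<and> (\<forall>i\<ge>n. v i = \<zero>)},
      monoid.mult = undefined, one = undefined, ring.zero = (\<lambda>_. \<zero>),
      add = (\<lambda>v w i. v i \<oplus> w i),
      homog = (\<lambda>j. {v. (\<forall>i<n. if m \<le> j then v i \<in> homog A (j - m) else v i = \<zero>) \<and> (\<forall>i\<ge>n. v i = \<zero>)}),
      act = (\<lambda>v a i. v i \<otimes> a)\<rparr>"

lemma carrier_free_mod: "v \<in> carrier (free_mod n m) \<longleftrightarrow> (\<forall>i<n. v i \<in> carrier A) \<and> (\<forall>i\<ge>n. v i = \<zero>)"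
  and zero_free_mod: "\<zero>\<^bsub>free_mod n m\<^esub> = (\<lambda>_. \<zero>)"
  and add_free_mod: "v \<oplus>\<^bsub>free_mod n m\<^esub> w = (\<lambda>i. v i \<oplus> w i)"
  and homog_free_mod: "v \<in> homog (free_mod n m) j \<longleftrightarrow>
    (\<forall>i<n. if m \<le> j then v i \<in> homog A (j - m) else v i = \<zero>) \<and> (\<forall>i\<ge>n. v i = \<zero>)"
  and act_free_mod: "v \<triangleleft>\<^bsub>free_mod n m\<^esub> a = (\<lambda>i. v i \<otimes> a)"
  by (simp_all add: free_mod_def)

lemmas free_mod_simps = carrier_free_mod zero_free_mod add_free_mod homog_free_mod act_free_mod

lemma carrier_free_mod_apply: "v \<in> carrier (free_mod n m) \<Longrightarrow> v i \<in> carrier A"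
  by (cases "i < n") (auto simp: carrier_free_mod)

lemma abelian_group_free_mod: "abelian_group (free_mod n m)"
proof (rule abelian_groupI)
  fix v assume v: "v \<in> carrier (free_mod n m)"
  let ?w = "\<lambda>i. \<ominus> v i"
  have "?w \<in> carrier (free_mod n m)" "?w \<oplus>\<^bsub>free_mod n m\<^esub> v = \<zero>\<^bsub>free_mod n m\<^esub>"
    using v carrier_free_mod_apply[OF v] by (auto simp: free_mod_simps l_neg)
  then show "\<exists>w\<in>carrier (free_mod n m). w \<oplus>\<^bsub>free_mod n m\<^esub> v = \<zero>\<^bsub>free_mod n m\<^esub>"
    by blast
next
  fix v w u assume "v \<in> carrier (free_mod n m)" "w \<in> carrier (free_mod n m)" "u \<in> carrier (free_mod n m)"
  note * = this[THEN carrier_free_mod_apply]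
  show "v \<oplus>\<^bsub>free_mod n m\<^esub> w \<oplus>\<^bsub>free_mod n m\<^esub> u = v \<oplus>\<^bsub>free_mod n m\<^esub> (w \<oplus>\<^bsub>free_mod n m\<^esub> u)"
    using * by (simp add: add_free_mod a_assoc)
next
  fix v w assume "v \<in> carrier (free_mod n m)" "w \<in> carrier (free_mod n m)"
  note * = this[THEN carrier_free_mod_apply]
  show "v \<oplus>\<^bsub>free_mod n m\<^esub> w = w \<oplus>\<^bsub>free_mod n m\<^esub> v"
    using * by (simp add: add_free_mod a_comm)
next
  fix v assume "v \<in> carrier (free_mod n m)"
  note * = this[THEN carrier_free_mod_apply]
  show "\<zero>\<^bsub>free_mod n m\<^esub> \<oplus>\<^bsub>free_mod n m\<^esub> v = v"
    using * by (simp add: free_mod_simps)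
qed (auto simp: free_mod_simps)

lemma finsum_free_mod:
  assumes "finite S" "f \<in> S \<rightarrow> carrier (free_mod n m)"
  shows "finsum (free_mod n m) f S = (\<lambda>i. \<Oplus>s\<in>S. f s i)"
  using assms
proof (induction S)
  case empty
  interpret M: abelian_group "free_mod n m" by (rule abelian_group_free_mod)
  show ?case
    by (simp add: zero_free_mod)
next
  case (insert s S)
  interpret M: abelian_group "free_mod n m" by (rule abelian_group_free_mod)
  have "(\<lambda>s. f s i) \<in> S \<rightarrow> carrier A" "f s i \<in> carrier A" for i
    using insert.prems carrier_free_mod_apply by blast+
  then show ?case
    using insert by (simp add: add_free_mod)
qed

lemma homog_free_mod_subgroup: "additive_subgroup (homog (free_mod n m) j) (free_mod n m)"
proof -
  interpret M: abelian_group "free_mod n m" by (rule abelian_group_free_mod)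
  have sub: "homog (free_mod n m) j \<subseteq> carrier (free_mod n m)"
    by (auto simp: free_mod_simps) (metis homog_carrier zero_closed)
  have "subgroup (homog (free_mod n m) j) (add_monoid (free_mod n m))"
  proof (rule group.subgroupI[OF M.a_group])
    show "homog (free_mod n m) j \<noteq> {}"
    proof -
      have "(\<lambda>_. \<zero>) \<in> homog (free_mod n m) j"
        by (simp add: homog_free_mod)
      then show ?thesis
        by blast
    qed
    fix v assume v: "v \<in> homog (free_mod n m) j"
    have v_apply: "v i \<in> carrier A" for i
      using v sub carrier_free_mod_apply by blast
    let ?w = "\<lambda>i. \<ominus> v i"
    have w: "?w \<in> homog (free_mod n m) j"
      using v by (auto simp: homog_free_mod minus_homog)
    moreover have "?w \<oplus>\<^bsub>free_mod n m\<^esub> v = \<zero>\<^bsub>free_mod n m\<^esub>"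
      using v_apply by (simp add: free_mod_simps l_neg)
    then have "\<ominus>\<^bsub>free_mod n m\<^esub> v = ?w"
      using M.minus_equality v w sub by blast
    ultimately show "inv\<^bsub>add_monoid (free_mod n m)\<^esub> v \<in> homog (free_mod n m) j"
      by (simp add: a_inv_def)
  next
    fix v w assume "v \<in> homog (free_mod n m) j" "w \<in> homog (free_mod n m) j"
    then show "v \<otimes>\<^bsub>add_monoid (free_mod n m)\<^esub> w \<in> homog (free_mod n m) j"
      by (auto simp: free_mod_simps add_homog)
  qed (use sub in simp)
  then show ?thesis
    by (rule additive_subgroup.intro)
qed

definition proj_free_mod :: "nat \<Rightarrow> nat \<Rightarrow> (nat \<Rightarrow> 'a) \<Rightarrow> nat \<Rightarrow> 'a" where
  "proj_free_mod m j v = (\<lambda>i. if m \<le> j then P (j - m) (v i) else \<zero>)"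

lemma P_zero [simp]: "P j \<zero> = \<zero>"
  using P_same[OF zero_homog] by simp

lemma free_mod_unique_decomposition:
  assumes v: "v \<in> carrier (free_mod n m)"
  shows "\<exists>!c. decomposition (free_mod n m) v c"
proof -
  let ?M = "free_mod n m" and ?P = "proj_free_mod m"
  interpret M: abelian_group ?M by (rule abelian_group_free_mod)
  have P_h: "?P j x \<in> homog ?M j" if "x \<in> carrier ?M" for j x
    using that by (auto simp: proj_free_mod_def free_mod_simps P_homog)
  have P_a: "?P j (x \<oplus>\<^bsub>?M\<^esub> y) = ?P j x \<oplus>\<^bsub>?M\<^esub> ?P j y" if "x \<in> carrier ?M" "y \<in> carrier ?M" for j x y
    using that[THEN carrier_free_mod_apply] by (auto simp: proj_free_mod_def add_free_mod P_add)
  have P_s: "?P i x = (if i = j then x else \<zero>\<^bsub>?M\<^esub>)" if "x \<in> homog ?M j" for i j x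
  proof
    fix k
    show "?P i x k = (if i = j then x else \<zero>\<^bsub>?M\<^esub>) k"
      using that P_same[of "x k" "j - m" "i - m"]
      by (cases "k < n"; cases "m \<le> j") (auto simp: proj_free_mod_def free_mod_simps)
  qed
  let ?J = "{j. ?P j v \<noteq> \<zero>\<^bsub>?M\<^esub>}"
  \<comment> \<open>The degrees in which some entry has a nonzero component, shifted by
    \<open>m\<close>: a finite bound for the support.\<close>
  let ?N = "\<Union>i<n. (\<lambda>j. j + m) ` {j. P j (v i) \<noteq> \<zero>}"
  have N: "finite ?N"
    using v P_finite by (auto simp: carrier_free_mod)
  have JN: "?J \<subseteq> ?N"
  proof
    fix j assume "j \<in> ?J"
    then obtain i where i: "m \<le> j" "P (j - m) (v i) \<noteq> \<zero>"
      by (auto simp: proj_free_mod_def zero_free_mod fun_eq_iff split: if_splits)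
    then have "i < n"
      using v by (metis P_zero carrier_free_mod not_le)
    moreover have "j = (j - m) + m"
      using i(1) by simp
    ultimately show "j \<in> ?N"
      using i(2) by blast
  qed
  then have fin: "finite ?J"
    using N finite_subset by blast
  have "(\<Oplus>\<^bsub>?M\<^esub>j\<in>?J. ?P j v) = v"
  proof
    fix i
    have carr: "(\<lambda>j. ?P j v) \<in> ?J \<rightarrow> carrier ?M"
      using P_h[OF v] homog_free_mod_subgroup additive_subgroup.a_subset by blast
    have vi: "v i \<in> carrier A"
      using v carrier_free_mod_apply by blast
    have zero: "?P j v i = \<zero>" if "j \<notin> ?J" for j
      using that by (simp add: zero_free_mod)
    have "finite {j. P j (v i) \<noteq> \<zero>}"
      using P_finite vi by blast
    let ?K = "(\<lambda>j. j + m) ` {j. P j (v i) \<noteq> \<zero>}"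
    have "(\<Oplus>\<^bsub>?M\<^esub>j\<in>?J. ?P j v) i = (\<Oplus>j\<in>?J. ?P j v i)"
      by (simp add: finsum_free_mod[OF fin carr])
    also have "\<dots> = (\<Oplus>j\<in>?K. ?P j v i)"
    proof (rule add.finprod_mono_neutral_cong_right)
      show "?K \<subseteq> ?J"
        by (auto simp: proj_free_mod_def zero_free_mod fun_eq_iff)
      show "?P j v i = \<zero>" if "j \<in> ?J - ?K" for j
      proof (rule ccontr)
        assume ne: "?P j v i \<noteq> \<zero>"
        then have "m \<le> j" "P (j - m) (v i) \<noteq> \<zero>"
          by (auto simp: proj_free_mod_def split: if_splits)
        then have "j \<in> ?K"
          by (intro image_eqI[of _ _ "j - m"]) auto
        then show False
          using that by simp
      qed
      show "(\<lambda>j. ?P j v i) \<in> ?J \<rightarrow> carrier A"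
        using vi by (auto simp: proj_free_mod_def)
    qed (use fin in auto)
    also have "\<dots> = (\<Oplus>j\<in>{j. P j (v i) \<noteq> \<zero>}. ?P (j + m) v i)"
      using vi by (intro add.finprod_reindex) (auto simp: proj_free_mod_def inj_on_def)
    also have "\<dots> = (\<Oplus>j\<in>{j. P j (v i) \<noteq> \<zero>}. P j (v i))"
      by (simp add: proj_free_mod_def)
    also have "\<dots> = v i"
      by (rule P_sum[OF vi])
    finally show "(\<Oplus>\<^bsub>?M\<^esub>j\<in>?J. ?P j v) i = v i" .
  qed
  then show ?thesis
    using decomposition_iff[of ?M ?P v, OF abelian_group_free_mod homog_free_mod_subgroup P_h P_a P_s fin _ v]
    by auto
qed

lemma graded_right_module_free_mod: "graded_right_module A (free_mod n m)"
proof (intro graded_right_module.intro graded_right_module_axioms.intro ring_axioms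
    abelian_group_free_mod homog_free_mod_subgroup free_mod_unique_decomposition)
  fix x a assume "x \<in> carrier (free_mod n m)" "a \<in> carrier A"
  then show "x \<triangleleft>\<^bsub>free_mod n m\<^esub> a \<in> carrier (free_mod n m)"
    by (auto simp: free_mod_simps)
next
  fix x y a assume "x \<in> carrier (free_mod n m)" "y \<in> carrier (free_mod n m)" "a \<in> carrier A"
  then show "(x \<oplus>\<^bsub>free_mod n m\<^esub> y) \<triangleleft>\<^bsub>free_mod n m\<^esub> a =
      x \<triangleleft>\<^bsub>free_mod n m\<^esub> a \<oplus>\<^bsub>free_mod n m\<^esub> y \<triangleleft>\<^bsub>free_mod n m\<^esub> a"
    using carrier_free_mod_apply by (auto simp: add_free_mod act_free_mod l_distr)
next
  fix x a b assume "x \<in> carrier (free_mod n m)" "a \<in> carrier A" "b \<in> carrier A"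
  then show "x \<triangleleft>\<^bsub>free_mod n m\<^esub> (a \<oplus> b) = x \<triangleleft>\<^bsub>free_mod n m\<^esub> a \<oplus>\<^bsub>free_mod n m\<^esub> x \<triangleleft>\<^bsub>free_mod n m\<^esub> b"
    "x \<triangleleft>\<^bsub>free_mod n m\<^esub> (a \<otimes> b) = (x \<triangleleft>\<^bsub>free_mod n m\<^esub> a) \<triangleleft>\<^bsub>free_mod n m\<^esub> b"
    using carrier_free_mod_apply by (auto simp: add_free_mod act_free_mod r_distr m_assoc)
next
  fix x assume "x \<in> carrier (free_mod n m)"
  then show "x \<triangleleft>\<^bsub>free_mod n m\<^esub> \<one> = x"
    using carrier_free_mod_apply by (auto simp: act_free_mod)
next
  fix x a i j assume "x \<in> homog (free_mod n m) i" and a: "a \<in> homog A j"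
  then show "x \<triangleleft>\<^bsub>free_mod n m\<^esub> a \<in> homog (free_mod n m) (i + j)"
    using homog_mult[OF _ a, of _ "i - m"] homog_carrier[OF a]
    by (cases "m \<le> i") (auto simp: free_mod_simps)
qed

definition unit_vec :: "nat \<Rightarrow> nat \<Rightarrow> 'a" where
  "unit_vec k = (\<lambda>i. if i = k then \<one> else \<zero>)"

lemma unit_vec_apply: "unit_vec k i = (if i = k then \<one> else \<zero>)"
  by (simp add: unit_vec_def)

lemma right_span_free_mod_subset:
  assumes "S \<subseteq> carrier (free_mod n m)"
  shows "right_span A (free_mod n m) S \<subseteq> carrier (free_mod n m)"
proof
  interpret M: abelian_group "free_mod n m" by (rule abelian_group_free_mod)
  interpret graded_right_module A "free_mod n m" by (rule graded_right_module_free_mod)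
  fix v assume "v \<in> right_span A (free_mod n m) S"
  then obtain F c where "v = (\<Oplus>\<^bsub>free_mod n m\<^esub>s\<in>F. s \<triangleleft>\<^bsub>free_mod n m\<^esub> c s)" "F \<subseteq> S" "c \<in> F \<rightarrow> carrier A"
    unfolding right_span_def by blast
  moreover from this have "(\<lambda>s. s \<triangleleft>\<^bsub>free_mod n m\<^esub> c s) \<in> F \<rightarrow> carrier (free_mod n m)"
    using assms act_closed by blast
  ultimately show "v \<in> carrier (free_mod n m)"
    by simp
qed

lemma right_basis_free_mod: "right_basis A (free_mod n m) (unit_vec ` {..<n})"
proof -
  let ?M = "free_mod n m" and ?B = "unit_vec ` {..<n}"
  interpret M: abelian_group ?M by (rule abelian_group_free_mod)
  have inj: "inj_on unit_vec N" for N
    by (rule inj_onI) (metis one_neq_zero unit_vec_def)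
  have B: "?B \<subseteq> carrier ?M"
    by (auto simp: unit_vec_def carrier_free_mod)
  have apply_sum: "(\<Oplus>\<^bsub>?M\<^esub>b\<in>unit_vec ` N. b \<triangleleft>\<^bsub>?M\<^esub> c b) i = (if i \<in> N then c (unit_vec i) else \<zero>)"
    if N: "N \<subseteq> {..<n}" and c: "c \<in> unit_vec ` N \<rightarrow> carrier A" for N c i
  proof -
    have finN: "finite N"
      using N finite_subset by blast
    have carr: "(\<lambda>b. b \<triangleleft>\<^bsub>?M\<^esub> c b) \<in> unit_vec ` N \<rightarrow> carrier ?M"
    proof
      fix b assume b: "b \<in> unit_vec ` N"
      then have "c b \<in> carrier A" "b \<in> carrier ?M"
        using c B N by blast+
      then show "b \<triangleleft>\<^bsub>?M\<^esub> c b \<in> carrier ?M"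
        by (auto simp: free_mod_simps)
    qed
    have cu: "c (unit_vec k) \<in> carrier A" if "k \<in> N" for k
      using c that by blast
    have "(\<Oplus>\<^bsub>?M\<^esub>b\<in>unit_vec ` N. b \<triangleleft>\<^bsub>?M\<^esub> c b) i = (\<Oplus>b\<in>unit_vec ` N. b i \<otimes> c b)"
      using finsum_free_mod[OF _ carr] finN by (simp add: act_free_mod)
    also have "\<dots> = (\<Oplus>k\<in>N. unit_vec k i \<otimes> c (unit_vec k))"
      using cu inj by (intro add.finprod_reindex) (auto simp: unit_vec_apply)
    also have "\<dots> = (\<Oplus>k\<in>N. if i = k then c (unit_vec k) else \<zero>)"
      using cu by (intro add.finprod_cong') (auto simp: unit_vec_apply)
    also have "\<dots> = (if i \<in> N then c (unit_vec i) else \<zero>)"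
    proof (cases "i \<in> N")
      case True
      then show ?thesis
        using finsum_singleton[OF True finN, of "\<lambda>k. c (unit_vec k)"] c by auto
    next
      case False
      then have "(\<Oplus>k\<in>N. if i = k then c (unit_vec k) else \<zero>) = (\<Oplus>k\<in>N. \<zero>)"
        by (intro add.finprod_cong') auto
      then show ?thesis
        using False by simp
    qed
    finally show ?thesis .
  qed
  have "carrier ?M \<subseteq> right_span A ?M ?B"
  proof
    fix v assume v: "v \<in> carrier ?M"
    define c where "c b = v (the_inv_into {..<n} unit_vec b)" for b
    have c_unit: "c (unit_vec i) = v i" if "i < n" for i
      using the_inv_into_f_f[OF inj, of i "{..<n}"] that by (simp add: c_def)
    have c: "c \<in> ?B \<rightarrow> carrier A"
      using v c_unit by (auto simp: carrier_free_mod)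
    have "v = (\<Oplus>\<^bsub>?M\<^esub>b\<in>?B. b \<triangleleft>\<^bsub>?M\<^esub> c b)"
    proof
      fix i
      show "v i = (\<Oplus>\<^bsub>?M\<^esub>b\<in>?B. b \<triangleleft>\<^bsub>?M\<^esub> c b) i"
        using apply_sum[OF subset_refl c, of i] c_unit[of i] v by (auto simp: carrier_free_mod)
    qed
    then show "v \<in> right_span A ?M ?B"
      unfolding right_span_def using c by (intro CollectI exI[of _ ?B] exI[of _ c]) auto
  qed
  moreover have "c b = \<zero>"
    if F: "finite F" "F \<subseteq> ?B" and c: "c \<in> F \<rightarrow> carrier A" and zero: "(\<Oplus>\<^bsub>?M\<^esub>b\<in>F. b \<triangleleft>\<^bsub>?M\<^esub> c b) = \<zero>\<^bsub>?M\<^esub>"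
      and b: "b \<in> F" for F c b
  proof -
    obtain N where N: "N \<subseteq> {..<n}" "F = unit_vec ` N"
      using F(2) subset_imageE by metis
    obtain k where k: "k \<in> N" "b = unit_vec k"
      using b N(2) by blast
    show ?thesis
      using apply_sum[OF N(1), of c k] c zero k N(2) by (simp add: zero_free_mod)
  qed
  ultimately show ?thesis
    unfolding right_basis_def using B right_span_free_mod_subset[OF B] by blast
qed

lemma unit_vec_homog: "k < n \<Longrightarrow> unit_vec k \<in> homog (free_mod n m) m"
  by (auto simp: homog_free_mod unit_vec_def one_homog)

lemma graded_free_free_mod: "graded_free A (free_mod n m)"
  unfolding graded_free_def
proof (intro conjI exI)
  show "unit_vec ` {..<n} \<subseteq> (\<Union>j. homog (free_mod n m) j)"
    using unit_vec_homog[of _ n m] by blast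
qed (fact graded_right_module_free_mod right_basis_free_mod)+

lemma generated_in_degree_free_mod: "generated_in_degree A (free_mod n m) m"
proof -
  have "unit_vec ` {..<n} \<subseteq> homog (free_mod n m) m"
    using unit_vec_homog by blast
  then have "right_span A (free_mod n m) (unit_vec ` {..<n}) \<subseteq>
      right_span A (free_mod n m) (homog (free_mod n m) m)"
    unfolding right_span_def by blast
  moreover have "homog (free_mod n m) m \<subseteq> carrier (free_mod n m)"
    using additive_subgroup.a_subset[OF homog_free_mod_subgroup] by blast
  then have "right_span A (free_mod n m) (homog (free_mod n m) m) \<subseteq> carrier (free_mod n m)"
    by (rule right_span_free_mod_subset)
  ultimately show ?thesis
    using right_basis_free_mod[of n m]
    unfolding generated_in_degree_def right_basis_def by simp
qed

section \<open>Maps given by matrices of linear forms\<close>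

definition row_map :: "nat \<Rightarrow> (nat \<Rightarrow> 'a) \<Rightarrow> (nat \<Rightarrow> 'a) \<Rightarrow> 'a" where
  "row_map n D v = (\<Oplus>j\<in>{..<n}. D j \<otimes> v j)"

definition mat_map :: "nat \<Rightarrow> nat \<Rightarrow> (nat \<Rightarrow> nat \<Rightarrow> 'a) \<Rightarrow> (nat \<Rightarrow> 'a) \<Rightarrow> nat \<Rightarrow> 'a" where
  "mat_map n' n D v = (\<lambda>i. if i < n' then row_map n (D i) v else \<zero>)"

text \<open>The last item has the shape of the membership condition in
  \<open>homog_free_mod\<close>, so that degree preservation of \<open>mat_map\<close> follows entry
  by entry.\<close>

lemma row_map:
  assumes D: "\<And>j. j < n \<Longrightarrow> D j \<in> homog A 1"
  shows "v \<in> carrier (free_mod n m) \<Longrightarrow> row_map n D v \<in> carrier A"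
    and "v \<in> carrier (free_mod n m) \<Longrightarrow> w \<in> carrier (free_mod n m) \<Longrightarrow>
      row_map n D (v \<oplus>\<^bsub>free_mod n m\<^esub> w) = row_map n D v \<oplus> row_map n D w"
    and "v \<in> carrier (free_mod n m) \<Longrightarrow> a \<in> carrier A \<Longrightarrow>
      row_map n D (v \<triangleleft>\<^bsub>free_mod n m\<^esub> a) = row_map n D v \<otimes> a"
    and "v \<in> homog (free_mod n (Suc m)) j \<Longrightarrow> if m \<le> j then row_map n D v \<in> homog A (j - m) else row_map n D v = \<zero>"
proof -
  have Dc: "D j \<in> carrier A" if "j < n" for j
    using D[OF that] homog_carrier by blast
  show "v \<in> carrier (free_mod n m) \<Longrightarrow> row_map n D v \<in> carrier A"
    using Dc by (auto simp: row_map_def carrier_free_mod intro!: finsum_closed)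
  {
    assume vw: "v \<in> carrier (free_mod n m)" "w \<in> carrier (free_mod n m)"
    have "row_map n D (v \<oplus>\<^bsub>free_mod n m\<^esub> w) = (\<Oplus>j\<in>{..<n}. D j \<otimes> v j \<oplus> D j \<otimes> w j)"
      unfolding row_map_def using vw Dc
      by (intro finsum_cong') (auto simp: add_free_mod carrier_free_mod r_distr)
    also have "\<dots> = row_map n D v \<oplus> row_map n D w"
      unfolding row_map_def using vw Dc by (intro finsum_addf) (auto simp: carrier_free_mod)
    finally show "row_map n D (v \<oplus>\<^bsub>free_mod n m\<^esub> w) = row_map n D v \<oplus> row_map n D w" .
  next
    assume va: "v \<in> carrier (free_mod n m)" "a \<in> carrier A"
    have "row_map n D v \<otimes> a = (\<Oplus>j\<in>{..<n}. D j \<otimes> v j \<otimes> a)"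
      unfolding row_map_def using va Dc by (intro finsum_ldistr) (auto simp: carrier_free_mod)
    also have "\<dots> = row_map n D (v \<triangleleft>\<^bsub>free_mod n m\<^esub> a)"
      unfolding row_map_def using va Dc
      by (intro finsum_cong') (auto simp: act_free_mod carrier_free_mod m_assoc)
    finally show "row_map n D (v \<triangleleft>\<^bsub>free_mod n m\<^esub> a) = row_map n D v \<otimes> a" ..
  next
    assume v: "v \<in> homog (free_mod n (Suc m)) j"
    show "if m \<le> j then row_map n D v \<in> homog A (j - m) else row_map n D v = \<zero>"
    proof (cases "Suc m \<le> j")
      case True
      have "D k \<otimes> v k \<in> homog A (j - m)" if "k < n" for k
        using homog_mult[OF D[OF that], of "v k" "j - Suc m"] v that True
        by (auto simp: homog_free_mod Suc_diff_Suc)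
      then show ?thesis
        using True finsum_homog[of "{..<n}" "\<lambda>k. D k \<otimes> v k" "j - m"] by (auto simp: row_map_def)
    next
      \<comment> \<open>Here \<open>v\<close> lies below the generating degree and vanishes. This
        includes \<open>j = m\<close>, where the value 0 is a legitimate element of degree
        0.\<close>
      case False
      then have "row_map n D v = (\<Oplus>k\<in>{..<n}. \<zero>)"
        unfolding row_map_def using v Dc by (intro finsum_cong') (auto simp: homog_free_mod)
      then show ?thesis
        by simp
    qed
  }
qed

lemma row_map_hom:
  assumes "\<And>j. j < n \<Longrightarrow> D j \<in> homog A 1"
  shows "row_map n D \<in> graded_hom A (free_mod n 1) (regular_module A)"
  unfolding graded_hom_def
  using row_map[of n D _ 1, OF assms] row_map(4)[of n D _ 0, OF assms]
  by (auto simp: regular_module_def)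

lemma mat_map_hom:
  assumes "\<And>i j. i < n' \<Longrightarrow> j < n \<Longrightarrow> D i j \<in> homog A 1"
  shows "mat_map n' n D \<in> graded_hom A (free_mod n (Suc m)) (free_mod n' m)"
  unfolding graded_hom_def
proof (intro CollectI conjI ballI allI image_subsetI funcsetI)
  fix v assume "v \<in> carrier (free_mod n (Suc m))"
  then show "mat_map n' n D v \<in> carrier (free_mod n' m)"
    using row_map(1)[of n "D _" v "Suc m"] assms by (auto simp: carrier_free_mod[of _ n'] mat_map_def)
next
  fix v w assume "v \<in> carrier (free_mod n (Suc m))" "w \<in> carrier (free_mod n (Suc m))"
  then show "mat_map n' n D (v \<oplus>\<^bsub>free_mod n (Suc m)\<^esub> w) =
      mat_map n' n D v \<oplus>\<^bsub>free_mod n' m\<^esub> mat_map n' n D w"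
    using row_map(2)[of n "D _" v "Suc m" w] assms by (auto simp: add_free_mod[of n' m] mat_map_def)
next
  fix v a assume "v \<in> carrier (free_mod n (Suc m))" "a \<in> carrier A"
  then show "mat_map n' n D (v \<triangleleft>\<^bsub>free_mod n (Suc m)\<^esub> a) = mat_map n' n D v \<triangleleft>\<^bsub>free_mod n' m\<^esub> a"
    using row_map(3)[of n "D _" v "Suc m" a] assms by (auto simp: act_free_mod[of n' m] mat_map_def)
next
  fix j v assume "v \<in> homog (free_mod n (Suc m)) j"
  then show "mat_map n' n D v \<in> homog (free_mod n' m) j"
    using row_map(4)[of n "D _" v m j] assms by (auto simp: homog_free_mod[of _ n'] mat_map_def)
qed

lemma augmentation_hom:
  "augmentation A \<in> graded_hom A (regular_module A) (ground_field_module A)"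
  "augmentation A ` carrier (regular_module A) = carrier (ground_field_module A)"
proof -
  show "augmentation A ` carrier (regular_module A) = carrier (ground_field_module A)"
    using P_homog P_same[of _ 0 0] homog_carrier
    by (force simp: regular_module_def ground_field_module_def scalars_eq augmentation_eq)
  show "augmentation A \<in> graded_hom A (regular_module A) (ground_field_module A)"
    unfolding graded_hom_def
    using P_homog P_same[of _ _ 0] homog_carrier P_add P_0_mult
    by (auto simp: regular_module_def ground_field_module_def scalars_eq augmentation_eq)
qed

lemma koszul_if_exact:
  fixes n :: "nat \<Rightarrow> nat" and D\<^sub>1 :: "nat \<Rightarrow> 'a" and D :: "nat \<Rightarrow> nat \<Rightarrow> nat \<Rightarrow> 'a"
  assumes D1: "\<And>j. j < n 1 \<Longrightarrow> D\<^sub>1 j \<in> homog A 1"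
    and D: "\<And>m i j. m \<ge> 1 \<Longrightarrow> i < n m \<Longrightarrow> j < n (Suc m) \<Longrightarrow> D m i j \<in> homog A 1"
    and ex0: "\<And>a. a \<in> carrier A \<Longrightarrow> P 0 a = \<zero> \<longleftrightarrow> a \<in> row_map (n 1) D\<^sub>1 ` carrier (free_mod (n 1) 1)"
    and ex1: "\<And>v. v \<in> carrier (free_mod (n 1) 1) \<Longrightarrow> row_map (n 1) D\<^sub>1 v = \<zero> \<longleftrightarrow>
      v \<in> mat_map (n 1) (n 2) (D 1) ` carrier (free_mod (n 2) 2)"
    and ex: "\<And>m v. m \<ge> 1 \<Longrightarrow> v \<in> carrier (free_mod (n (Suc m)) (Suc m)) \<Longrightarrow>
      (\<forall>i<n m. row_map (n (Suc m)) (D m i) v = \<zero>) \<longleftrightarrow>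
      v \<in> mat_map (n (Suc m)) (n (Suc (Suc m))) (D (Suc m)) ` carrier (free_mod (n (Suc (Suc m))) (Suc (Suc m)))"
  shows "koszul A"
proof -
  let ?M = "\<lambda>m. free_mod (n m) m"
  let ?d = "\<lambda>m. mat_map (n m) (n (Suc m)) (D m)"
  have hom: "?d m \<in> graded_hom A (?M (m + 1)) (?M m)" if "m \<ge> 1" for m
    using mat_map_hom[of "n m" "n (Suc m)" "D m" m] D[OF that] by simp
  have hom1: "row_map (n 1) D\<^sub>1 \<in> graded_hom A (?M 1) (regular_module A)"
    using row_map_hom D1 by blast
  have im: "f ` carrier M \<subseteq> carrier N" if "f \<in> graded_hom A M N"
    for f and M :: "('a, nat \<Rightarrow> 'a) graded_right_module" and N :: "('a, 'c) graded_right_module"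
    using that unfolding graded_hom_def by blast
  have e0: "row_map (n 1) D\<^sub>1 ` carrier (?M 1) =
      kernel_of (regular_module A) (ground_field_module A) (augmentation A)"
    using ex0 im[OF hom1] augmentation_eq
    by (auto simp: kernel_of_def regular_module_def ground_field_module_def)
  have e1: "?d 1 ` carrier (?M 2) = kernel_of (?M 1) (regular_module A) (row_map (n 1) D\<^sub>1)"
    using ex1 im[OF hom[of 1]]
    by (auto simp: kernel_of_def regular_module_def numeral_2_eq_2)
  have e: "?d (m + 1) ` carrier (?M (m + 2)) = kernel_of (?M (m + 1)) (?M m) (?d m)" if "m \<ge> 1" for m
  proof -
    have "?d m v = \<zero>\<^bsub>?M m\<^esub> \<longleftrightarrow> (\<forall>i<n m. row_map (n (Suc m)) (D m i) v = \<zero>)" for v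
      by (auto simp: mat_map_def zero_free_mod fun_eq_iff)
    then show ?thesis
      using ex[OF that] im[OF hom[of "m + 1"]] by (auto simp: kernel_of_def)
  qed
  show ?thesis
    unfolding koszul_def
    using graded_free_free_mod generated_in_degree_free_mod augmentation_hom hom1 hom e0 e1 e
    by (intro exI[of _ ?M] exI[of _ "row_map (n 1) D\<^sub>1"] exI[of _ ?d]) blast
qed

end

section \<open>The quotient algebra\<close>

text \<open>Multiplication by 1 - X takes first differences, and three of them lead from the
  binomials over n + 1 and the constant sequence 1 to the series 1.\<close>

lemma inverse_one_minus_fps_X_cubed:
  "inverse ((1 - fps_X) ^ 3) = Abs_fps (\<lambda>n. of_nat ((n + 2) choose 2) :: rat)"
proof -
  let ?f = "\<lambda>n. of_nat ((n + 2) choose 2) :: rat"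
  have step: "(1 - fps_X) * Abs_fps f = Abs_fps (\<lambda>n. if n = 0 then f 0 else f n - f (n - 1))"
    for f :: "nat \<Rightarrow> rat"
    by (rule fps_ext) (simp add: left_diff_distrib)
  have "(1 - fps_X) ^ 3 * Abs_fps ?f = (1 - fps_X) * ((1 - fps_X) * ((1 - fps_X) * Abs_fps ?f))"
    by (simp add: power3_eq_cube mult.assoc)
  also have "(1 - fps_X) * Abs_fps ?f = Abs_fps (\<lambda>n. of_nat (n + 1))"
    unfolding step
  proof (rule fps_ext)
    fix n
    show "fps_nth (Abs_fps (\<lambda>n. if n = 0 then ?f 0 else ?f n - ?f (n - 1))) n =
        fps_nth (Abs_fps (\<lambda>n. of_nat (n + 1))) n"
      by (cases n) (simp_all add: choose_two numeral_2_eq_2)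
  qed
  also have "(1 - fps_X) * Abs_fps (\<lambda>n. of_nat (n + 1) :: rat) = Abs_fps (\<lambda>n. 1)"
    unfolding step by (rule fps_ext) simp
  also have "(1 - fps_X) * Abs_fps (\<lambda>n. 1 :: rat) = 1"
    unfolding step by (rule fps_ext) simp
  finally show ?thesis
    by (rule fps_inverse_unique)
qed

context quadratic_relations
begin

abbreviation A :: "('g, 'k) free set graded_algebra" where
  "A \<equiv> quadratic_algebra (range r)"

definition \<pi> :: "('g, 'k) free \<Rightarrow> ('g, 'k) free set" where
  "\<pi> f = I +>\<^bsub>free_algebra\<^esub> f"

lemma pi_eq_iff: "\<pi> f = \<pi> h \<longleftrightarrow> f - h \<in> I"
  using ring.quotient_eq_iff_same_a_r_cos[OF ring_free_algebra I.ideal_axioms, of f h]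
  by (simp add: \<pi>_def a_minus_def)

lemma quotient_carrier: "carrier A = range \<pi>"
  and quotient_homog: "homog A j = \<pi> ` free_homog j"
  and quotient_scalars: "scalars A = \<pi> ` range const"
  by (auto simp: quadratic_algebra_def Let_def FactRing_def A_RCOSETS_def' \<pi>_def simp flip: I_def)

lemma quotient_mult: "\<pi> f \<otimes>\<^bsub>A\<^esub> \<pi> h = \<pi> (f * h)"
  and quotient_add: "\<pi> f \<oplus>\<^bsub>A\<^esub> \<pi> h = \<pi> (f + h)"
  and quotient_one: "\<one>\<^bsub>A\<^esub> = \<pi> 1"
  using I.rcoset_mult_add[of f h] I.a_rcos_sum[of f h]
  by (simp_all add: quadratic_algebra_def Let_def FactRing_def \<pi>_def flip: I_def)

lemma quotient_zero: "\<zero>\<^bsub>A\<^esub> = \<pi> 0"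
proof -
  have "\<zero>\<^bsub>A\<^esub> = I"
    by (simp add: quadratic_algebra_def Let_def FactRing_def flip: I_def)
  also have "I = \<pi> 0"
    by (auto simp: \<pi>_def a_r_coset_def')
  finally show ?thesis .
qed

lemmas quotient_simps = quotient_carrier quotient_mult quotient_add quotient_one quotient_zero

lemma pi_eq_zero_iff: "\<pi> f = \<zero>\<^bsub>A\<^esub> \<longleftrightarrow> f \<in> I"
  by (simp add: quotient_zero pi_eq_iff)

lemma ring_quotient: "ring A"
proof (rule ringI)
  show "abelian_group A"
  proof (rule abelian_groupI)
    fix x assume "x \<in> carrier A"
    then obtain f where "x = \<pi> f"
      by (auto simp: quotient_carrier)
    then have "\<pi> (- f) \<in> carrier A" "\<pi> (- f) \<oplus>\<^bsub>A\<^esub> x = \<zero>\<^bsub>A\<^esub>"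
      by (simp_all add: quotient_simps)
    then show "\<exists>y\<in>carrier A. y \<oplus>\<^bsub>A\<^esub> x = \<zero>\<^bsub>A\<^esub>"
      by blast
  qed (auto simp: quotient_simps algebra_simps)
  show "Group.monoid A"
    by (rule monoidI) (auto simp: quotient_simps algebra_simps)
qed (auto simp: quotient_simps algebra_simps)

definition proj :: "nat \<Rightarrow> ('g, 'k) free set \<Rightarrow> ('g, 'k) free set" where
  "proj j x = \<pi> (hcomp j (SOME f. \<pi> f = x))"

text \<open>Independence of the chosen representative is exactly the homogeneity of
  \<open>I\<close>.\<close>

lemma proj_pi: "proj j (\<pi> f) = \<pi> (hcomp j f)"
proof -
  let ?h = "SOME h. \<pi> h = \<pi> f"
  have "\<pi> ?h = \<pi> f"
    by (rule someI_ex) blast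
  then have "hcomp j (?h - f) \<in> I"
    unfolding pi_eq_iff by (rule I_hcomp)
  then show ?thesis
    by (simp add: proj_def pi_eq_iff)
qed

lemma quotient_finsum: "finite N \<Longrightarrow> finsum A (\<lambda>s. \<pi> (f s)) N = \<pi> (sum f N)"
proof (induction N rule: finite_induct)
  case empty
  interpret ring A by (rule ring_quotient)
  show ?case
    by (simp add: quotient_zero)
next
  case (insert s N)
  interpret ring A by (rule ring_quotient)
  have "(\<lambda>s. \<pi> (f s)) \<in> N \<rightarrow> carrier A" "\<pi> (f s) \<in> carrier A"
    by (auto simp: quotient_carrier)
  then show ?case
    using insert by (simp add: quotient_add)
qed

sublocale A: connected_graded_ring A proj
proof (intro connected_graded_ring.intro connected_graded_ring_axioms.intro ring_quotient)
  interpret ring A by (rule ring_quotient)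
  fix j
  have "subgroup (homog A j) (add_monoid A)"
  proof (rule group.subgroupI[OF a_group])
    fix x assume "x \<in> homog A j"
    then obtain f where f: "x = \<pi> f" "f \<in> free_homog j"
      by (auto simp: quotient_homog)
    have "\<ominus>\<^bsub>A\<^esub> x = \<pi> (- f)"
      by (rule minus_equality) (simp_all add: f quotient_simps)
    then show "inv\<^bsub>add_monoid A\<^esub> x \<in> homog A j"
      using f by (auto simp: a_inv_def quotient_homog)
  next
    fix x y assume "x \<in> homog A j" "y \<in> homog A j"
    then show "x \<otimes>\<^bsub>add_monoid A\<^esub> y \<in> homog A j"
      by (auto simp: quotient_homog quotient_add)
  qed (auto simp: quotient_homog quotient_carrier)
  then show "additive_subgroup (homog A j) A"
    by (rule additive_subgroup.intro)
next
  fix x y i j assume "x \<in> homog A i" "y \<in> homog A j"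
  then show "x \<otimes>\<^bsub>A\<^esub> y \<in> homog A (i + j)"
    by (auto simp: quotient_homog quotient_mult free_homog_mult)
next
  show "\<one>\<^bsub>A\<^esub> \<in> homog A 0"
    using const_in_free_homog[of 1] by (auto simp: quotient_homog quotient_one)
  show "\<one>\<^bsub>A\<^esub> \<noteq> \<zero>\<^bsub>A\<^esub>"
    using I_low_degree(1)[of 1] by (auto simp: quotient_one pi_eq_zero_iff simp flip: zero_list_def)
  show "scalars A = homog A 0"
    by (simp add: quotient_scalars quotient_homog free_homog_0_eq)
next
  fix x i j assume "x \<in> homog A j"
  then show "proj i x = (if i = j then x else \<zero>\<^bsub>A\<^esub>)"
    by (auto simp: quotient_homog proj_pi hcomp_free_homog quotient_zero)
next
  fix x j assume "x \<in> carrier A"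
  then obtain f where f: "x = \<pi> f"
    by (auto simp: quotient_carrier)
  show "proj j x \<in> homog A j"
    by (simp add: f proj_pi quotient_homog)
  have sub: "{j. proj j x \<noteq> \<zero>\<^bsub>A\<^esub>} \<subseteq> {j. hcomp j f \<noteq> 0}"
    by (auto simp: f proj_pi quotient_zero)
  then show fin: "finite {j. proj j x \<noteq> \<zero>\<^bsub>A\<^esub>}"
    using finite_hcomp finite_subset by blast
  interpret ring A by (rule ring_quotient)
  have "(\<Oplus>\<^bsub>A\<^esub>j\<in>{j. proj j x \<noteq> \<zero>\<^bsub>A\<^esub>}. proj j x) = (\<Oplus>\<^bsub>A\<^esub>j\<in>{j. hcomp j f \<noteq> 0}. proj j x)"
    using sub finite_hcomp by (intro add.finprod_mono_neutral_cong_left) (auto simp: f proj_pi quotient_carrier)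
  also have "\<dots> = x"
    by (simp add: f proj_pi quotient_finsum[OF finite_hcomp] sum_hcomp[OF finite_hcomp])
  finally show "(\<Oplus>\<^bsub>A\<^esub>j\<in>{j. proj j x \<noteq> \<zero>\<^bsub>A\<^esub>}. proj j x) = x" .
next
  fix x y assume "x \<in> carrier A" "y \<in> carrier A"
  then obtain f h where fh: "x = \<pi> f" "y = \<pi> h"
    by (auto simp: quotient_carrier)
  show "proj j (x \<oplus>\<^bsub>A\<^esub> y) = proj j x \<oplus>\<^bsub>A\<^esub> proj j y" for j
    by (simp add: fh proj_pi quotient_add)
  have "hcomp 0 f = const (Poly_Mapping.lookup f [])" for f :: "('g, 'k) free"
    by (auto intro!: poly_mapping_eqI simp: const_def lookup_single when_def)
  then show "proj 0 (x \<otimes>\<^bsub>A\<^esub> y) = proj 0 x \<otimes>\<^bsub>A\<^esub> proj 0 y"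
    by (simp add: fh proj_pi quotient_mult const_mult)
qed

lemma pi_in_homog: "f \<in> free_homog j \<Longrightarrow> \<pi> f \<in> homog A j"
  by (auto simp: quotient_homog)

lemma pi_in_carrier [simp]: "\<pi> f \<in> carrier A"
  by (auto simp: quotient_carrier)

section \<open>Exactness as a congruence modulo the ideal\<close>

definition pi_vec :: "nat \<Rightarrow> (nat \<Rightarrow> ('g, 'k) free) \<Rightarrow> nat \<Rightarrow> ('g, 'k) free set" where
  "pi_vec n u = (\<lambda>i. if i < n then \<pi> (u i) else \<zero>\<^bsub>A\<^esub>)"

lemma carrier_free_mod_quotient: "carrier (A.free_mod n m) = range (pi_vec n)"
proof (intro subset_antisym subsetI)
  fix v assume v: "v \<in> carrier (A.free_mod n m)"
  then have "\<forall>i. \<exists>f. i < n \<longrightarrow> v i = \<pi> f"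
    by (simp add: A.carrier_free_mod quotient_carrier image_iff)
  then obtain u where "\<forall>i. i < n \<longrightarrow> v i = \<pi> (u i)"
    by metis
  then have "v = pi_vec n u"
    using v by (intro ext) (simp add: pi_vec_def A.carrier_free_mod)
  then show "v \<in> range (pi_vec n)"
    by blast
qed (auto simp: pi_vec_def A.carrier_free_mod)

lemma row_map_pi: "A.row_map n (\<lambda>j. \<pi> (D j)) (pi_vec n u) = \<pi> (\<Sum>j<n. D j * u j)"
proof -
  have "A.row_map n (\<lambda>j. \<pi> (D j)) (pi_vec n u) = (\<Oplus>\<^bsub>A\<^esub>j\<in>{..<n}. \<pi> (D j * u j))"
    unfolding A.row_map_def by (intro A.finsum_cong') (auto simp: pi_vec_def quotient_mult)
  then show ?thesis
    by (simp add: quotient_finsum)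
qed

lemma mat_map_pi:
  "A.mat_map n' n (\<lambda>i j. \<pi> (D i j)) (pi_vec n u) = pi_vec n' (\<lambda>i. \<Sum>j<n. D i j * u j)"
  unfolding A.mat_map_def row_map_pi by (simp add: pi_vec_def)

lemma pi_vec_eq_iff: "pi_vec n u = pi_vec n w \<longleftrightarrow> (\<forall>i<n. u i - w i \<in> I)"
  unfolding pi_vec_def fun_eq_iff by (auto simp: pi_eq_iff)

text \<open>From here on a resolution is checked by congruences in the free algebra. In
  \<open>ex0\<close> one implication suffices, because linear forms and elements of \<open>I\<close>
  have no constant term.\<close>

lemma koszul_if_exact:
  fixes n :: "nat \<Rightarrow> nat" and D\<^sub>1 :: "nat \<Rightarrow> ('g, 'k) free" and D :: "nat \<Rightarrow> nat \<Rightarrow> nat \<Rightarrow> ('g, 'k) free"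
  assumes D1: "\<And>j. j < n 1 \<Longrightarrow> D\<^sub>1 j \<in> free_homog 1"
    and D: "\<And>m i j. m \<ge> 1 \<Longrightarrow> i < n m \<Longrightarrow> j < n (Suc m) \<Longrightarrow> D m i j \<in> free_homog 1"
    and ex0: "\<And>f. Poly_Mapping.lookup f [] = 0 \<Longrightarrow> \<exists>w. f - (\<Sum>j<n 1. D\<^sub>1 j * w j) \<in> I"
    and ex1: "\<And>v. (\<Sum>j<n 1. D\<^sub>1 j * v j) \<in> I \<longleftrightarrow>
      (\<exists>w. \<forall>i<n 1. v i - (\<Sum>j<n 2. D 1 i j * w j) \<in> I)"
    and ex: "\<And>m v. m \<ge> 1 \<Longrightarrow> (\<forall>i<n m. (\<Sum>j<n (Suc m). D m i j * v j) \<in> I) \<longleftrightarrow>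
      (\<exists>w. \<forall>i<n (Suc m). v i - (\<Sum>j<n (Suc (Suc m)). D (Suc m) i j * w j) \<in> I)"
  shows "koszul A"
proof (rule A.koszul_if_exact[where n = n and D\<^sub>1 = "\<lambda>j. \<pi> (D\<^sub>1 j)" and D = "\<lambda>m i j. \<pi> (D m i j)"])
  show "\<pi> (D\<^sub>1 j) \<in> homog A 1" if "j < n 1" for j
    using D1 that pi_in_homog by blast
  show "\<pi> (D m i j) \<in> homog A 1" if "m \<ge> 1" "i < n m" "j < n (Suc m)" for m i j
    using D that pi_in_homog by blast
next
  fix a assume "a \<in> carrier A"
  then obtain f where f: "a = \<pi> f"
    by (auto simp: quotient_carrier)
  have hcomp0: "hcomp 0 f \<in> I \<longleftrightarrow> Poly_Mapping.lookup f [] = 0" for f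
  proof
    assume "hcomp 0 f \<in> I"
    then show "Poly_Mapping.lookup f [] = 0"
      using I_low_degree(1)[of "hcomp 0 f"] by simp
  next
    assume "Poly_Mapping.lookup f [] = 0"
    then have "hcomp 0 f = 0"
      by (intro poly_mapping_eqI) simp
    then show "hcomp 0 f \<in> I"
      by simp
  qed
  have "proj 0 a = \<zero>\<^bsub>A\<^esub> \<longleftrightarrow> Poly_Mapping.lookup f [] = 0"
    by (simp add: f proj_pi pi_eq_zero_iff hcomp0)
  also have "\<dots> \<longleftrightarrow> (\<exists>w. f - (\<Sum>j<n 1. D\<^sub>1 j * w j) \<in> I)"
  proof
    assume "\<exists>w. f - (\<Sum>j<n 1. D\<^sub>1 j * w j) \<in> I"
    then obtain w where w: "f - (\<Sum>j<n 1. D\<^sub>1 j * w j) \<in> I"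
      by blast
    have "Poly_Mapping.lookup (D\<^sub>1 j) [] = 0" if "j < n 1" for j
      using D1[OF that] lookup_Nil_free_homog[of "D\<^sub>1 j" 0] by simp
    then show "Poly_Mapping.lookup f [] = 0"
      using I_low_degree(1)[OF w] by (simp add: lookup_minus lookup_sum)
  qed (rule ex0)
  also have "\<dots> \<longleftrightarrow> a \<in> A.row_map (n 1) (\<lambda>j. \<pi> (D\<^sub>1 j)) ` carrier (A.free_mod (n 1) 1)"
    by (auto simp: carrier_free_mod_quotient row_map_pi f pi_eq_iff image_iff)
  finally show "proj 0 a = \<zero>\<^bsub>A\<^esub> \<longleftrightarrow>
      a \<in> A.row_map (n 1) (\<lambda>j. \<pi> (D\<^sub>1 j)) ` carrier (A.free_mod (n 1) 1)" .
next
  fix v assume "v \<in> carrier (A.free_mod (n 1) 1)"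
  then obtain u where u: "v = pi_vec (n 1) u"
    by (auto simp: carrier_free_mod_quotient)
  show "A.row_map (n 1) (\<lambda>j. \<pi> (D\<^sub>1 j)) v = \<zero>\<^bsub>A\<^esub> \<longleftrightarrow>
      v \<in> A.mat_map (n 1) (n 2) (\<lambda>i j. \<pi> (D 1 i j)) ` carrier (A.free_mod (n 2) 2)"
    using ex1[of u]
    by (auto simp: u row_map_pi pi_eq_zero_iff carrier_free_mod_quotient mat_map_pi pi_vec_eq_iff image_iff)
next
  fix m v assume m: "m \<ge> (1::nat)" and "v \<in> carrier (A.free_mod (n (Suc m)) (Suc m))"
  then obtain u where u: "v = pi_vec (n (Suc m)) u"
    by (auto simp: carrier_free_mod_quotient)
  show "(\<forall>i<n m. A.row_map (n (Suc m)) (\<lambda>j. \<pi> (D m i j)) v = \<zero>\<^bsub>A\<^esub>) \<longleftrightarrow>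
      v \<in> A.mat_map (n (Suc m)) (n (Suc (Suc m))) (\<lambda>i j. \<pi> (D (Suc m) i j)) `
        carrier (A.free_mod (n (Suc (Suc m))) (Suc (Suc m)))"
    using ex[OF m, of u]
    by (auto simp: u row_map_pi pi_eq_zero_iff carrier_free_mod_quotient mat_map_pi pi_vec_eq_iff image_iff)
qed

section \<open>Dimensions in the quotient\<close>

lemma subfield_scalars: "subfield (scalars A) A"
proof (rule A.subfieldI)
  show "subcring (scalars A) A"
  proof (rule A.subcringI[OF A.subringI])
    fix h assume "h \<in> scalars A"
    then show "\<ominus>\<^bsub>A\<^esub> h \<in> scalars A"
      using A.minus_homog by (simp add: A.scalars_eq)
  next
    fix h k assume "h \<in> scalars A" "k \<in> scalars A"
    then show "h \<otimes>\<^bsub>A\<^esub> k \<in> scalars A" "h \<oplus>\<^bsub>A\<^esub> k \<in> scalars A"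
      using A.homog_mult[of h 0 k 0] A.add_homog by (simp_all add: A.scalars_eq)
    show "h \<otimes>\<^bsub>A\<^esub> k = k \<otimes>\<^bsub>A\<^esub> h"
      using \<open>h \<in> scalars A\<close> \<open>k \<in> scalars A\<close> by (auto simp: quotient_scalars quotient_mult mult.commute simp flip: const_mult)
  qed (use A.homog_carrier A.one_homog in \<open>auto simp: A.scalars_eq\<close>)
  show "Units (A\<lparr>carrier := scalars A\<rparr>) = scalars A - {\<zero>\<^bsub>A\<^esub>}"
  proof (intro subset_antisym subsetI)
    fix y assume y: "y \<in> Units (A\<lparr>carrier := scalars A\<rparr>)"
    then obtain x where "x \<in> scalars A" "x \<otimes>\<^bsub>A\<^esub> y = \<one>\<^bsub>A\<^esub>"
      by (auto simp: Units_def)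
    then have "y \<noteq> \<zero>\<^bsub>A\<^esub>"
      using A.one_neq_zero A.homog_carrier A.r_null unfolding A.scalars_eq by metis
    then show "y \<in> scalars A - {\<zero>\<^bsub>A\<^esub>}"
      using y by (simp add: Units_def)
  next
    fix y assume "y \<in> scalars A - {\<zero>\<^bsub>A\<^esub>}"
    then obtain c where c: "y = \<pi> (const c)" "\<pi> (const c) \<noteq> \<pi> 0"
      unfolding quotient_scalars quotient_zero by blast
    then have "c \<noteq> 0"
      by auto
    then have "\<pi> (const (inverse c)) \<otimes>\<^bsub>A\<^esub> y = \<one>\<^bsub>A\<^esub>" "y \<otimes>\<^bsub>A\<^esub> \<pi> (const (inverse c)) = \<one>\<^bsub>A\<^esub>"
      by (simp_all add: c(1) quotient_mult quotient_one flip: const_mult)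
    then show "y \<in> Units (A\<lparr>carrier := scalars A\<rparr>)"
      using c(1) by (auto simp: Units_def quotient_scalars)
  qed
qed

lemma Span_pi:
  assumes "set xs \<subseteq> free_homog n"
  shows "A.Span (scalars A) (map \<pi> xs) = \<pi> ` free_space.span (set xs)"
proof (induction xs)
  case Nil
  show ?case
    by (simp add: quotient_zero)
next
  case (Cons x xs)
  have "A.Span (scalars A) (map \<pi> (x # xs)) =
      A.line_extension (scalars A) (\<pi> x) (\<pi> ` free_space.span (set xs))"
    using Cons by simp
  also have "\<dots> = \<pi> ` free_space.span (set (x # xs))"
  proof (intro subset_antisym subsetI)
    fix u assume "u \<in> A.line_extension (scalars A) (\<pi> x) (\<pi> ` free_space.span (set xs))"
    then obtain c y where u: "u = \<pi> (const c * x + y)" "y \<in> free_space.span (set xs)"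
      by (auto simp: A.line_extension_mem_iff quotient_scalars quotient_mult quotient_add)
    have "const c * x + y \<in> free_space.span (set (x # xs))"
      using u(2) by (auto simp: free_space.span_breakdown_eq smul_def intro!: exI[of _ c])
    then show "u \<in> \<pi> ` free_space.span (set (x # xs))"
      using u(1) by blast
  next
    fix u assume "u \<in> \<pi> ` free_space.span (set (x # xs))"
    then obtain z c where z: "u = \<pi> z" "z - const c * x \<in> free_space.span (set xs)"
      by (auto simp: free_space.span_breakdown_eq smul_def)
    have "u = \<pi> (const c) \<otimes>\<^bsub>A\<^esub> \<pi> x \<oplus>\<^bsub>A\<^esub> \<pi> (z - const c * x)"
      by (simp add: z(1) quotient_mult quotient_add)
    then show "u \<in> A.line_extension (scalars A) (\<pi> x) (\<pi> ` free_space.span (set xs))"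
      using z(2) by (auto simp: A.line_extension_mem_iff quotient_scalars)
  qed
  finally show ?case .
qed

text \<open>A relation among the images lifts to one modulo the degree \<open>n\<close> part of
  \<open>I\<close>, that is modulo the span of \<open>B\<close>, and \<open>B\<close> together with
  \<open>xs\<close> is independent.\<close>

lemma independent_pi:
  assumes "free_space.span B = I_homog n" "distinct xs" "set xs \<inter> B = {}" "set xs \<subseteq> free_homog n"
    "free_space.independent (B \<union> set xs)"
  shows "A.independent (scalars A) (map \<pi> xs)"
  using assms(2-5)
proof (induction xs)
  case Nil
  then show ?case
    by simp
next
  case (Cons x xs)
  have "free_space.independent (B \<union> set xs)"
    by (rule free_space.independent_mono[OF Cons.prems(4)]) auto
  then have IH: "A.independent (scalars A) (map \<pi> xs)"
    using Cons by auto
  have "\<pi> x \<notin> A.Span (scalars A) (map \<pi> xs)"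
  proof
    assume "\<pi> x \<in> A.Span (scalars A) (map \<pi> xs)"
    then obtain y where y: "\<pi> x = \<pi> y" "y \<in> free_space.span (set xs)"
      using Span_pi[of xs n] Cons.prems by auto
    have "y \<in> free_homog n"
      using y(2) free_space.span_minimal[OF _ subspace_free_homog, of "set xs" n] Cons.prems by auto
    then have "x - y \<in> free_space.span B"
      using y(1) Cons.prems by (auto simp: pi_eq_iff assms(1))
    then have "(x - y) + y \<in> free_space.span (B \<union> set xs)"
      using y(2) by (intro free_space.span_add) (auto intro: subsetD[OF free_space.span_mono, rotated])
    then have "x \<in> free_space.span (B \<union> set (x # xs) - {x})"
      using Cons.prems by (auto elim!: subsetD[OF free_space.span_mono, rotated])
    then show False
      using Cons.prems(4) by (auto simp: free_space.dependent_def)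
  qed
  then show ?case
    using IH by (auto intro!: A.li_Cons)
qed

text \<open>Extend a basis of the degree \<open>n\<close> part of \<open>I\<close> to one of the
  degree \<open>n\<close> part of F; the added vectors map to a basis of A_n.\<close>

lemma dim_quotient_homog: "A.dim (scalars A) (homog A n) = hdim n"
proof -
  obtain B C where BC: "B \<subseteq> C" "finite C" "free_space.independent C" "free_space.span B = I_homog n"
    "free_space.span C = free_homog n" "card B = free_space.dim (I_homog n)"
    "card C = free_space.dim (free_homog n :: ('g, 'k) free set)"
    using free_space.nested_bases[OF subspace_I_homog subspace_free_homog Int_lower2, of n] dim_free_homog by metis
  obtain xs where xs: "set xs = C - B" "distinct xs"
    using BC(2) finite_distinct_list by (metis finite_Diff)
  have CB: "B \<union> set xs = C"
    using BC(1) xs by auto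
  have xsn: "set xs \<subseteq> free_homog n"
    using xs BC(5) free_space.span_superset by blast
  have len: "length xs = hdim n"
    using BC xs dim_free_homog[of n, where ?'g = 'g and ?'k = 'k]
    by (metis card_Diff_subset distinct_card finite_subset hdim_def)
  have "A.independent (scalars A) (map \<pi> xs)"
    by (rule independent_pi[of B n]) (use BC CB xs xsn in auto)
  then have "A.dimension (hdim n) (scalars A) (A.Span (scalars A) (map \<pi> xs))"
    using A.dimension_independent len by fastforce
  also have "A.Span (scalars A) (map \<pi> xs) = \<pi> ` free_space.span (set xs)"
    by (rule Span_pi[OF xsn])
  also have "\<dots> = homog A n"
  proof (intro subset_antisym subsetI)
    fix u assume "u \<in> homog A n"
    then obtain f where f: "u = \<pi> f" "f \<in> free_space.span (B \<union> set xs)"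
      using BC(5) CB by (auto simp: quotient_homog)
    then obtain b y where bz: "f = b + y" "b \<in> free_space.span B" "y \<in> free_space.span (set xs)"
      by (auto simp: free_space.span_Un)
    then have "u = \<pi> y"
      using BC(4) f(1) bz by (simp add: pi_eq_iff)
    then show "u \<in> \<pi> ` free_space.span (set xs)"
      using bz(3) by blast
  qed (use free_space.span_minimal[OF xsn subspace_free_homog] in \<open>auto simp: quotient_homog\<close>)
  finally show ?thesis
    using A.dimI[OF subfield_scalars] by (simp add: over_def)
qed

lemma PHS_iff: "PHS A \<longleftrightarrow> (\<forall>n. hdim n = (n + 2) choose 2)"
  unfolding PHS_def hilbert_series_def inverse_one_minus_fps_X_cubed dim_quotient_homog
  by (simp add: fps_eq_iff)

end

section \<open>The relations of the Sklyanin algebra\<close>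

instance xyz :: finite
proof
  have "(UNIV :: xyz set) = {Gx, Gy, Gz}"
    using xyz.exhaust by auto
  then show "finite (UNIV :: xyz set)"
    by (rule ssubst) simp
qed

lemma UNIV_xyz: "UNIV = {Gx, Gy, Gz}"
  using xyz.exhaust by auto

lemma card_xyz [simp]: "card (UNIV :: xyz set) = 3"
  by (simp add: UNIV_xyz)

lemma sum_xyz: "(\<Sum>g\<in>UNIV. f g) = f Gx + f Gy + (f Gz :: 'a::comm_monoid_add)"
  by (simp add: UNIV_xyz add.assoc)

lemma all_xyz: "(\<forall>g. Q g) \<longleftrightarrow> Q Gx \<and> Q Gy \<and> Q Gz"
  by (metis xyz.exhaust)

fun nxt :: "xyz \<Rightarrow> xyz" where
  "nxt Gx = Gy" | "nxt Gy = Gz" | "nxt Gz = Gx"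

text \<open>The trilinear form with coefficients \<open>tau\<close> is invariant under cyclic permutation of its three
  arguments; contracting one of them with the generators gives the relations.\<close>

definition tau :: "'k::field \<Rightarrow> 'k \<Rightarrow> 'k \<Rightarrow> xyz \<Rightarrow> xyz \<Rightarrow> xyz \<Rightarrow> 'k" where
  "tau p q r k i j =
     (if i = k \<and> j = k then r
      else if i = nxt k \<and> j = nxt i then p
      else if j = nxt k \<and> i = nxt j then q
      else 0)"

definition lin :: "(xyz \<Rightarrow> 'k) \<Rightarrow> (xyz, 'k::field) free" where
  "lin a = (\<Sum>g\<in>UNIV. const (a g) * gen g)"

definition quad :: "(xyz \<Rightarrow> xyz \<Rightarrow> 'k) \<Rightarrow> (xyz, 'k::field) free" where
  "quad m = (\<Sum>i\<in>UNIV. gen i * lin (m i))"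

definition rel :: "'k::field \<Rightarrow> 'k \<Rightarrow> 'k \<Rightarrow> xyz \<Rightarrow> (xyz, 'k) free" where
  "rel p q r k = quad (tau p q r k)"

lemma lin_in_free_homog [simp, intro]: "lin a \<in> free_homog (Suc 0)"
  unfolding lin_def by (intro free_homog_sum const_mult_free_homog gen_in_free_homog)

lemma quad_in_free_homog [simp, intro]: "quad m \<in> free_homog 2"
  unfolding quad_def
  by (intro free_homog_sum free_homog_mult'[OF gen_in_free_homog lin_in_free_homog]) simp

lemma lin_add: "lin (\<lambda>i. a i + b i) = lin a + lin b"
  and lin_scale: "lin (\<lambda>i. c * a i) = const c * lin a"
  and lin_delta: "lin (\<lambda>i. if i = g then 1 else 0) = gen g"
  and lin_zero: "lin (\<lambda>i. 0) = 0"
  by (simp_all add: lin_def const_add const_mult distrib_right sum.distrib sum_distrib_left mult.assoc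
      if_distrib[of const] if_distrib[of "\<lambda>c. c * gen _"] cong: if_cong)

lemma lin_sum: "lin (\<lambda>i. \<Sum>k\<in>N. a k i) = (\<Sum>k\<in>N. lin (a k))"
  by (induction N rule: infinite_finite_induct) (simp_all add: lin_zero lin_add)

lemma dl_lin_mult [simp]: "dl g (lin a * f) = const (a g) * f"
  by (cases g) (simp_all add: lin_def sum_xyz distrib_right mult.assoc)

lemma dl_quad [simp]: "dl g (quad m) = lin (m g)"
  by (simp add: quad_def)

text \<open>It reads factorizations into linear forms off the coefficient matrices: each product of
  two forms contributes a matrix of rank at most 1.\<close>

lemma lin_mult_lin_sum: "(\<Sum>k\<in>N. lin (a k) * lin (b k)) = quad (\<lambda>i j. \<Sum>k\<in>N. a k i * b k j)"
proof -
  have "(\<Sum>k\<in>N. lin (a k) * lin (b k)) = (\<Sum>k\<in>N. \<Sum>i\<in>UNIV. gen i * lin (\<lambda>j. a k i * b k j))"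
    by (simp add: lin_def[of "a _"] lin_scale sum_distrib_right const_left_commute mult.assoc)
  also have "\<dots> = (\<Sum>i\<in>UNIV. gen i * (\<Sum>k\<in>N. lin (\<lambda>j. a k i * b k j)))"
    by (subst sum.swap) (simp add: sum_distrib_left)
  finally show ?thesis
    by (simp add: quad_def lin_sum)
qed

lemma quad_add: "quad (\<lambda>i j. a i j + b i j) = quad a + quad b"
  and quad_scale: "quad (\<lambda>i j. c * a i j) = const c * quad a"
  by (simp_all add: quad_def lin_add lin_scale distrib_left sum.distrib sum_distrib_left const_left_commute)

lemma quad_zero: "quad (\<lambda>i j. 0) = 0"
  by (simp add: quad_def lin_zero)

lemma quad_sum: "quad (\<lambda>i j. \<Sum>k\<in>N. a k i j) = (\<Sum>k\<in>N. quad (a k))"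
  by (induction N rule: infinite_finite_induct) (simp_all add: quad_zero quad_add)

lemma sklyanin_eq: "sklyanin p q r = quadratic_algebra (range (rel p q r))"
proof -
  have "range (rel p q r) = {rel p q r Gx, rel p q r Gy, rel p q r Gz}"
    by (simp add: UNIV_xyz)
  moreover have "rel p q r Gx = const p * gen Gy * gen Gz + const q * gen Gz * gen Gy + const r * gen Gx * gen Gx"
    "rel p q r Gy = const p * gen Gz * gen Gx + const q * gen Gx * gen Gz + const r * gen Gy * gen Gy"
    "rel p q r Gz = const p * gen Gx * gen Gy + const q * gen Gy * gen Gx + const r * gen Gz * gen Gz"
    by (simp_all add: rel_def quad_def lin_def sum_xyz tau_def const_left_commute mult.assoc add_ac)
  ultimately show ?thesis
    by (simp add: sklyanin_def Let_def)
qed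

section \<open>Passing between the three letters and the indices 0, 1, 2\<close>

definition idx :: "nat \<Rightarrow> xyz" where
  "idx i = (if i = 0 then Gx else if i = 1 then Gy else Gz)"

fun pos :: "xyz \<Rightarrow> nat" where
  "pos Gx = 0" | "pos Gy = 1" | "pos Gz = 2"

lemma idx_pos [simp]: "idx (pos g) = g"
  by (cases g) (simp_all add: idx_def)

lemma sum_pos: "(\<Sum>j<3. f j) = (\<Sum>g\<in>UNIV. f (pos g))"
  by (simp add: sum_xyz eval_nat_numeral)

lemma all_pos: "(\<forall>i<3. Q i) \<longleftrightarrow> (\<forall>g. Q (pos g))"
  by (simp add: all_xyz eval_nat_numeral less_Suc_eq all_conj_distrib imp_disjL) 

text \<open>The modules use vectors indexed by natural numbers, of which only three entries matter;
  any function of the letters extends to such a vector.\<close>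

lemma ex_pos: "(\<exists>w :: nat \<Rightarrow> 'a. Q (\<lambda>g. w (pos g))) \<longleftrightarrow> (\<exists>w. Q w)"
proof
  assume "\<exists>w. Q w"
  then obtain w where "Q w" ..
  then show "\<exists>w. Q (\<lambda>g. w (pos g))"
    by (intro exI[of _ "w \<circ> idx"]) simp
qed blast


section \<open>Independence of the relations and the first dimensions\<close>

locale sklyanin_relations =
  fixes p q r :: "'k::field"
begin

sublocale quadratic_relations "rel p q r"
  by unfold_locales (simp add: rel_def)

text \<open>If some element of \<open>{p, q, r}\<close> is nonzero, every relation contains a monomial that occurs in no
  other relation.\<close>

lemma rel_left_independent:
  assumes nz: "p \<noteq> 0 \<or> q \<noteq> 0 \<or> r \<noteq> 0" and sum: "(\<Sum>k\<in>UNIV. rel p q r k * f k) = 0"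
  shows "\<forall>k\<in>UNIV. f k = 0"
proof -
  have "const (tau p q r Gx i j) * f Gx + const (tau p q r Gy i j) * f Gy + const (tau p q r Gz i j) * f Gz
      = dl j (dl i (\<Sum>k\<in>UNIV. rel p q r k * f k))" for i j
  proof -
    have "dl i (rel p q r k * f k) = lin (tau p q r k i) * f k" for k
      using I_low_degree(1)[OF rel_in_I[of k]] by (simp add: dl_mult rel_def)
    then show ?thesis
      by (simp add: sum_xyz)
  qed
  then have "const (tau p q r Gx i j) * f Gx + const (tau p q r Gy i j) * f Gy + const (tau p q r Gz i j) * f Gz = 0"
    for i j
    by (simp add: sum)
  note eqs = this
  have zero: "f k = 0" if "const c * f k = 0" "c \<noteq> 0" for c k
  proof -
    have "const (inverse c) * (const c * f k) = f k"
      using that(2) by (simp add: mult.assoc[symmetric] const_mult[symmetric])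
    then show ?thesis
      using that(1) by simp
  qed
  \<comment> \<open>\<open>eqs\<close> lists the coefficients of the nine words of length 2: the
    squares isolate \<open>r\<close>, the words yz, zx, xy isolate \<open>p\<close>, and the
    reversed ones isolate \<open>q\<close>.\<close>
  show ?thesis
    unfolding Ball_def all_xyz
    using nz eqs[of Gx Gx] eqs[of Gy Gy] eqs[of Gz Gz] eqs[of Gy Gz] eqs[of Gz Gx] eqs[of Gx Gy]
      eqs[of Gz Gy] eqs[of Gx Gz] eqs[of Gy Gx]
    by (auto simp: tau_def dest: zero)
qed

lemma augmentation_exact:
  assumes "Poly_Mapping.lookup a [] = 0"
  shows "\<exists>w. a - (\<Sum>j<3. gen (idx j) * w j) \<in> I"
proof -
  have "a - (\<Sum>j<3. gen (idx j) * dl (idx j) a) = 0"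
    using gen_expansion[of a] assms by (simp add: sum_pos)
  then show ?thesis
    by (intro exI[of _ "\<lambda>j. dl (idx j) a"]) simp
qed

lemma I_homog_low: "I_homog 0 = {0}" "I_homog (Suc 0) = {0}"
  using I_homog_0 I_homog_1 by auto

lemma hdim_low: "hdim 0 = 1" "hdim (Suc 0) = 3"
  unfolding hdim_def I_homog_low dim_singleton_0 by simp_all

text \<open>Inclusion-exclusion for R F_n + V I_(n+1). The intersection consists of the syzygies
  between the relations, and its size is the only unknown in the Hilbert series.\<close>

lemma hdim_step:
  assumes "p \<noteq> 0 \<or> q \<noteq> 0 \<or> r \<noteq> 0"
  shows "free_space.dim (I_homog (Suc (Suc n))) +
      free_space.dim (lcomb (rel p q r) UNIV (free_homog n) \<inter> lcomb gen UNIV (I_homog (Suc n))) =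
    3 * 3 ^ n + 3 * free_space.dim (I_homog (Suc n))"
proof -
  have R: "free_space.fin_gen (lcomb (rel p q r) UNIV (free_homog n)) \<and>
      free_space.dim (lcomb (rel p q r) UNIV (free_homog n)) = 3 * 3 ^ n"
    using dim_lcomb[OF finite subspace_free_homog, of n "rel p q r"] rel_left_independent[OF assms]
      dim_free_homog[of n, where ?'g = xyz and ?'k = 'k] by simp
  have V: "free_space.fin_gen (lcomb gen UNIV (I_homog (Suc n))) \<and>
      free_space.dim (lcomb gen UNIV (I_homog (Suc n))) =
      3 * free_space.dim (I_homog (Suc n))"
    using dim_lcomb[OF finite subspace_I_homog fin_gen_I_homog gen_comb_eq_0] by simp
  show ?thesis
    unfolding I_homog_Suc_Suc
    using free_space.dim_sums_Int_fin_gen[OF subspace_lcomb[OF subspace_free_homog]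
        subspace_lcomb[OF subspace_I_homog], of "rel p q r" UNIV n gen UNIV "Suc n"] R V
    by simp
qed

lemma dim_I_homog_2:
  assumes "p \<noteq> 0 \<or> q \<noteq> 0 \<or> r \<noteq> 0"
  shows "free_space.dim (I_homog (Suc (Suc 0))) = 3"
proof -
  have "0 \<in> lcomb (rel p q r) UNIV (free_homog 0)"
    using free_space.subspace_0[OF subspace_lcomb[OF subspace_free_homog]] .
  then have "lcomb (rel p q r) UNIV (free_homog 0) \<inter> lcomb gen UNIV (I_homog (Suc 0)) = {0}"
    unfolding I_homog_low lcomb_zero by auto
  then show ?thesis
    using hdim_step[OF assms, of 0] by (simp add: I_homog_low dim_singleton_0)
qed

end

section \<open>Degenerate parameters\<close>

text \<open>Here the free resolution has rank 3 in every positive degree, with the same matrix \<open>N\<close>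
  everywhere. As some combination of the rows of \<open>N\<close> is the row of generators, the kernel of
  \<open>N\<close> lies in the kernel of that row, which is the image of \<open>N\<close>.\<close>

locale periodic_resolution = sklyanin_relations p q r for p q r :: "'k::field" +
  fixes \<nu> :: "xyz \<Rightarrow> xyz \<Rightarrow> xyz \<Rightarrow> 'k"
    and c :: "xyz \<Rightarrow> 'k" and \<sigma> :: "xyz \<Rightarrow> xyz" and \<epsilon> :: "xyz \<Rightarrow> 'k"
    and f :: "xyz \<Rightarrow> xyz \<Rightarrow> 'k" and \<kappa> :: "xyz \<Rightarrow> xyz \<Rightarrow> xyz"
  assumes nonzero: "p \<noteq> 0 \<or> q \<noteq> 0 \<or> r \<noteq> 0"
    and column: "\<nu> g h j = c h * tau p q r (\<sigma> h) g j"
    and c_nonzero: "c h \<noteq> 0" and \<sigma>_bij: "bij \<sigma>"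
    and square: "(\<Sum>k\<in>UNIV. \<nu> g k i * \<nu> k h j) = f g h * tau p q r (\<kappa> g h) i j"
    and row: "(\<Sum>g\<in>UNIV. \<epsilon> g * \<nu> g h j) = (if j = h then 1 else 0)"
begin

abbreviation N :: "xyz \<Rightarrow> xyz \<Rightarrow> (xyz, 'k) free" where
  "N g h \<equiv> lin (\<nu> g h)"

lemma N_square: "(\<Sum>k\<in>UNIV. N g k * N k h) = const (f g h) * rel p q r (\<kappa> g h)"
  by (simp add: lin_mult_lin_sum square quad_scale rel_def)

lemma N_rows: "(\<Sum>g\<in>UNIV. const (\<epsilon> g) * N g h) = gen h"
proof -
  have "(\<Sum>g\<in>UNIV. const (\<epsilon> g) * N g h) = lin (\<lambda>j. \<Sum>g\<in>UNIV. \<epsilon> g * \<nu> g h j)"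
    by (simp add: lin_sum lin_scale)
  then show ?thesis
    by (simp add: row lin_delta)
qed

lemma rows_comb:
  "(\<Sum>g\<in>UNIV. const (\<epsilon> g) * (\<Sum>h\<in>UNIV. N g h * v h)) = (\<Sum>h\<in>UNIV. gen h * v h)"
proof -
  have "(\<Sum>g\<in>UNIV. const (\<epsilon> g) * (\<Sum>h\<in>UNIV. N g h * v h)) =
      (\<Sum>h\<in>UNIV. \<Sum>g\<in>UNIV. const (\<epsilon> g) * N g h * v h)"
    by (subst sum.swap) (simp add: sum_distrib_left mult.assoc)
  then show ?thesis
    by (simp add: N_rows flip: sum_distrib_right)
qed

lemma N_dl_rel: "N g h = dl g (rel p q r (\<sigma> h)) * const (c h)"
  by (simp add: rel_def const_commute column[abs_def] lin_scale)

definition \<rho> :: "xyz \<Rightarrow> xyz" where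
  "\<rho> = inv_into UNIV \<sigma>"

lemma rho_sigma [simp]: "\<rho> (\<sigma> k) = k" "\<sigma> (\<rho> k) = k"
  using bij_is_inj[OF \<sigma>_bij] bij_is_surj[OF \<sigma>_bij] by (simp_all add: \<rho>_def surj_f_inv_f)

lemma sum_sigma: "(\<Sum>k\<in>UNIV. F k) = (\<Sum>h\<in>UNIV. F (\<sigma> h))"
  by (rule sum.reindex_bij_betw[OF \<sigma>_bij, symmetric])

text \<open>\<open>N\<close> arises from the matrix of \<open>gen_comb_in_I_iff\<close> by permuting
  columns with \<open>\<sigma>\<close> and rescaling them with \<open>c\<close>. Both operations are
  invertible, so the image is the same.\<close>

lemma gen_comb_in_I_iff_N: "(\<Sum>g\<in>UNIV. gen g * v g) \<in> I \<longleftrightarrow>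
    (\<exists>w. \<forall>g. v g - (\<Sum>h\<in>UNIV. N g h * w h) \<in> I)"
proof -
  have eq: "(\<Sum>h\<in>UNIV. N g h * w h) = (\<Sum>k\<in>UNIV. dl g (rel p q r k) * (const (c (\<rho> k)) * w (\<rho> k)))"
    for g w
    unfolding N_dl_rel
      sum_sigma[of "\<lambda>k. dl g (rel p q r k) * (const (c (\<rho> k)) * w (\<rho> k))"]
    by (simp add: mult.assoc)
  have ex: "(\<exists>w. Q (\<lambda>k. const (c (\<rho> k)) * w (\<rho> k))) \<longleftrightarrow> (\<exists>h. Q h)"
    for Q :: "(xyz \<Rightarrow> (xyz, 'k) free) \<Rightarrow> bool"
  proof
    assume "\<exists>h. Q h"
    then obtain h where h: "Q h" ..
    have "h = (\<lambda>k. const (c (\<rho> k)) * (const (inverse (c (\<rho> k))) * h (\<sigma> (\<rho> k))))"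
      using c_nonzero
      by (simp add: mult.assoc[symmetric] const_mult[symmetric])
    then show "\<exists>w. Q (\<lambda>k. const (c (\<rho> k)) * w (\<rho> k))"
      using h by (intro exI[of _ "\<lambda>k. const (inverse (c k)) * h (\<sigma> k)"]) simp
  qed blast
  show ?thesis
    unfolding gen_comb_in_I_iff eq
    using ex[of "\<lambda>h. \<forall>g. v g - (\<Sum>k\<in>UNIV. dl g (rel p q r k) * h k) \<in> I"] by simp
qed

lemma N_exact: "(\<forall>g. (\<Sum>h\<in>UNIV. N g h * v h) \<in> I) \<longleftrightarrow>
    (\<exists>w. \<forall>g. v g - (\<Sum>h\<in>UNIV. N g h * w h) \<in> I)"
proof
  assume "\<forall>g. (\<Sum>h\<in>UNIV. N g h * v h) \<in> I"
  then have "(\<Sum>g\<in>UNIV. const (\<epsilon> g) * (\<Sum>h\<in>UNIV. N g h * v h)) \<in> I"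
    by blast
  then show "\<exists>w. \<forall>g. v g - (\<Sum>h\<in>UNIV. N g h * w h) \<in> I"
    unfolding rows_comb gen_comb_in_I_iff_N .
next
  assume "\<exists>w. \<forall>g. v g - (\<Sum>h\<in>UNIV. N g h * w h) \<in> I"
  then obtain w where w: "\<forall>g. v g - (\<Sum>h\<in>UNIV. N g h * w h) \<in> I" ..
  show "\<forall>g. (\<Sum>h\<in>UNIV. N g h * v h) \<in> I"
  proof
    fix g
    have "(\<Sum>k\<in>UNIV. N g k * (\<Sum>h\<in>UNIV. N k h * w h)) = (\<Sum>h\<in>UNIV. (\<Sum>k\<in>UNIV. N g k * N k h) * w h)"
      by (simp add: sum_distrib_left sum_distrib_right mult.assoc) (rule sum.swap)
    also have "\<dots> \<in> I"
      unfolding N_square by blast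
    finally have "(\<Sum>k\<in>UNIV. N g k * (\<Sum>h\<in>UNIV. N k h * w h)) \<in> I" .
    moreover have "(\<Sum>k\<in>UNIV. N g k * (v k - (\<Sum>h\<in>UNIV. N k h * w h))) \<in> I"
      using w by blast
    ultimately show "(\<Sum>h\<in>UNIV. N g h * v h) \<in> I"
      using I_diff_cong by (simp add: right_diff_distrib sum_subtractf)
  qed
qed

lemma koszul: "koszul (sklyanin p q r)"
  unfolding sklyanin_eq
proof (rule koszul_if_exact[where n = "\<lambda>_. 3" and D\<^sub>1 = "\<lambda>j. gen (idx j)"
      and D = "\<lambda>_ i j. N (idx i) (idx j)"])
  fix a :: "(xyz, 'k) free"
  assume "Poly_Mapping.lookup a [] = 0"
  then show "\<exists>w. a - (\<Sum>j<3. gen (idx j) * w j) \<in> I"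
    by (rule augmentation_exact)
next
  fix v :: "nat \<Rightarrow> (xyz, 'k) free"
  show "(\<Sum>j<3. gen (idx j) * v j) \<in> I \<longleftrightarrow>
      (\<exists>w. \<forall>i<3. v i - (\<Sum>j<3. N (idx i) (idx j) * w j) \<in> I)"
    using gen_comb_in_I_iff_N[of "\<lambda>g. v (pos g)"]
      ex_pos[of "\<lambda>w. \<forall>g. v (pos g) - (\<Sum>h\<in>UNIV. N g h * w h) \<in> I"]
    by (simp add: sum_pos all_pos)
next
  fix v :: "nat \<Rightarrow> (xyz, 'k) free"
  show "(\<forall>i<3. (\<Sum>j<3. N (idx i) (idx j) * v j) \<in> I) \<longleftrightarrow>
      (\<exists>w. \<forall>i<3. v i - (\<Sum>j<3. N (idx i) (idx j) * w j) \<in> I)"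
    using N_exact[of "\<lambda>g. v (pos g)"]
      ex_pos[of "\<lambda>w. \<forall>g. v (pos g) - (\<Sum>h\<in>UNIV. N g h * w h) \<in> I"]
    by (simp add: sum_pos all_pos)
qed simp_all

text \<open>PHS would give dim I_3 = 27 - 10 = 17, and \<open>hdim_step\<close> would then leave 18
  - 17 = 1 dimension for the intersection of R V and V R. Three independent elements of that
  intersection are exhibited.\<close>

lemma not_PHS: "\<not> PHS (sklyanin p q r)"
proof
  assume "PHS (sklyanin p q r)"
  then have "hdim (Suc (Suc (Suc 0))) = 10"
    unfolding sklyanin_eq PHS_iff by (simp add: choose_two)
  moreover have "hdim (Suc (Suc (Suc 0))) +
      free_space.dim (I_homog (Suc (Suc (Suc 0)))) = 27"
    using hdim_eq[of "Suc (Suc (Suc 0))"] by simp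
  ultimately have dim_I: "free_space.dim (I_homog (Suc (Suc (Suc 0)))) = 17"
    by simp
  \<comment> \<open>The entries of the row (x, y, z) N N. Bracketing the first product puts them in
    R V, bracketing the second puts them in V R.\<close>
  define \<omega> where "\<omega> h = (\<Sum>g\<in>UNIV. gen g * (\<Sum>k\<in>UNIV. N g k * N k h))" for h
  have \<omega>_rel: "\<omega> h = (\<Sum>k\<in>UNIV. rel p q r (\<sigma> k) * (const (c k) * N k h))" for h
  proof -
    have "\<omega> h = (\<Sum>k\<in>UNIV. (\<Sum>g\<in>UNIV. gen g * dl g (rel p q r (\<sigma> k))) * (const (c k) * N k h))"
      unfolding \<omega>_def N_dl_rel[of _ _]
      by (simp add: sum_distrib_left sum_distrib_right mult.assoc) (rule sum.swap)
    moreover have "(\<Sum>g\<in>UNIV. gen g * dl g (rel p q r k)) = rel p q r k" for k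
      by (simp add: rel_def quad_def)
    ultimately show ?thesis
      by simp
  qed
  \<comment> \<open>The row of generators is injective on columns over the free algebra, and it is a
    combination of the rows of \<open>N\<close>; so the row and the two factors \<open>N\<close> can
    be peeled off one after the other.\<close>
  have indep: "\<forall>h\<in>UNIV. v h = 0" if "(\<Sum>h\<in>UNIV. \<omega> h * v h) = 0" for v
  proof -
    have "(\<Sum>g\<in>UNIV. gen g * (\<Sum>k\<in>UNIV. N g k * (\<Sum>h\<in>UNIV. N k h * v h))) = (\<Sum>h\<in>UNIV. \<omega> h * v h)"
      unfolding \<omega>_def sum_xyz by (simp add: algebra_simps)
    then have "(\<Sum>k\<in>UNIV. N g k * (\<Sum>h\<in>UNIV. N k h * v h)) = 0" for g
      using gen_comb_eq_0 that by fastforce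
    then have "(\<Sum>k\<in>UNIV. gen k * (\<Sum>h\<in>UNIV. N k h * v h)) = 0"
      using rows_comb[of "\<lambda>k. \<Sum>h\<in>UNIV. N k h * v h"] by simp
    then have "(\<Sum>h\<in>UNIV. N k h * v h) = 0" for k
      using gen_comb_eq_0 by fastforce
    then have "(\<Sum>h\<in>UNIV. gen h * v h) = 0"
      using rows_comb[of v] by simp
    then show ?thesis
      by (rule gen_comb_eq_0)
  qed
  let ?X = "lcomb (rel p q r) UNIV (free_homog (Suc 0)) \<inter> lcomb gen UNIV (I_homog (Suc (Suc 0)))"
  have "lcomb \<omega> UNIV (free_homog 0) \<subseteq> ?X"
  proof
    fix x assume "x \<in> lcomb \<omega> UNIV (free_homog 0)"
    then obtain v where v: "x = (\<Sum>h\<in>UNIV. \<omega> h * v h)" "\<And>h. v h \<in> free_homog 0"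
      by (auto elim!: lcombE)
    have "x = (\<Sum>k\<in>UNIV. rel p q r (\<sigma> k) * (\<Sum>h\<in>UNIV. const (c k) * (N k h * v h)))"
      unfolding v(1) \<omega>_rel by (simp add: sum_distrib_left sum_distrib_right mult.assoc) (rule sum.swap)
    also have "\<dots> = (\<Sum>k\<in>UNIV. rel p q r k * (\<Sum>h\<in>UNIV. const (c (\<rho> k)) * (N (\<rho> k) h * v h)))"
      by (rule sum.reindex_bij_betw[OF \<sigma>_bij, THEN trans[rotated]])
        simp
    also have "\<dots> \<in> lcomb (rel p q r) UNIV (free_homog (Suc 0))"
      using v(2)
      by (intro lcombI free_homog_sum const_mult_free_homog free_homog_mult'[OF lin_in_free_homog]) auto
    finally have xR: "x \<in> lcomb (rel p q r) UNIV (free_homog (Suc 0))" .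
    have x_eq: "x = (\<Sum>g\<in>UNIV. gen g * (\<Sum>h\<in>UNIV. const (f g h) * rel p q r (\<kappa> g h) * v h))"
      unfolding v(1) \<omega>_def N_square
      by (simp add: sum_distrib_left sum_distrib_right mult.assoc) (rule sum.swap)
    have "const (f g h) * rel p q r (\<kappa> g h) * v h \<in> I_homog (Suc (Suc 0))" for g h
      using v(2)[of h] rel_homog
      by (auto intro!: free_homog_mult'[of _ 2 _ 0] const_mult_free_homog)
    then have "(\<Sum>h\<in>UNIV. const (f g h) * rel p q r (\<kappa> g h) * v h) \<in> I_homog (Suc (Suc 0))" for g
      by (auto intro!: I_sum free_homog_sum)
    then have "x \<in> lcomb gen UNIV (I_homog (Suc (Suc 0)))"
      unfolding x_eq by (intro lcombI)
    then show "x \<in> ?X"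
      using xR by blast
  qed
  moreover have "free_space.subspace ?X"
    by (intro free_space.subspace_inter subspace_lcomb subspace_free_homog subspace_I_homog)
  moreover have "free_space.fin_gen ?X"
    using dim_lcomb[OF finite subspace_I_homog fin_gen_I_homog gen_comb_eq_0]
    by (meson free_space.fin_gen_subset Int_lower2)
  ultimately have "free_space.dim (lcomb \<omega> UNIV (free_homog 0)) \<le> free_space.dim ?X"
    by (intro free_space.dim_mono_fin_gen subspace_lcomb subspace_free_homog)
  moreover have "free_space.dim (lcomb \<omega> UNIV (free_homog 0)) = 3"
    using dim_lcomb[OF finite subspace_free_homog, of 0 \<omega>] indep
      dim_free_homog[of 0, where ?'g = xyz and ?'k = 'k] by simp
  ultimately show False
    using hdim_step[OF nonzero, of "Suc 0"] dim_I dim_I_homog_2[OF nonzero] by simp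
qed

end

section \<open>The free algebra and the matrices of the periodic cases\<close>

lemma koszul_free:
  shows "koszul (sklyanin 0 0 (0 :: 'k::field))" and "\<not> PHS (sklyanin 0 0 (0 :: 'k))"
proof -
  interpret sklyanin_relations 0 0 "0 :: 'k" .
  have "tau 0 0 (0 :: 'k) = (\<lambda>_ _ _. 0)"
    by (simp add: tau_def fun_eq_iff)
  then have rel0: "rel 0 0 (0 :: 'k) k = 0" for k
    by (simp add: rel_def quad_zero)
  show "koszul (sklyanin 0 0 (0 :: 'k))"
    unfolding sklyanin_eq
  \<comment> \<open>Without relations the augmentation ideal is free on the generators, and the
    resolution stops after one module of rank 3.\<close>
  proof (rule koszul_if_exact[where n = "\<lambda>m. if m = 1 then 3 else 0" and D\<^sub>1 = "\<lambda>j. gen (idx j)"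
        and D = "\<lambda>_ _ _. 0"])
    fix v :: "nat \<Rightarrow> (xyz, 'k) free"
    show "(\<Sum>j<if (1::nat) = 1 then 3 else 0. gen (idx j) * v j) \<in> I \<longleftrightarrow>
      (\<exists>w. \<forall>i<if (1::nat) = 1 then 3 else 0. v i - (\<Sum>j<if (2::nat) = 1 then 3 else 0. 0 * w j) \<in> I)"
      using gen_comb_in_I_iff[of "\<lambda>g. v (pos g)"] by (simp add: sum_pos all_pos rel0)
  qed (use augmentation_exact in auto)
  \<comment> \<open>Degree 2 already decides: the dimension is 9 instead of 6.\<close>
  have "lcomb (rel 0 0 (0 :: 'k)) UNIV (free_homog 0) = {0}"
    by (auto simp: lcomb_def rel0 intro: exI[of _ "\<lambda>_. 0"])
  then have "I_homog (Suc (Suc 0)) = {0}"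
    unfolding I_homog_Suc_Suc I_homog_low lcomb_zero by simp
  then have "hdim (Suc (Suc 0)) = 9"
    by (simp add: hdim_def dim_singleton_0)
  then show "\<not> PHS (sklyanin 0 0 (0 :: 'k))"
    unfolding sklyanin_eq PHS_iff by (auto simp: choose_two intro!: exI[of _ "Suc (Suc 0)"])
qed

text \<open>The matrix is normalized so that its row \<open>Gx\<close> is (x, y, z): the word formed
  by x and the letter \<open>h\<close> occurs in the relation of index \<open>\<sigma> h\<close>,
  with coefficient r, p or q, and \<open>c h\<close> is the inverse of that coefficient.\<close>

lemma periodic_resolution_cubes:
  fixes p q r :: "'k::field"
  assumes nz: "p \<noteq> 0" "q \<noteq> 0" "r \<noteq> 0" and cubes: "p ^ 3 = q ^ 3" "q ^ 3 = r ^ 3"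
  defines "c \<equiv> case_xyz (1 / r) (1 / p) (1 / q)" and "\<sigma> \<equiv> case_xyz Gx Gz Gy"
  defines "f \<equiv> case_xyz c (case_xyz (1 / r) (p / (q * r)) (p / r ^ 2)) (case_xyz (1 / r) (q / r ^ 2) (q / (p * r)))"
    and "\<kappa> \<equiv> case_xyz \<sigma> (case_xyz Gy Gx Gz) (case_xyz Gz Gy Gx)"
  shows "periodic_resolution p q r (\<lambda>g h j. c h * tau p q r (\<sigma> h) g j) c \<sigma> (case_xyz 1 0 0) f \<kappa>"
proof
  have cu: "p * (p * p) = r * (r * r)" "q * (q * q) = r * (r * r)"
    using cubes by (simp_all add: power3_eq_cube mult.assoc)
  show "bij \<sigma>"
    by (rule involuntory_imp_bij) (simp add: \<sigma>_def split: xyz.split)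
  show "c h \<noteq> 0" for h
    using nz by (cases h) (simp_all add: c_def)
  show "(\<Sum>g\<in>UNIV. case_xyz 1 0 0 g * (c h * tau p q r (\<sigma> h) g j)) = (if j = h then 1 else 0)" for h j
    using nz by (cases h; cases j) (simp_all add: sum_xyz c_def \<sigma>_def tau_def)
  \<comment> \<open>Row \<open>Gx\<close> of the square is (x, y, z) times the matrix and yields
    rescaled relations for any nonzero parameters. The other two rows need the cubes, for instance
    as r^2 / (p q) = p^2 / (q r).\<close>
  show "(\<Sum>k\<in>UNIV. c k * tau p q r (\<sigma> k) g i * (c h * tau p q r (\<sigma> h) k j)) = f g h * tau p q r (\<kappa> g h) i j"
    for g h i j
    using nz cu
    by (cases g; cases h; cases i; cases j)
      (simp_all add: sum_xyz c_def \<sigma>_def f_def \<kappa>_def tau_def field_simps power2_eq_square)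
qed (use nz in auto)

lemma bij_nxt: "bij nxt"
  by (rule bij_betw_byWitness[of _ "nxt \<circ> nxt"]) (auto simp: all_xyz)

text \<open>With one surviving parameter the relations are monomials. \<open>\<sigma> h\<close>
  picks the one ending in the letter \<open>h\<close>, so column \<open>h\<close> has the single
  entry \<open>gen h\<close>, in the row of the first letter, and the sum of all rows is (x, y,
  z).\<close>

lemma periodic_resolution_monomial:
  fixes c :: "'k::field"
  assumes c: "c \<noteq> 0" and \<sigma>: "(p = 0 \<and> q = 0 \<and> r = c \<and> \<sigma> = id) \<or> (p = c \<and> q = 0 \<and> r = 0 \<and> \<sigma> = nxt) \<or>
    (p = 0 \<and> q = c \<and> r = 0 \<and> \<sigma> = nxt \<circ> nxt)"
  shows "periodic_resolution p q r (\<lambda>g h j. 1 / c * tau p q r (\<sigma> h) g j) (\<lambda>_. 1 / c) \<sigma> (\<lambda>_. 1)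
    (\<lambda>g h. if h = \<sigma> (\<sigma> g) then 1 / c else 0) (\<lambda>g h. \<sigma> h)"
proof
  show "bij \<sigma>"
    using \<sigma> bij_nxt by (auto intro: bij_comp)
  show "1 / c \<noteq> 0"
    using c by simp
  show "(\<Sum>g\<in>UNIV. 1 * (1 / c * tau p q r (\<sigma> h) g j)) = (if j = h then 1 else 0)" for h j
    using \<sigma> c by (elim disjE conjE; cases h; cases j; simp add: sum_xyz tau_def)
  show "(\<Sum>k\<in>UNIV. 1 / c * tau p q r (\<sigma> k) g i * (1 / c * tau p q r (\<sigma> h) k j)) =
    (if h = \<sigma> (\<sigma> g) then 1 / c else 0) * tau p q r (\<sigma> h) i j"
    for g h i j
    using \<sigma> c
    by (elim disjE conjE; cases g; cases h; cases i; cases j; simp add: sum_xyz tau_def)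
qed (use c \<sigma> in auto)

section \<open>Linear algebra in dimension three\<close>

definition dot :: "(xyz \<Rightarrow> 'k::field) \<Rightarrow> (xyz \<Rightarrow> 'k) \<Rightarrow> 'k" where
  "dot a b = (\<Sum>i\<in>UNIV. a i * b i)"

definition indep2 :: "(xyz \<Rightarrow> 'k::field) \<Rightarrow> (xyz \<Rightarrow> 'k) \<Rightarrow> bool" where
  "indep2 u v \<longleftrightarrow> (\<exists>j j'. u j * v j' \<noteq> u j' * v j)"

definition rank_ge_2 :: "(xyz \<Rightarrow> xyz \<Rightarrow> 'k::field) \<Rightarrow> bool" where
  "rank_ge_2 m \<longleftrightarrow> (\<exists>i i' j j'. m i j * m i' j' \<noteq> m i j' * m i' j)"

lemma dot_simps:
  "dot (\<lambda>i. a i + b i) c = dot a c + dot b c" "dot (\<lambda>i. a i - b i) c = dot a c - dot b c"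
  "dot (\<lambda>i. s * a i) c = s * dot a c" "dot c (\<lambda>i. a i + b i) = dot c a + dot c b"
  "dot c (\<lambda>i. s * a i) = s * dot c a"
  by (simp_all add: dot_def algebra_simps sum.distrib sum_distrib_left sum_subtractf)

lemma third_xyz:
  assumes "j \<noteq> j'"
  obtains k where "k \<noteq> j" "k \<noteq> j'" "UNIV = {j, j', k}"
    "\<And>f :: xyz \<Rightarrow> 'a::comm_monoid_add. (\<Sum>i\<in>UNIV. f i) = f j + f j' + f k"
proof -
  obtain k where k: "k \<noteq> j" "k \<noteq> j'" "UNIV = {j, j', k}"
    using assms by (cases j; cases j') (auto simp: UNIV_xyz)
  have "(\<Sum>i\<in>UNIV. f i) = f j + f j' + f k" for f :: "xyz \<Rightarrow> 'a"
    unfolding k(3) using assms k(1,2) by (simp add: add.assoc)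
  then show thesis
    using that[OF k] by blast
qed

text \<open>The orthogonal complement of \<open>a\<close> is a plane. Cramer's rule on a nonzero
  minor matches two coordinates, and orthogonality settles the third because \<open>a k\<close>
  cannot vanish.\<close>

lemma orthogonal_span:
  fixes u v a l :: "xyz \<Rightarrow> 'k::field"
  assumes ind: "indep2 u v" and a: "a g \<noteq> 0" and uv: "dot u a = 0" "dot v a = 0" and l: "dot l a = 0"
  obtains s t where "\<And>i. l i = s * u i + t * v i"
proof -
  obtain j j' where d: "u j * v j' - u j' * v j \<noteq> 0"
    using ind unfolding indep2_def by auto
  define D where "D = u j * v j' - u j' * v j"
  have D: "D \<noteq> 0"
    using d by (simp add: D_def)
  have "j \<noteq> j'"
    using d by auto
  then obtain k where k: "UNIV = {j, j', k}"
    "\<And>f :: xyz \<Rightarrow> 'k. (\<Sum>i\<in>UNIV. f i) = f j + f j' + f k"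
    using third_xyz by metis
  have eqs: "u j * a j + u j' * a j' + u k * a k = 0" "v j * a j + v j' * a j' + v k * a k = 0"
    using uv by (simp_all add: dot_def k(2))
  have ak: "a k \<noteq> 0"
  proof
    assume 0: "a k = 0"
    have eqs0: "u j * a j + u j' * a j' = 0" "v j * a j + v j' * a j' = 0"
      using eqs 0 by simp_all
    have "D * a j = v j' * (u j * a j + u j' * a j') - u j' * (v j * a j + v j' * a j')"
      "D * a j' = u j * (v j * a j + v j' * a j') - v j * (u j * a j + u j' * a j')"
      by (simp_all add: D_def algebra_simps)
    then have "a j = 0" "a j' = 0"
      unfolding eqs0 using D by simp_all
    then show False
      using a 0 k(1) by (metis UNIV_I empty_iff insert_iff)
  qed
  \<comment> \<open>Cramer's rule for the coordinates \<open>j\<close> and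
    \<open>j'\<close>.\<close>
  define s where "s = (l j * v j' - l j' * v j) / D"
  define t where "t = (u j * l j' - u j' * l j) / D"
  define w where "w i = l i - (s * u i + t * v i)" for i
  have "D * w j = 0" "D * w j' = 0"
    unfolding w_def s_def t_def using D by (simp_all add: field_simps) (simp_all add: D_def algebra_simps)
  then have w: "w j = 0" "w j' = 0"
    using D by auto
  have "dot w a = 0"
    unfolding w_def[abs_def] using uv l by (simp add: dot_simps)
  then have "w k = 0"
    using w ak by (simp add: dot_def k(2))
  then have "w i = 0" for i
    using w k(1) by (metis UNIV_I empty_iff insert_iff)
  then show thesis
    using that[of s t] by (simp add: w_def)
qed

lemma indep2_not_multiple: "indep2 u v \<Longrightarrow> \<exists>i. s * u i + t * v i \<noteq> 0 \<or> (s = 0 \<and> t = 0)"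
proof (rule ccontr)
  assume "indep2 u v" and "\<nexists>i. s * u i + t * v i \<noteq> 0 \<or> (s = 0 \<and> t = 0)"
  then have *: "\<And>i. s * u i + t * v i = 0" "s \<noteq> 0 \<or> t \<noteq> 0"
    by auto
  obtain j j' where d: "u j * v j' - u j' * v j \<noteq> 0"
    using \<open>indep2 u v\<close> unfolding indep2_def by auto
  have "s * (u j * v j' - u j' * v j) = (s * u j + t * v j) * v j' - (s * u j' + t * v j') * v j"
    "t * (u j * v j' - u j' * v j) = (s * u j' + t * v j') * u j - (s * u j + t * v j) * u j'"
    by (simp_all add: algebra_simps)
  then show False
    using * d by auto
qed

text \<open>A matrix of rank at least 2 with a left kernel vector has rank 2. A right kernel vector is
  the cross product of two independent rows.\<close>

lemma singular_matrix:
  fixes m :: "xyz \<Rightarrow> xyz \<Rightarrow> 'k::field"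
  assumes rank: "rank_ge_2 m" and a: "a g \<noteq> 0" and ker: "\<And>j. dot (\<lambda>i. m i j) a = 0"
  obtains b h where "b h \<noteq> 0" "\<And>i. dot (m i) b = 0"
    "\<And>l. dot l b = 0 \<Longrightarrow> \<exists>\<beta>. \<forall>j. l j = dot (\<lambda>i. m i j) \<beta>"
proof -
  obtain i i' j j' where minor: "m i j * m i' j' \<noteq> m i j' * m i' j"
    using rank unfolding rank_ge_2_def by blast
  then have rows: "indep2 (m i) (m i')"
    unfolding indep2_def by blast
  have "i \<noteq> i'" "j \<noteq> j'"
    using minor by auto
  obtain k where k: "k \<noteq> i" "k \<noteq> i'" "UNIV = {i, i', k}"
    "\<And>f :: xyz \<Rightarrow> 'k. (\<Sum>i\<in>UNIV. f i) = f i + f i' + f k"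
    using third_xyz[OF \<open>i \<noteq> i'\<close>] by metis
  define b where "b g = m i (nxt g) * m i' (nxt (nxt g)) - m i (nxt (nxt g)) * m i' (nxt g)" for g
  have orth: "dot (m i) b = 0" "dot (m i') b = 0"
    by (simp_all add: dot_def sum_xyz b_def algebra_simps)
  have "\<exists>h. b h \<noteq> 0"
  proof (rule ccontr)
    assume "\<nexists>h. b h \<noteq> 0"
    then have "b Gx = 0" "b Gy = 0" "b Gz = 0"
      by auto
    then show False
      using minor by (cases j; cases j') (simp_all add: b_def)
  qed
  then obtain h where h: "b h \<noteq> 0" ..
  have row_rel: "m i j * a i + m i' j * a i' + m k j * a k = 0" for j
    using ker[of j] by (simp add: dot_def k(4))
  have ak: "a k \<noteq> 0"
  proof
    assume 0: "a k = 0"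
    have "a i * m i j + a i' * m i' j = 0" for j
      using row_rel[of j] 0 by (simp add: mult.commute)
    then have "a i = 0" "a i' = 0"
      using indep2_not_multiple[OF rows, of "a i" "a i'"] by auto
    then show False
      using a 0 k(3) by (metis UNIV_I empty_iff insert_iff)
  qed
  have "a k * dot (m k) b = - (a i * dot (m i) b + a i' * dot (m i') b)"
  proof -
    have "a i * dot (m i) b + a i' * dot (m i') b + a k * dot (m k) b =
        (\<Sum>j\<in>UNIV. (m i j * a i + m i' j * a i' + m k j * a k) * b j)"
      by (simp add: dot_def sum_xyz algebra_simps)
    then show ?thesis
      unfolding row_rel by (simp add: add_eq_0_iff)
  qed
  then have "dot (m k) b = 0"
    using orth ak by simp
  then have kerb: "dot (m i) b = 0" for i
    using orth k(3) by (metis UNIV_I empty_iff insert_iff)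
  have "\<exists>\<beta>. \<forall>j. l j = dot (\<lambda>i. m i j) \<beta>" if l: "dot l b = 0" for l
  proof -
    obtain s t where st: "\<And>j. l j = s * m i j + t * m i' j"
      using orthogonal_span[OF rows h orth l] by metis
    let ?\<beta> = "(\<lambda>_. 0)(i := s, i' := t)"
    have "l j = dot (\<lambda>i. m i j) ?\<beta>" for j
      using \<open>i \<noteq> i'\<close> k(1,2) by (simp add: dot_def k(4) st mult.commute)
    then show ?thesis
      by blast
  qed
  then show thesis
    using that h kerb by metis
qed

text \<open>If all columns were proportional to \<open>u\<close>, every 2 x 2 minor would vanish;
  the factor \<open>u g\<close>, taken twice, replaces division.\<close>

lemma singular_matrix_column:
  fixes m :: "xyz \<Rightarrow> xyz \<Rightarrow> 'k::field"
  assumes rank: "rank_ge_2 m" and u: "u g \<noteq> 0"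
  obtains j where "indep2 u (\<lambda>i. m i j)"
proof (rule ccontr)
  assume "\<not> thesis"
  then have *: "u h * m h' j = u h' * m h j" for h h' j
    using that unfolding indep2_def by blast
  obtain i i' j j' where minor: "m i j * m i' j' \<noteq> m i j' * m i' j"
    using rank unfolding rank_ge_2_def by blast
  have "u g * (u g * (m i j * m i' j')) = (u g * m i j) * (u g * m i' j')"
    by (simp add: algebra_simps)
  also have "\<dots> = (u i * m g j) * (u i' * m g j')"
    by (simp only: *)
  also have "\<dots> = (u i * m g j') * (u i' * m g j)"
    by (simp add: algebra_simps)
  also have "\<dots> = (u g * m i j') * (u g * m i' j)"
    by (simp only: *)
  finally have "u g * (u g * (m i j * m i' j')) = u g * (u g * (m i j' * m i' j))"
    by (simp add: algebra_simps)
  then show False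
    using u minor by simp
qed

section \<open>Contractions of the trilinear form\<close>

definition contract :: "'k::field \<Rightarrow> 'k \<Rightarrow> 'k \<Rightarrow> (xyz \<Rightarrow> 'k) \<Rightarrow> xyz \<Rightarrow> xyz \<Rightarrow> 'k" where
  "contract p q r a i j = (\<Sum>k\<in>UNIV. a k * tau p q r k i j)"

text \<open>With A the square of \<open>a g\<close> and B the product of the other two coordinates,
  three minors give r^2 B = p q A, q^2 B = p r A and p^2 B = q r A. Hence all cubes times B equal p
  q r A. Distinct cubes force B = 0, and then A nonzero leaves at most one nonzero
  parameter.\<close>

lemma rank_contract:
  assumes two: "p \<noteq> 0 \<and> q \<noteq> 0 \<or> p \<noteq> 0 \<and> r \<noteq> 0 \<or> q \<noteq> 0 \<and> r \<noteq> 0"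
    and cubes: "\<not> (p ^ 3 = q ^ 3 \<and> q ^ 3 = r ^ 3)" and a: "a g \<noteq> (0 :: 'k::field)"
  shows "rank_ge_2 (contract p q r a)"
proof (rule ccontr)
  let ?m = "contract p q r a"
  assume "\<not> rank_ge_2 ?m"
  then have minors: "?m i j * ?m i' j' = ?m i j' * ?m i' j" for i i' j j'
    unfolding rank_ge_2_def by blast
  let ?h = "nxt g" and ?k = "nxt (nxt g)"
  have entries: "?m g g = r * a g" "?m ?h ?h = r * a ?h" "?m ?k ?k = r * a ?k"
    "?m ?h ?k = p * a g" "?m ?k ?h = q * a g" "?m g ?h = p * a ?k" "?m ?h g = q * a ?k"
    "?m ?k g = p * a ?h" "?m g ?k = q * a ?h"
    by (cases g; simp add: contract_def sum_xyz tau_def mult.commute)+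
  define A where "A = a g * a g"
  define B where "B = a ?h * a ?k"
  have A: "A \<noteq> 0"
    using a by (simp add: A_def)
  have eqs: "r * r * B = p * q * A" "q * q * B = p * r * A" "p * p * B = q * r * A"
    using minors[of ?h ?h ?k ?k] minors[of g g ?h ?k] minors[of g g ?k ?h]
    unfolding entries A_def B_def by (simp_all add: algebra_simps)
  have "r ^ 3 * B = p * q * r * A" "q ^ 3 * B = p * q * r * A" "p ^ 3 * B = p * q * r * A"
    using arg_cong[OF eqs(1), of "(*) r"] arg_cong[OF eqs(2), of "(*) q"] arg_cong[OF eqs(3), of "(*) p"]
    by (simp_all add: power3_eq_cube algebra_simps)
  then have "(p ^ 3 - q ^ 3) * B = 0" "(q ^ 3 - r ^ 3) * B = 0"
    by (simp_all add: left_diff_distrib)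
  then have "B = 0"
    using cubes by auto
  then show False
    using eqs A two by auto
qed

section \<open>Point modules and line modules\<close>

text \<open>Cyclic invariance of the form moves the contracted slot, turning a left kernel vector of
  one contraction into a right kernel vector of another. Every passage from point to point rests on
  it.\<close>

lemma contract_cyclic: "dot (\<lambda>i. contract p q r a i j) b = dot (contract p q r b j) a"
  by (cases j) (simp_all add: dot_def contract_def sum_xyz tau_def algebra_simps)

lemma rank_ge_2_transpose: "rank_ge_2 m \<Longrightarrow> rank_ge_2 (\<lambda>i j. m j i)"
  unfolding rank_ge_2_def by (metis mult.commute)

lemma dual_vector:
  assumes "a g \<noteq> (0 :: 'k::field)"
  obtains t where "dot t a = 1"
proof
  show "dot (\<lambda>i. if i = g then 1 / a g else 0) a = 1"
    using assms by (cases g) (simp_all add: dot_def sum_xyz)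
qed

section \<open>Evaluating the first letter at a point\<close>

definition lcontract :: "(xyz \<Rightarrow> 'k) \<Rightarrow> (xyz, 'k::field) free \<Rightarrow> (xyz, 'k) free" where
  "lcontract a f = (\<Sum>g\<in>UNIV. const (a g) * dl g f)"

lemma lcontract_simps [simp]:
  "lcontract a (f + h) = lcontract a f + lcontract a h"
  "lcontract a (f - h) = lcontract a f - lcontract a h"
  "lcontract a (const c * f) = const c * lcontract a f"
  "lcontract a (lin b * f) = const (dot b a) * f"
  by (simp_all add: lcontract_def sum_xyz dot_def distrib_left distrib_right right_diff_distrib const_add
      mult.assoc[symmetric] const_mult[symmetric] mult.commute[of "a _"])

lemma lcontract_sum: "lcontract a (\<Sum>g\<in>N. f g) = (\<Sum>g\<in>N. lcontract a (f g))"
  by (induction N rule: infinite_finite_induct) (simp_all add: lcontract_def[of _ 0])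

lemma dl_quad_mult: "dl g (quad m * f) = lin (m g) * f"
  using lookup_Nil_free_homog[of "quad m" 1] quad_in_free_homog[of m] by (simp add: dl_mult numeral_2_eq_2)

lemma lcontract_quad: "lcontract a (quad m * f) = lin (\<lambda>j. dot (\<lambda>i. m i j) a) * f"
  by (simp add: lcontract_def dl_quad_mult dot_def lin_sum lin_scale sum_distrib_right mult.assoc mult.commute[of "m _ _"])

lemma lcontract_in_free_homog: "f \<in> free_homog (Suc n) \<Longrightarrow> lcontract a f \<in> free_homog n"
  unfolding lcontract_def by (intro free_homog_sum const_mult_free_homog dl_in_free_homog)

text \<open>Each first letter \<open>gen g\<close> is replaced by its difference with the multiple
  \<open>a g\<close> of \<open>lin t\<close>. When \<open>t\<close> is 1 at \<open>a\<close>, these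
  forms vanish at \<open>a\<close> by \<open>dot_projection\<close>, so the kernel consists of
  elements whose first factors vanish at \<open>a\<close>.\<close>

lemma lcontract_kernel:
  assumes "Poly_Mapping.lookup x [] = 0" "lcontract a x = 0"
  shows "x = (\<Sum>g\<in>UNIV. lin (\<lambda>i. (if i = g then 1 else 0) + (- a g) * t i) * dl g x)"
proof -
  have "(\<Sum>g\<in>UNIV. lin (\<lambda>i. (if i = g then 1 else 0) + (- a g) * t i) * dl g x) =
      (\<Sum>g\<in>UNIV. gen g * dl g x) - lin t * lcontract a x"
    unfolding lin_add lin_scale lin_delta lcontract_def
    by (simp add: sum_xyz algebra_simps const_uminus const_left_commute)
  then show ?thesis
    using gen_expansion[of x] assms by simp
qed

lemma dot_projection:
  "dot t a = 1 \<Longrightarrow> dot (\<lambda>i. (if i = g then 1 else 0) + (- a g) * t i) a = 0"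
  unfolding dot_simps by (cases g) (simp_all add: dot_def sum_xyz)

lemma lin_mult_eq_0_iff: "u g \<noteq> 0 \<Longrightarrow> lin u * f = 0 \<longleftrightarrow> f = 0"
proof
  assume u: "u g \<noteq> 0" and "lin u * f = 0"
  then have "const (u g) * f = 0"
    using dl_lin_mult[of g u f] by simp
  then have "const (1 / u g) * (const (u g) * f) = 0"
    by simp
  then show "f = 0"
    using u by (simp add: mult.assoc[symmetric] const_mult[symmetric])
qed simp

text \<open>Degree n - 1, with nothing in degree -1; truncated subtraction would wrongly admit
  constants at \<open>n = 0\<close>.\<close>

definition lower_homog :: "nat \<Rightarrow> ('g, 'k::field) free set" where
  "lower_homog n = (case n of 0 \<Rightarrow> {0} | Suc m \<Rightarrow> free_homog m)"

locale generic_sklyanin = sklyanin_relations p q r for p q r :: "'k::field" +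
  assumes two_nonzero: "p \<noteq> 0 \<and> q \<noteq> 0 \<or> p \<noteq> 0 \<and> r \<noteq> 0 \<or> q \<noteq> 0 \<and> r \<noteq> 0"
    and cubes_distinct: "\<not> (p ^ 3 = q ^ 3 \<and> q ^ 3 = r ^ 3)"
begin

abbreviation M :: "(xyz \<Rightarrow> 'k) \<Rightarrow> xyz \<Rightarrow> xyz \<Rightarrow> 'k" where
  "M \<equiv> contract p q r"

lemma nonzero: "p \<noteq> 0 \<or> q \<noteq> 0 \<or> r \<noteq> 0"
  using two_nonzero by blast

lemma rank_M: "a g \<noteq> 0 \<Longrightarrow> rank_ge_2 (M a)"
  using rank_contract two_nonzero cubes_distinct by blast

lemma quad_M_in_I: "quad (M a) \<in> I"
proof -
  have "quad (M a) = (\<Sum>k\<in>UNIV. const (a k) * rel p q r k)"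
    unfolding contract_def[abs_def] quad_sum quad_scale rel_def ..
  then show ?thesis
    by (auto intro!: I_sum)
qed

text \<open>The points of the cubic curve that parametrises point modules.\<close>

definition on_curve :: "(xyz \<Rightarrow> 'k) \<Rightarrow> bool" where
  "on_curve a \<longleftrightarrow> (\<exists>g. a g \<noteq> 0) \<and> (\<exists>\<alpha>. (\<exists>g. \<alpha> g \<noteq> 0) \<and> (\<forall>j. dot (\<lambda>i. M \<alpha> i j) a = 0))"

lemma on_curve_rational: "on_curve (case_xyz 1 (- 1) 0)"
proof -
  have "case_xyz 1 (- 1) 0 Gx \<noteq> (0 :: 'k)"
    by simp
  \<comment> \<open>The three equations for a left kernel vector (1, -1, 0) compare the contracting
    vector with (q, p, r) coordinate by coordinate.\<close>
  moreover have "\<exists>g. case_xyz q p r g \<noteq> 0"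
    using nonzero by (metis xyz.case)
  moreover have "\<forall>j. dot (\<lambda>i. M (case_xyz q p r) i j) (case_xyz 1 (- 1) 0) = 0"
    by (simp add: all_xyz dot_def contract_def sum_xyz tau_def)
  ultimately show ?thesis
    unfolding on_curve_def by blast
qed

text \<open>The point \<open>b\<close> is a left kernel vector of the contraction
  \<open>M a\<close>, and \<open>a\<close> itself witnesses that it is on the curve. By rank 2,
  every form vanishing at \<open>b\<close> is obtained by evaluating the first letter of some
  relation at \<open>a\<close>: one step into the point module of \<open>a\<close> leads to that of
  \<open>b\<close>.\<close>

lemma next_point:
  assumes "on_curve a"
  obtains b where "on_curve b" "\<And>l. dot l b = 0 \<Longrightarrow> \<exists>\<beta>. \<forall>j. l j = dot (\<lambda>i. M \<beta> i j) a"
proof -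
  obtain g \<alpha> h where a: "a g \<noteq> 0" and \<alpha>: "\<alpha> h \<noteq> 0" "\<And>j. dot (\<lambda>i. M \<alpha> i j) a = 0"
    using assms unfolding on_curve_def by blast
  have "dot (\<lambda>k. M a j k) \<alpha> = 0" for j
    using \<alpha>(2)[of j] unfolding contract_cyclic .
  then obtain b h' where b: "b h' \<noteq> 0" "\<And>j. dot (\<lambda>i. M a i j) b = 0"
    "\<And>l. dot l b = 0 \<Longrightarrow> \<exists>\<beta>. \<forall>j. l j = dot (\<lambda>k. M a j k) \<beta>"
    using singular_matrix[OF rank_ge_2_transpose[OF rank_M[of a g, OF a]], of \<alpha> h] \<alpha>(1) by metis
  show thesis
  proof
    show "on_curve b"
      unfolding on_curve_def using a b(1,2) by blast
    show "\<exists>\<beta>. \<forall>j. l j = dot (\<lambda>i. M \<beta> i j) a" if "dot l b = 0" for l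
      using b(3)[OF that] unfolding contract_cyclic .
  qed
qed

text \<open>If \<open>a\<close> is a left kernel vector of \<open>M \<alpha>\<close>, all columns of
  that matrix vanish at \<open>a\<close>. Expanding them in \<open>u\<close> and one independent
  column \<open>v\<close> writes the relation as u s + v t. So modulo u A the element
  \<open>v\<close> is killed by \<open>t\<close>, which is again a form vanishing at a point of the
  curve.\<close>

lemma line_step:
  assumes "on_curve a" and u: "u g \<noteq> 0" "dot u a = 0"
  obtains v \<alpha> s t b h where "\<And>i j. M \<alpha> i j = u i * s j + v i * t j" "t h \<noteq> 0" "dot t b = 0" "on_curve b"
    "\<And>l. dot l a = 0 \<Longrightarrow> \<exists>x y. \<forall>i. l i = x * u i + y * v i"
proof -
  obtain g' \<alpha> h' where a: "a g' \<noteq> 0" and \<alpha>: "\<alpha> h' \<noteq> 0" "\<And>j. dot (\<lambda>i. M \<alpha> i j) a = 0"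
    using assms(1) unfolding on_curve_def by blast
  obtain b h where b: "b h \<noteq> 0" "\<And>i. dot (M \<alpha> i) b = 0"
    using singular_matrix[OF rank_M[of \<alpha> h', OF \<alpha>(1)], of a g'] a \<alpha>(2) by metis
  obtain j\<^sub>0 where ind: "indep2 u (\<lambda>i. M \<alpha> i j\<^sub>0)"
    using singular_matrix_column[OF rank_M[of \<alpha> h', OF \<alpha>(1)], of u g] u(1) by metis
  define v where "v = (\<lambda>i. M \<alpha> i j\<^sub>0)"
  have ind_uv: "indep2 u v" and va: "dot v a = 0"
    using ind \<alpha>(2) by (simp_all add: v_def)
  have span: "\<exists>x y. \<forall>i. l i = x * u i + y * v i" if "dot l a = 0" for l
    using orthogonal_span[OF ind_uv, of a g' l] a u(2) va that by metis
  obtain s t where st: "\<And>i j. M \<alpha> i j = s j * u i + t j * v i"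
    using span[OF \<alpha>(2)] by metis
  \<comment> \<open>Column \<open>j\<^sub>0\<close> is \<open>v\<close> itself, so it cannot be a
    multiple of \<open>u\<close> alone.\<close>
  have t: "t j\<^sub>0 \<noteq> 0"
  proof
    assume "t j\<^sub>0 = 0"
    then have "s j\<^sub>0 * u i + (- 1) * v i = 0" for i
      using st[of i j\<^sub>0] by (simp add: v_def)
    then show False
      using indep2_not_multiple[OF ind_uv, of "s j\<^sub>0" "- 1"] by auto
  qed
  have "dot s b * u i + dot t b * v i = 0" for i
  proof -
    have "dot (M \<alpha> i) b = dot s b * u i + dot t b * v i"
      unfolding dot_def sum_xyz st by (simp add: algebra_simps)
    then show ?thesis
      using b(2) by simp
  qed
  then have tb: "dot t b = 0"
    using indep2_not_multiple[OF ind_uv, of "dot s b" "dot t b"] by auto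
  \<comment> \<open>By cyclicity \<open>\<alpha>\<close> is a left kernel vector of
    \<open>M b\<close>. This matrix is therefore singular, and its right kernel vector
    \<open>c\<close> witnesses that \<open>b\<close> is on the curve.\<close>
  have "dot (\<lambda>i. M b i j) \<alpha> = 0" for j
    unfolding contract_cyclic by (rule b(2))
  then obtain c h'' where c: "c h'' \<noteq> 0" "\<And>i. dot (M b i) c = 0"
    using singular_matrix[OF rank_M[of b h, OF b(1)], of \<alpha> h'] \<alpha>(1) by metis
  have "on_curve b"
    unfolding on_curve_def contract_cyclic using b(1) c by blast
  then show thesis
    using that[of \<alpha> s v t j\<^sub>0 b] st t tb span by (simp add: mult.commute)
qed

text \<open>Modulo \<open>I\<close> the point module of \<open>a\<close> has dimension at most 1 in each degree; here it is shifted by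
  one and identified with the quotient of \<open>F\<close> by \<open>lcontract a ` I\<close>.\<close>

lemma point_module:
  assumes "on_curve a"
  shows "\<exists>g\<in>free_homog n. \<forall>f\<in>free_homog n. \<exists>c. \<exists>i\<in>I_homog (Suc n). f = const c * g + lcontract a i"
  using assms
proof (induction n arbitrary: a)
  case 0
  show ?case
  proof (intro bexI ballI)
    fix f :: "(xyz, 'k) free"
    assume "f \<in> free_homog 0"
    then show "\<exists>c. \<exists>i\<in>I_homog (Suc 0). f = const c * const 1 + lcontract a i"
      unfolding I_homog_low free_homog_0_eq by (auto simp: lcontract_def)
  qed (rule const_in_free_homog)
next
  case (Suc n)
  obtain b where b: "on_curve b" "\<And>l. dot l b = 0 \<Longrightarrow> \<exists>\<beta>. \<forall>j. l j = dot (\<lambda>i. M \<beta> i j) a"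
    using next_point[OF Suc.prems] by metis
  obtain g where g: "g \<in> free_homog n"
    "\<forall>f\<in>free_homog n. \<exists>c. \<exists>i\<in>I_homog (Suc n). f = const c * g + lcontract b i"
    using Suc.IH[OF b(1)] by blast
  obtain t where t: "dot t b = 1"
    using dual_vector b(1) unfolding on_curve_def by metis
  obtain s where s: "dot s a = 1"
    using dual_vector Suc.prems unfolding on_curve_def by metis
  \<comment> \<open>Since \<open>t\<close> is 1 at \<open>b\<close>, this element contracts at
    \<open>b\<close> to the representative \<open>g\<close> one degree lower.\<close>
  have tg: "lin t * g \<in> free_homog (Suc n)"
    using free_homog_mult'[OF lin_in_free_homog g(1)] by simp
  show ?case
  proof (rule bexI[OF _ tg], rule ballI)
    fix f :: "(xyz, 'k) free"
    assume f: "f \<in> free_homog (Suc n)"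
    obtain c i where i: "i \<in> I_homog (Suc n)" "lcontract b f = const c * g + lcontract b i"
      using g(2) lcontract_in_free_homog[OF f] by blast
    \<comment> \<open>What remains is killed by contraction at \<open>b\<close>. So it is built from
      forms vanishing at \<open>b\<close>, and those are contractions at \<open>a\<close> of
      relations.\<close>
    define x where "x = f - const c * (lin t * g) - i"
    have x: "x \<in> free_homog (Suc n)" "lcontract b x = 0"
      using f tg i t by (auto simp: x_def)
    obtain \<beta> where \<beta>: "\<And>g j. (if j = g then 1 else 0) + (- b g) * t j = dot (\<lambda>i. M (\<beta> g) i j) a"
      using b(2)[OF dot_projection[OF t]] by metis
    let ?y = "\<Sum>g\<in>UNIV. quad (M (\<beta> g)) * dl g x"
    have "x = lcontract a ?y"
      unfolding lcontract_sum lcontract_quad \<beta>[symmetric]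
      by (rule lcontract_kernel[OF lookup_Nil_free_homog[OF x(1)] x(2)])
    \<comment> \<open>As \<open>s\<close> is 1 at \<open>a\<close>, contracting
      \<open>lin s * i\<close> at \<open>a\<close> returns \<open>i\<close>.\<close>
    then have "f = const c * (lin t * g) + lcontract a (?y + lin s * i)"
      using s by (simp add: x_def algebra_simps)
    moreover have "?y + lin s * i \<in> I_homog (Suc (Suc n))"
      using i x(1) quad_M_in_I
      by (auto intro!: I_add I_sum free_homog_add free_homog_sum
          free_homog_mult'[OF quad_in_free_homog dl_in_free_homog] free_homog_mult'[OF lin_in_free_homog])
    ultimately show "\<exists>c. \<exists>i\<in>I_homog (Suc (Suc n)). f = const c * (lin t * g) + lcontract a i"
      by blast
  qed
qed

text \<open>Modulo u A, the part of A not captured by v A is the point module of \<open>a\<close>,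
  which has at most one dimension per degree. The part v A is a quotient of the line module of
  \<open>t\<close> shifted by one, because v t = - u s modulo the relations. Each degree thus adds 1
  to the bound.\<close>

lemma line_module:
  assumes "on_curve a" "u g \<noteq> 0" "dot u a = 0"
  shows "\<exists>B. finite B \<and> card B \<le> n + 1 \<and> (\<forall>f\<in>free_homog n. \<exists>y\<in>free_space.span B.
    \<exists>h\<in>lower_homog n. \<exists>i\<in>I_homog n. f = y + lin u * h + i)"
  using assms
proof (induction n arbitrary: a u g)
  case 0
  have "\<exists>y\<in>free_space.span {1 :: (xyz, 'k) free}. \<exists>h\<in>lower_homog 0. \<exists>i\<in>I_homog 0. f = y + lin u * h + i"
    if f: "f \<in> free_homog 0" for f
  proof -
    obtain c where "f = const c"
      using f by (auto simp: free_homog_0_eq)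
    then have "f = smul c 1 + lin u * 0 + 0"
      by (simp add: smul_def)
    then show ?thesis
      unfolding I_homog_low free_space.span_singleton lower_homog_def by fastforce
  qed
  then show ?case
    by (intro exI[of _ "{1}"]) auto
next
  case (Suc n)
  obtain v \<alpha> s t b h where step: "\<And>i j. M \<alpha> i j = u i * s j + v i * t j" "t h \<noteq> 0" "dot t b = 0" "on_curve b"
    "\<And>l. dot l a = 0 \<Longrightarrow> \<exists>x y. \<forall>i. l i = x * u i + y * v i"
    using line_step[OF Suc.prems] by metis
  obtain B where B: "finite B" "card B \<le> n + 1" "\<And>f. f \<in> free_homog n \<Longrightarrow> \<exists>y\<in>free_space.span B.
    \<exists>h\<in>lower_homog n. \<exists>i\<in>I_homog n. f = y + lin t * h + i"
    using Suc.IH[OF step(4,2,3)] by blast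
  obtain g where g: "g \<in> free_homog n"
    "\<forall>f\<in>free_homog n. \<exists>c. \<exists>i\<in>I_homog (Suc n). f = const c * g + lcontract a i"
    using point_module[OF Suc.prems(1)] by blast
  obtain w where w: "dot w a = 1"
    using dual_vector Suc.prems(1) unfolding on_curve_def by metis
  interpret v: Vector_Spaces.linear smul smul "(*) (lin v)"
    by (rule linear_mult_left)
  \<comment> \<open>One representative of the point module, and \<open>v\<close> times the spanning
    set for \<open>t\<close>.\<close>
  let ?B = "insert (lin w * g) ((*) (lin v) ` B)"
  have "finite ?B" "card ?B \<le> Suc n + 1"
    using B(1,2) card_image_le[OF B(1), of "(*) (lin v)"] card_insert_le_m1[of "Suc n + 1" "(*) (lin v) ` B"]
    by auto
  moreover have "\<exists>y\<in>free_space.span ?B. \<exists>h\<in>lower_homog (Suc n). \<exists>i\<in>I_homog (Suc n). f = y + lin u * h + i"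
    if f: "f \<in> free_homog (Suc n)" for f
  proof -
    obtain c i where i: "i \<in> I_homog (Suc n)" "lcontract a f = const c * g + lcontract a i"
      using g(2) lcontract_in_free_homog[OF f] by blast
    define x where "x = f - const c * (lin w * g) - i"
    have "lin w * g \<in> free_homog (Suc n)"
      using free_homog_mult'[OF lin_in_free_homog g(1)] by simp
    then have x: "x \<in> free_homog (Suc n)" "lcontract a x = 0"
      using f i w by (auto simp: x_def)
    \<comment> \<open>Forms vanishing at \<open>a\<close> are combinations of \<open>u\<close> and
      \<open>v\<close>, so \<open>x\<close> lies in u F + v F. The coefficient of \<open>v\<close>
      goes to the induction hypothesis.\<close>
    obtain x1 x2 where x12: "\<And>g i. (if i = g then 1 else 0) + (- a g) * w i = x1 g * u i + x2 g * v i"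
      using step(5)[OF dot_projection[OF w]] by metis
    define h1 where "h1 = (\<Sum>g\<in>UNIV. const (x1 g) * dl g x)"
    define h2 where "h2 = (\<Sum>g\<in>UNIV. const (x2 g) * dl g x)"
    have h12: "h1 \<in> free_homog n" "h2 \<in> free_homog n"
      unfolding h1_def h2_def using x(1) by (auto intro!: free_homog_sum)
    have "x = lin u * h1 + lin v * h2"
      by (subst lcontract_kernel[OF lookup_Nil_free_homog[OF x(1)] x(2), of w])
        (simp only: x12, simp only: lin_add lin_scale h1_def h2_def sum_xyz distrib_left distrib_right
          const_left_commute mult.assoc add_ac)
    moreover obtain y h' i' where y: "y \<in> free_space.span B" "h' \<in> lower_homog n" "i' \<in> I_homog n"
      "h2 = y + lin t * h' + i'"
      using B(3)[OF h12(2)] by blast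
    moreover have "lin v * lin t = quad (M \<alpha>) - lin u * lin s"
    proof -
      have "M \<alpha> = (\<lambda>i j. u i * s j + v i * t j)"
        using step(1) by blast
      then have "quad (M \<alpha>) = lin u * lin s + lin v * lin t"
        using lin_mult_lin_sum[of "case_xyz u v (\<lambda>_. 0)" "case_xyz s t (\<lambda>_. 0)" UNIV]
        by (simp add: sum_xyz lin_zero)
      then show ?thesis
        by simp
    qed
    then have "lin v * (lin t * h') = quad (M \<alpha>) * h' - lin u * (lin s * h')"
      by (simp add: mult.assoc[symmetric] left_diff_distrib)
    ultimately have "f = (const c * (lin w * g) + lin v * y) + lin u * (h1 - lin s * h') +
        (i + quad (M \<alpha>) * h' + lin v * i')"
      by (simp add: x_def algebra_simps)
    moreover have "const c * (lin w * g) + lin v * y \<in> free_space.span ?B"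
    proof (rule free_space.span_add)
      show "const c * (lin w * g) \<in> free_space.span ?B"
        using free_space.span_scale[OF free_space.span_base[of "lin w * g" ?B], of c] by (simp add: smul_def)
      have "lin v * y \<in> free_space.span ((*) (lin v) ` B)"
        using y(1) v.span_image by blast
      then show "lin v * y \<in> free_space.span ?B"
        using free_space.span_mono[of "(*) (lin v) ` B" ?B] by blast
    qed
    moreover have "h1 - lin s * h' \<in> lower_homog (Suc n)"
      using h12(1) y(2) free_homog_mult'[OF lin_in_free_homog, of h' _ n s]
      by (auto simp: lower_homog_def split: nat.splits)
    moreover have "i + quad (M \<alpha>) * h' + lin v * i' \<in> I_homog (Suc n)"
    proof -
      have "quad (M \<alpha>) * h' \<in> free_homog (Suc n)"
        using y(2) free_homog_mult'[OF quad_in_free_homog, of h' _ "Suc n" "M \<alpha>"]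
        by (auto simp: lower_homog_def split: nat.splits)
      then show ?thesis
        using i(1) y(3) quad_M_in_I
        by (auto intro!: free_homog_add free_homog_mult'[OF lin_in_free_homog])
    qed
    ultimately show ?thesis
      by blast
  qed
  ultimately show ?case
    by blast
qed

end

section \<open>Exactness of the Koszul complex for generic parameters\<close>

lemma inj_lin_mult: "u g \<noteq> 0 \<Longrightarrow> inj_on ((*) (lin u)) N"
proof (rule inj_onI)
  fix x y assume "u g \<noteq> 0" and "lin u * x = lin u * y"
  then show "x = y"
    using lin_mult_eq_0_iff[of u g "x - y"] by (simp add: right_diff_distrib)
qed

context generic_sklyanin
begin

text \<open>Left multiplication by \<open>gen Gz\<close> is used because the line \<open>z = 0\<close> meets the cubic curve in a
  rational point.\<close>

definition z_kernel :: "nat \<Rightarrow> (xyz, 'k) free set" where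
  "z_kernel n = {f \<in> free_homog n. gen Gz * f \<in> I}"

lemma subspace_z_kernel: "free_space.subspace (z_kernel n)"
  unfolding z_kernel_def free_space.subspace_def smul_def
  by (auto simp: distrib_left const_left_commute)

lemma fin_gen_z_kernel: "free_space.fin_gen (z_kernel n)"
  by (rule free_space.fin_gen_subset[OF _ dim_free_homog[THEN conjunct1]]) (auto simp: z_kernel_def)

lemma I_homog_subset_z_kernel: "I_homog n \<subseteq> z_kernel n"
  by (auto simp: z_kernel_def)

lemma dim_z_kernel_ge: "free_space.dim (I_homog n) \<le> free_space.dim (z_kernel n)"
  by (rule free_space.dim_mono_fin_gen[OF subspace_I_homog subspace_z_kernel I_homog_subset_z_kernel
        fin_gen_z_kernel])

text \<open>Rank and nullity of left multiplication by z from A_n to A_(n+1): the image has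
  dimension 3^n - dim \<open>z_kernel n\<close>, and the cokernel is a line module of dimension at
  most n + 2. The kernel thus measures the slack in the dimension bound.\<close>

lemma hdim_upper: "hdim (Suc n) + free_space.dim (z_kernel n) \<le> n + 2 + 3 ^ n"
proof -
  define u :: "xyz \<Rightarrow> 'k" where "u = (\<lambda>i. if i = Gz then 1 else 0)"
  have u: "u Gz \<noteq> 0" "dot u (case_xyz 1 (- 1) 0) = 0" "lin u = gen Gz"
    by (simp_all add: u_def dot_def sum_xyz lin_delta)
  obtain B where B: "finite B" "card B \<le> n + 2" "\<And>f. f \<in> free_homog (Suc n) \<Longrightarrow> \<exists>y\<in>free_space.span B.
    \<exists>h\<in>free_homog n. \<exists>i\<in>I_homog (Suc n). f = y + gen Gz * h + i"
    using line_module[OF on_curve_rational u(1,2), of "Suc n"] u(3) by (auto simp: lower_homog_def)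
  let ?U = "(*) (gen Gz) ` (free_homog n :: (xyz, 'k) free set)"
  let ?W = "{x + y |x y. x \<in> ?U \<and> y \<in> I_homog (Suc n)}"
  let ?S = "{x + y |x y. x \<in> free_space.span B \<and> y \<in> ?W}"
  note fh = dim_free_homog[where ?'g = xyz and ?'k = 'k]
  have inj: "inj_on ((*) (gen Gz)) N" for N :: "(xyz, 'k) free set"
    using inj_lin_mult[of u Gz, OF u(1)] unfolding u(3) .
  note U = free_space.dim_image_fin_gen[OF linear_mult_left subspace_free_homog inj, of n, OF fh[THEN conjunct1]]
  note K = free_space.dim_image_fin_gen[OF linear_mult_left subspace_z_kernel inj, OF fin_gen_z_kernel]
  have "?U \<inter> I_homog (Suc n) = (*) (gen Gz) ` z_kernel n"
    by (auto simp: z_kernel_def intro!: free_homog_mult'[OF gen_in_free_homog])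
  then have W: "free_space.dim ?W + free_space.dim (z_kernel n) = 3 ^ n + free_space.dim (I_homog (Suc n))"
    using free_space.dim_sums_Int_fin_gen[OF U(3) subspace_I_homog[of "Suc n"] U(2) fin_gen_I_homog] U(1) K(1) fh[of n]
    by simp
  have subW: "free_space.subspace ?W" and finW: "free_space.fin_gen ?W"
    by (intro free_space.subspace_sums U(3) subspace_I_homog)
      (intro free_space.fin_gen_sums U(2) fin_gen_I_homog)
  have finB: "free_space.fin_gen (free_space.span B)"
    unfolding free_space.fin_gen_def using B(1) by blast
  have dimB: "free_space.dim (free_space.span B) \<le> n + 2"
    using free_space.dim_le_card'[OF B(1)] B(2) by simp
  have "free_homog (Suc n) \<subseteq> ?S"
  proof
    fix f :: "(xyz, 'k) free" assume "f \<in> free_homog (Suc n)"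
    then obtain y h i where *: "y \<in> free_space.span B" "h \<in> free_homog n" "i \<in> I_homog (Suc n)"
      "f = y + gen Gz * h + i"
      using B(3) by blast
    then have "gen Gz * h + i \<in> ?W"
      by blast
    moreover have "f = y + (gen Gz * h + i)"
      using * by (simp add: add.assoc)
    ultimately show "f \<in> ?S"
      using *(1) by blast
  qed
  then have "3 ^ Suc n \<le> free_space.dim ?S"
    using free_space.dim_mono_fin_gen[OF subspace_free_homog[of "Suc n"]
        free_space.subspace_sums[OF free_space.subspace_span subW] _ free_space.fin_gen_sums[OF finB finW]] fh[of "Suc n"]
    by simp
  also have "\<dots> \<le> free_space.dim (free_space.span B) + free_space.dim ?W"
    using free_space.dim_sums_Int_fin_gen[OF free_space.subspace_span subW finB finW] by simp
  finally show ?thesis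
    using W dimB hdim_eq[of "Suc n"] by simp
qed

lemma z_kernel_eq_if_hdim: "hdim (Suc n) = hdim n + n + 2 \<Longrightarrow> z_kernel n = I_homog n"
  using hdim_upper[of n] hdim_eq[of n]
  by (intro free_space.subspace_dim_equal_fin_gen[OF subspace_I_homog subspace_z_kernel
        I_homog_subset_z_kernel fin_gen_z_kernel, symmetric]) simp

text \<open>The cubic superpotential, which spans the intersection of \<open>R V\<close> and \<open>V R\<close>.\<close>

definition superpotential :: "(xyz, 'k) free" where
  "superpotential = (\<Sum>g\<in>UNIV. gen g * rel p q r g)"

text \<open>Cyclic invariance of the trilinear form.\<close>

lemma superpotential_eq: "superpotential = (\<Sum>k\<in>UNIV. rel p q r k * gen k)"
  unfolding superpotential_def
  by (simp add: sum_xyz rel_def quad_def lin_def tau_def algebra_simps const_left_commute)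

section \<open>Syzygies between the relations\<close>

definition syzygies :: "nat \<Rightarrow> (xyz, 'k) free set" where
  "syzygies n = lcomb (rel p q r) UNIV (free_homog n) \<inter> lcomb gen UNIV (I_homog (Suc n))"

text \<open>As the relations are right independent, an element of \<open>syzygies\<close> is a
  coefficient vector whose image under the second differential is zero in A. The first summand
  collects vectors that vanish in A, the second those coming from the last differential.\<close>

definition trivial_syzygies :: "nat \<Rightarrow> (xyz, 'k) free set" where
  "trivial_syzygies n = {x + y |x y. x \<in> lcomb (rel p q r) UNIV (I_homog (Suc n)) \<and>
     y \<in> (*) superpotential ` free_homog n}"

lemma trivial_syzygiesE:
  assumes "x \<in> trivial_syzygies n"
  obtains i f where "\<And>k. i k \<in> I_homog (Suc n)" "f \<in> free_homog n"
    "x = (\<Sum>k\<in>UNIV. rel p q r k * i k) + superpotential * f"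
proof -
  obtain y f where y: "y \<in> lcomb (rel p q r) UNIV (I_homog (Suc n))" and f: "f \<in> free_homog n"
    "x = y + superpotential * f"
    using assms unfolding trivial_syzygies_def by blast
  from y obtain i where "y = (\<Sum>k\<in>UNIV. rel p q r k * i k)" "\<And>k. i k \<in> I_homog (Suc n)"
    by (rule lcombE) blast
  then show thesis
    using that f by blast
qed

lemma rel_comb_eq_iff: "(\<Sum>k\<in>UNIV. rel p q r k * f k) = (\<Sum>k\<in>UNIV. rel p q r k * h k) \<longleftrightarrow> f = h"
proof
  assume "(\<Sum>k\<in>UNIV. rel p q r k * f k) = (\<Sum>k\<in>UNIV. rel p q r k * h k)"
  then have "(\<Sum>k\<in>UNIV. rel p q r k * (f k - h k)) = 0"
    by (simp add: right_diff_distrib sum_subtractf)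
  then show "f = h"
    using rel_left_independent[OF nonzero] by fastforce
qed simp

lemma superpotential_mult: "superpotential * f = (\<Sum>k\<in>UNIV. rel p q r k * (gen k * f))"
  "superpotential * f = (\<Sum>g\<in>UNIV. gen g * (rel p q r g * f))"
  by (simp add: superpotential_eq sum_distrib_right mult.assoc)
    (simp add: superpotential_def sum_distrib_right mult.assoc)

lemma trivial_syzygies_subset: "trivial_syzygies n \<subseteq> syzygies (Suc n)"
proof
  fix x assume "x \<in> trivial_syzygies n"
  then obtain i f where i: "\<And>k. i k \<in> I_homog (Suc n)" and f: "f \<in> free_homog n"
    and x: "x = (\<Sum>k\<in>UNIV. rel p q r k * i k) + superpotential * f"
    by (rule trivial_syzygiesE) blast
  have x1: "x = (\<Sum>k\<in>UNIV. rel p q r k * (i k + gen k * f))"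
    unfolding x superpotential_mult(1) by (simp add: distrib_left sum.distrib)
  have "i k + gen k * f \<in> free_homog (Suc n)" for k
    using i[of k] f by (auto intro!: free_homog_add free_homog_mult'[OF gen_in_free_homog])
  then have 1: "x \<in> lcomb (rel p q r) UNIV (free_homog (Suc n))"
    unfolding x1 by (rule lcombI)
  have "(\<Sum>k\<in>UNIV. rel p q r k * i k) = (\<Sum>g\<in>UNIV. gen g * (\<Sum>k\<in>UNIV. lin (tau p q r k g) * i k))"
    unfolding rel_def quad_def sum_distrib_left sum_distrib_right mult.assoc by (rule sum.swap)
  then have x2: "x = (\<Sum>g\<in>UNIV. gen g * ((\<Sum>k\<in>UNIV. lin (tau p q r k g) * i k) + rel p q r g * f))"
    unfolding x superpotential_mult(2) by (simp add: distrib_left sum.distrib)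
  have "(\<Sum>k\<in>UNIV. lin (tau p q r k g) * i k) + rel p q r g * f \<in> I_homog (Suc (Suc n))" for g
    using i f
    by (auto intro!: I_add I_sum free_homog_add free_homog_sum free_homog_mult'[OF lin_in_free_homog]
        rel_mult_in_free_homog)
  then have "x \<in> lcomb gen UNIV (I_homog (Suc (Suc n)))"
    unfolding x2 by (rule lcombI)
  with 1 show "x \<in> syzygies (Suc n)"
    by (simp add: syzygies_def)
qed

lemma subspace_syzygies: "free_space.subspace (syzygies n)"
  unfolding syzygies_def
  by (intro free_space.subspace_inter subspace_lcomb subspace_free_homog subspace_I_homog)

lemma fin_gen_syzygies: "free_space.fin_gen (syzygies n)"
  unfolding syzygies_def
  using dim_lcomb[OF finite subspace_I_homog fin_gen_I_homog gen_comb_eq_0]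
  by (meson free_space.fin_gen_subset Int_lower2)

lemma inj_superpotential: "inj_on ((*) superpotential) N"
proof (rule inj_onI)
  fix x y assume "superpotential * x = superpotential * y"
  then have "(\<lambda>k. gen k * x) = (\<lambda>k. gen k * y)"
    unfolding superpotential_mult(1) rel_comb_eq_iff .
  then have "dl Gx (gen Gx * x) = dl Gx (gen Gx * y)"
    by metis
  then show "x = y"
    by simp
qed

lemma trivial_syzygies_facts:
  assumes "z_kernel n = I_homog n"
  shows "free_space.subspace (trivial_syzygies n)"
    and "3 * free_space.dim (I_homog (Suc n)) + 3 ^ n \<le>
      free_space.dim (trivial_syzygies n) + free_space.dim (I_homog n)"
proof -
  let ?R = "lcomb (rel p q r) UNIV (I_homog (Suc n))" and ?U = "(*) superpotential ` free_homog n"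
  note fh = dim_free_homog[where ?'g = xyz and ?'k = 'k]
  have R: "free_space.fin_gen ?R \<and> free_space.dim ?R = 3 * free_space.dim (I_homog (Suc n))"
    using dim_lcomb[OF finite subspace_I_homog fin_gen_I_homog rel_left_independent[OF nonzero]] by simp
  have subR: "free_space.subspace ?R"
    by (rule subspace_lcomb[OF subspace_I_homog])
  note U = free_space.dim_image_fin_gen[OF linear_mult_left subspace_free_homog inj_superpotential, of n,
      OF fh[THEN conjunct1]]
  note K = free_space.dim_image_fin_gen[OF linear_mult_left subspace_I_homog inj_superpotential, OF fin_gen_I_homog, of n]
  show "free_space.subspace (trivial_syzygies n)"
    unfolding trivial_syzygies_def by (rule free_space.subspace_sums[OF subR U(3)])
  \<comment> \<open>The relations have coefficients x f, y f and z f in the superpotential times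
    \<open>f\<close>. If all of them lie in \<open>I\<close>, then z f does, and the assumed
    injectivity puts \<open>f\<close> into \<open>I\<close>.\<close>
  have "?R \<inter> ?U \<subseteq> (*) superpotential ` I_homog n"
  proof
    fix x assume x: "x \<in> ?R \<inter> ?U"
    then obtain f where f: "f \<in> free_homog n" "x = superpotential * f"
      by blast
    from x have "x \<in> ?R" ..
    then obtain i where i: "x = (\<Sum>k\<in>UNIV. rel p q r k * i k)" "\<And>k. i k \<in> I_homog (Suc n)"
      by (rule lcombE) blast
    have "i = (\<lambda>k. gen k * f)"
      using f(2) i(1) unfolding superpotential_mult(1) by (metis rel_comb_eq_iff)
    then have "gen Gz * f \<in> I"
      using i(2)[of Gz] by simp
    then have "f \<in> I_homog n"
      using f(1) assms by (auto simp: z_kernel_def)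
    then show "x \<in> (*) superpotential ` I_homog n"
      using f(2) by blast
  qed
  then have "free_space.dim (?R \<inter> ?U) \<le> free_space.dim (I_homog n)"
    using free_space.dim_mono_fin_gen[OF free_space.subspace_inter[OF subR U(3)] K(3) _ K(2)] K(1) by simp
  then show "3 * free_space.dim (I_homog (Suc n)) + 3 ^ n \<le>
      free_space.dim (trivial_syzygies n) + free_space.dim (I_homog n)"
    using free_space.dim_sums_Int_fin_gen[OF subR U(3) conjunct1[OF R] U(2)] R U(1) fh[of n]
    unfolding trivial_syzygies_def by simp
qed

section \<open>The Hilbert series\<close>

lemma choose_two_Suc: "(Suc n + 2) choose 2 = ((n + 2) choose 2) + n + 2"
  by (simp add: numeral_2_eq_2)

text \<open>For a_n = dim A_n, the syzygies give a_n - 3 a_(n-1) + 3 a_(n-2) - a_(n-3) >= 0 and the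
  line module gives a_n <= a_(n-1) + n + 1. With the binomials in lower degrees, both bounds equal
  the binomial for n.\<close>

lemma hdim_eq_choose: "hdim n = (n + 2) choose 2"
proof (induction n rule: less_induct)
  case (less n)
  consider "n = 0" | "n = Suc 0" | "n = Suc (Suc 0)" | m where "n = Suc (Suc (Suc m))"
    by (metis not0_implies_Suc)
  then show ?case
  proof cases
    case 1
    then show ?thesis
      by (simp add: hdim_low numeral_2_eq_2)
  next
    case 2
    then show ?thesis
      by (simp add: hdim_low choose_two)
  next
    case 3
    then show ?thesis
      using hdim_eq[of n] dim_I_homog_2[OF nonzero] by (simp add: choose_two)
  next
    case (4 m)
    have IH: "hdim m = (m + 2) choose 2" "hdim (Suc m) = (Suc m + 2) choose 2"
      "hdim (Suc (Suc m)) = (Suc (Suc m) + 2) choose 2"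
      using less.IH 4 by auto
    \<comment> \<open>The dimensions in degrees \<open>m\<close> and \<open>m + 1\<close> are
      already known, so the slack in \<open>hdim_upper\<close> is gone there.\<close>
    have K: "z_kernel m = I_homog m"
      using IH choose_two_Suc by (intro z_kernel_eq_if_hdim) simp
    have "free_space.dim (trivial_syzygies m) \<le> free_space.dim (syzygies (Suc m))"
      by (rule free_space.dim_mono_fin_gen[OF trivial_syzygies_facts(1)[OF K] subspace_syzygies
            trivial_syzygies_subset fin_gen_syzygies])
    \<comment> \<open>The Euler characteristic in degree \<open>m + 3\<close>, as an inequality
      because further syzygies are not yet excluded.\<close>
    then have "3 * hdim (Suc (Suc m)) + hdim m \<le> hdim n + 3 * hdim (Suc m)"
      using trivial_syzygies_facts(2)[OF K] hdim_step[OF nonzero, of "Suc m"] 4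
        hdim_eq[of n] hdim_eq[of "Suc (Suc m)"] hdim_eq[of "Suc m"] hdim_eq[of m]
      unfolding syzygies_def by simp
    moreover have "hdim n \<le> hdim (Suc (Suc m)) + m + 4"
      using hdim_upper[of "Suc (Suc m)"] dim_z_kernel_ge[of "Suc (Suc m)"] hdim_eq[of "Suc (Suc m)"] 4
      by simp
    ultimately show ?thesis
      using IH choose_two_Suc[of m] choose_two_Suc[of "Suc m"] choose_two_Suc[of "Suc (Suc m)"] 4 by simp
  qed
qed

lemma PHS: "PHS (sklyanin p q r)"
  unfolding sklyanin_eq PHS_iff by (simp add: hdim_eq_choose)

lemma z_kernel_eq: "z_kernel n = I_homog n"
  using choose_two_Suc[of n] by (intro z_kernel_eq_if_hdim) (simp add: hdim_eq_choose)

text \<open>Once the Hilbert series is known, the dimension count leaves no room for further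
  syzygies.\<close>

lemma syzygies_eq: "syzygies (Suc n) = trivial_syzygies n"
proof (rule free_space.subspace_dim_equal_fin_gen[OF trivial_syzygies_facts(1)[OF z_kernel_eq]
      subspace_syzygies trivial_syzygies_subset fin_gen_syzygies, symmetric])
  show "free_space.dim (syzygies (Suc n)) \<le> free_space.dim (trivial_syzygies n)"
    using trivial_syzygies_facts(2)[OF z_kernel_eq, of n] hdim_step[OF nonzero, of "Suc n"]
      hdim_eq[of "Suc (Suc (Suc n))"] hdim_eq[of "Suc (Suc n)"] hdim_eq[of "Suc n"] hdim_eq[of n]
      choose_two_Suc[of n] choose_two_Suc[of "Suc n"] choose_two_Suc[of "Suc (Suc n)"]
    unfolding syzygies_def by (simp add: hdim_eq_choose)
qed

section \<open>Exactness of the complex\<close>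

lemma in_I_if_hcomp:
  assumes "\<And>n. hcomp n f \<in> I"
  shows "f \<in> I"
  using sum_hcomp[OF finite_hcomp, of f] I_sum[of _ "\<lambda>n. hcomp n f"] assms by (metis order_refl)

lemma exact_3: "(\<forall>g. gen g * f \<in> I) \<longleftrightarrow> f \<in> I"
proof
  assume f: "\<forall>g. gen g * f \<in> I"
  show "f \<in> I"
  proof (rule in_I_if_hcomp)
    fix n
    have "gen Gz * hcomp n f \<in> I"
      using I_hcomp[of "gen Gz * f" "Suc n"] f hcomp_mult_left[OF gen_in_free_homog, of "Suc n" Gz f] by simp
    then have "hcomp n f \<in> z_kernel n"
      by (simp add: z_kernel_def)
    then show "hcomp n f \<in> I"
      using z_kernel_eq by blast
  qed
qed blast

text \<open>Combining the relations with coefficients \<open>f\<close> turns a cycle into a syzygy;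
  its trivial form, compared coefficient by coefficient, shows it to be a boundary.\<close>

lemma exact_2_homog:
  assumes f: "\<And>k. f k \<in> free_homog n"
    and ker: "\<And>g. (\<Sum>k\<in>UNIV. lin (tau p q r k g) * f k) \<in> I"
  shows "\<exists>h. \<forall>k. f k - gen k * h \<in> I"
proof -
  have "(\<Sum>k\<in>UNIV. rel p q r k * f k) = (\<Sum>g\<in>UNIV. gen g * (\<Sum>k\<in>UNIV. lin (tau p q r k g) * f k))"
    unfolding rel_def quad_def sum_distrib_left sum_distrib_right mult.assoc by (rule sum.swap)
  also have "\<dots> \<in> lcomb gen UNIV (I_homog (Suc n))"
    using ker f by (auto intro!: lcombI free_homog_sum free_homog_mult'[OF lin_in_free_homog])
  finally have "(\<Sum>k\<in>UNIV. rel p q r k * f k) \<in> lcomb gen UNIV (I_homog (Suc n))" .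
  then have syz: "(\<Sum>k\<in>UNIV. rel p q r k * f k) \<in> syzygies n"
    unfolding syzygies_def using lcombI[of UNIV f "free_homog n" "rel p q r", OF f] by blast
  show ?thesis
  proof (cases n)
    case 0
    have "(\<Sum>k\<in>UNIV. rel p q r k * f k) = 0"
      using syz 0 by (simp add: syzygies_def I_homog_low lcomb_zero)
    then have "f k = 0" for k
      using rel_left_independent[OF nonzero] by blast
    then show ?thesis
      by (intro exI[of _ 0]) simp
  next
    case (Suc m)
    then have "(\<Sum>k\<in>UNIV. rel p q r k * f k) \<in> trivial_syzygies m"
      using syz syzygies_eq by simp
    then obtain i h where i: "\<And>k. i k \<in> I_homog (Suc m)"
      and eq: "(\<Sum>k\<in>UNIV. rel p q r k * f k) = (\<Sum>k\<in>UNIV. rel p q r k * i k) + superpotential * h"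
      by (rule trivial_syzygiesE) blast
    have "(\<Sum>k\<in>UNIV. rel p q r k * f k) = (\<Sum>k\<in>UNIV. rel p q r k * (i k + gen k * h))"
      unfolding eq superpotential_mult(1) by (simp add: distrib_left sum.distrib)
    then have "f = (\<lambda>k. i k + gen k * h)"
      unfolding rel_comb_eq_iff .
    then show ?thesis
      using i by (intro exI[of _ h]) simp
  qed
qed

lemma exact_2: "(\<forall>g. (\<Sum>k\<in>UNIV. lin (tau p q r k g) * f k) \<in> I) \<longleftrightarrow> (\<exists>h. \<forall>k. f k - gen k * h \<in> I)"
proof
  assume ker: "\<forall>g. (\<Sum>k\<in>UNIV. lin (tau p q r k g) * f k) \<in> I"
  have "\<exists>h. \<forall>k. hcomp n (f k) - gen k * h \<in> I" for n
  proof (rule exact_2_homog[OF hcomp_in_free_homog])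
    fix g
    have "hcomp (Suc n) (\<Sum>k\<in>UNIV. lin (tau p q r k g) * f k) = (\<Sum>k\<in>UNIV. lin (tau p q r k g) * hcomp n (f k))"
      using hcomp_lcomb[of UNIV "\<lambda>k. lin (tau p q r k g)" "Suc 0" "Suc n" f] by simp
    then show "(\<Sum>k\<in>UNIV. lin (tau p q r k g) * hcomp n (f k)) \<in> I"
      using ker I_hcomp by metis
  qed
  then obtain h where h: "\<And>n k. hcomp n (f k) - gen k * h n \<in> I"
    by metis
  \<comment> \<open>A finite set of degrees common to the three coefficients, so that a single
    \<open>h\<close> can be summed up for all of them.\<close>
  let ?N = "\<Union>k. {n. hcomp n (f k) \<noteq> 0}"
  have N: "finite ?N"
    by (simp add: finite_hcomp)
  have "f k - gen k * (\<Sum>n\<in>?N. h n) = (\<Sum>n\<in>?N. hcomp n (f k) - gen k * h n)" for k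
  proof -
    have "(\<Sum>n\<in>?N. hcomp n (f k)) = f k"
      by (rule sum_hcomp[OF N]) blast
    then show ?thesis
      by (simp add: sum_subtractf sum_distrib_left)
  qed
  then have "f k - gen k * (\<Sum>n\<in>?N. h n) \<in> I" for k
    using h by (simp add: I_sum)
  then show "\<exists>h. \<forall>k. f k - gen k * h \<in> I"
    by blast
next
  assume "\<exists>h. \<forall>k. f k - gen k * h \<in> I"
  then obtain h where h: "\<And>k. f k - gen k * h \<in> I"
    by blast
  show "\<forall>g. (\<Sum>k\<in>UNIV. lin (tau p q r k g) * f k) \<in> I"
  proof
    fix g
    \<comment> \<open>Stripping the first letter from the two expressions for the superpotential
      shows that consecutive differentials compose to relations.\<close>
    have "(\<Sum>k\<in>UNIV. lin (tau p q r k g) * gen k) = rel p q r g"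
    proof -
      have "dl g superpotential = (\<Sum>k\<in>UNIV. lin (tau p q r k g) * gen k)"
        unfolding superpotential_eq by (simp add: rel_def dl_quad_mult)
      then show ?thesis
        by (simp add: superpotential_def)
    qed
    then have "(\<Sum>k\<in>UNIV. lin (tau p q r k g) * (gen k * h)) = rel p q r g * h"
      by (simp add: mult.assoc[symmetric] flip: sum_distrib_right)
    then have "(\<Sum>k\<in>UNIV. lin (tau p q r k g) * (gen k * h)) \<in> I"
      by auto
    moreover have "(\<Sum>k\<in>UNIV. lin (tau p q r k g) * (f k - gen k * h)) \<in> I"
      using h by blast
    ultimately show "(\<Sum>k\<in>UNIV. lin (tau p q r k g) * f k) \<in> I"
      using I_diff_cong by (simp add: right_diff_distrib sum_subtractf)
  qed
qed

lemma exact_1: "(\<Sum>g\<in>UNIV. gen g * f g) \<in> I \<longleftrightarrow>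
    (\<exists>h. \<forall>g. f g - (\<Sum>k\<in>UNIV. lin (tau p q r k g) * h k) \<in> I)"
  using gen_comb_in_I_iff[of f] by (simp add: rel_def)

lemma koszul: "koszul (sklyanin p q r)"
proof -
  \<comment> \<open>The ranks are 3, 3, 1 in positions 1, 2, 3 and 0 afterwards. The matrix of
    position 1 is that of the relations, and position 2 is the column of generators.\<close>
  define n :: "nat \<Rightarrow> nat" where "n m = (if m \<le> 2 then 3 else if m = 3 then 1 else 0)" for m
  define D :: "nat \<Rightarrow> nat \<Rightarrow> nat \<Rightarrow> (xyz, 'k) free" where
    "D m i j = (if m = 1 then lin (tau p q r (idx j) (idx i)) else gen (idx i))" for m i j
  show ?thesis
    unfolding sklyanin_eq
  proof (rule koszul_if_exact[where n = n and D\<^sub>1 = "\<lambda>j. gen (idx j)" and D = D])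
    show "D m i j \<in> free_homog 1" for m i j
      by (simp add: D_def)
    show "\<exists>w. f - (\<Sum>j<n 1. gen (idx j) * w j) \<in> I" if "Poly_Mapping.lookup f [] = 0" for f
      using augmentation_exact[OF that] by (simp add: n_def)
    show "(\<Sum>j<n 1. gen (idx j) * v j) \<in> I \<longleftrightarrow>
        (\<exists>w. \<forall>i<n 1. v i - (\<Sum>j<n 2. D 1 i j * w j) \<in> I)" for v
      using exact_1[of "\<lambda>g. v (pos g)"]
        ex_pos[of "\<lambda>w. \<forall>g. v (pos g) - (\<Sum>k\<in>UNIV. lin (tau p q r k g) * w k) \<in> I"]
      by (simp add: n_def D_def sum_pos all_pos)
    fix m :: nat and v :: "nat \<Rightarrow> (xyz, 'k) free"
    assume "m \<ge> 1"
    then consider "m = 1" | "m = 2" | "m \<ge> 3"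
      by linarith
    then show "(\<forall>i<n m. (\<Sum>j<n (Suc m). D m i j * v j) \<in> I) \<longleftrightarrow>
        (\<exists>w. \<forall>i<n (Suc m). v i - (\<Sum>j<n (Suc (Suc m)). D (Suc m) i j * w j) \<in> I)"
    proof cases
      case 1
      have "(\<exists>w :: nat \<Rightarrow> (xyz, 'k) free. Q (w 0)) \<longleftrightarrow> (\<exists>h. Q h)" for Q
        by (auto intro: exI[of _ "\<lambda>_. _"])
      from this[of "\<lambda>h. \<forall>g. v (pos g) - gen g * h \<in> I"] show ?thesis
        using exact_2[of "\<lambda>g. v (pos g)"] 1
        by (simp add: n_def D_def sum_pos all_pos)
    next
      case 2
      then show ?thesis
        using exact_3[of "v 0"] by (simp add: n_def D_def all_pos)
    next
      case 3
      then show ?thesis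
        by (simp add: n_def)
    qed
  qed simp
qed

end

theorem theorem1p1:
  fixes p q r :: "'k::field"
  shows "koszul (sklyanin p q r) \<and>
    (PHS (sklyanin p q r) \<longleftrightarrow>
       (p \<noteq> 0 \<and> q \<noteq> 0 \<or> p \<noteq> 0 \<and> r \<noteq> 0 \<or> q \<noteq> 0 \<and> r \<noteq> 0) \<and>
       \<not> (p ^ 3 = q ^ 3 \<and> q ^ 3 = r ^ 3))"
proof -
  let ?two = "p \<noteq> 0 \<and> q \<noteq> 0 \<or> p \<noteq> 0 \<and> r \<noteq> 0 \<or> q \<noteq> 0 \<and> r \<noteq> 0"
  consider "?two" "\<not> (p ^ 3 = q ^ 3 \<and> q ^ 3 = r ^ 3)"
    | "?two" "p ^ 3 = q ^ 3" "q ^ 3 = r ^ 3"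
    | "p = 0" "q = 0" "r = 0"
    | "\<not> ?two" "p \<noteq> 0 \<or> q \<noteq> 0 \<or> r \<noteq> 0"
    by blast
  then show ?thesis
  proof cases
    case 1
    then interpret generic_sklyanin p q r
      by unfold_locales
    show ?thesis
      using koszul PHS 1 by blast
  next
    case 2
    \<comment> \<open>Equal cubes vanish together, so two nonzero parameters force the
      third.\<close>
    then have "p \<noteq> 0" "q \<noteq> 0" "r \<noteq> 0"
      by auto
    note res = periodic_resolution_cubes[OF this 2(2,3)]
    show ?thesis
      using periodic_resolution.koszul[OF res] periodic_resolution.not_PHS[OF res] 2 by blast
  next
    case 3
    then show ?thesis
      using koszul_free by simp
  next
    case 4
    then obtain c \<sigma> where c: "c \<noteq> 0" and \<sigma>: "(p = 0 \<and> q = 0 \<and> r = c \<and> \<sigma> = id) \<or>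
        (p = c \<and> q = 0 \<and> r = 0 \<and> \<sigma> = nxt) \<or> (p = 0 \<and> q = c \<and> r = 0 \<and> \<sigma> = nxt \<circ> nxt)"
      by metis
    note res = periodic_resolution_monomial[OF this]
    show ?thesis
      using periodic_resolution.koszul[OF res] periodic_resolution.not_PHS[OF res] 4 by blast
  qed
qed

end
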